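(* Let $q$ be a fixed odd prime power and let $\kappa$ be any positive real number. For a positive integer $g$ set \[ \sigma=\frac12+\frac{\kappa}{\ln g}. \] For any $\epsilon\in(0,1/2)$, as $g\to\infty$, \[ \max_{P\in\mathcal{P}_{2g+1}}\left|L\left(\sigma,\chi_P\right)\right|\geq \exp\left( (C(\kappa)+o(1))\sqrt{\frac{g\,\ln_2 g}{\ln g}}\right), \] where \[ C(\kappa)=e^{-3\kappa}\sqrt{\left(\frac12-\epsilon\right)\ln q}. \]
   Context: $\ln$ is the natural logarithm and $\ln_2 g=\ln\ln g$. $\mathbb{F}_q$ is the finite field with $q$ elements ($q$ an odd prime power). $\mathcal{M}$ denotes the set of monic polynomials in $\mathbb{F}_q[t]$, and $\mathcal{P}_n$ the set of monic irreducible polynomials of degree $n$ in $\mathbb{F}_q[t]$. For nonzero $A\in\mathbb{F}_q[t]$, $|A|=q^{\deg A}$. For a monic irreducible polynomial $P$, $\chi_P(A)=\left(\frac{A}{P}\right)$ is the quadratic residue symbol: it equals $1$ if $P\nmid A$ and $A$ is a square modulo $P$, $-1$ if $P\nmid A$ and $A$ is not a square modulo $P$, and $0$ if $P\mid A$. The $L$-function is $L(s,\chi_P)=\sum_{A\in\mathcal{M}}\chi_P(A)|A|^{-s}$ for $\Re(s)>1$, extended to all $s\in\mathbb{C}$ by analytic continuation (it is a polynomial in $q^{-s}$). Here $q,\kappa,\epsilon$ are fixed, and the $o(1)$ term tends to $0$ as $g\to\infty$. *)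

theory Defs
  imports
    "HOL-Complex_Analysis.Complex_Analysis"
    "HOL-Computational_Algebra.Polynomial_Factorial"
    "HOL-Number_Theory.Cong"
begin

text \<open>The finite field with \<open>q\<close> elements is a type \<open>'a :: {finite, field}\<close>, with \<open>q = CARD('a)\<close>.\<close>

definition monic_polys :: "'a :: {finite, field} poly set" where
  "monic_polys = {A. lead_coeff A = 1}"

definition monic_irreducibles :: "nat \<Rightarrow> 'a :: {finite, field} poly set" where
  "monic_irreducibles n = {P. lead_coeff P = 1 \<and> irreducible P \<and> degree P = n}"

definition poly_norm :: "'a :: {finite, field} poly \<Rightarrow> real" where
  "poly_norm A = (if A = 0 then 0 else real CARD('a) ^ degree A)"

definition quad_char :: "'a :: {finite, field} poly \<Rightarrow> 'a poly \<Rightarrow> int" where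
  "quad_char P A = (if P dvd A then 0 else if (\<exists>B. [B\<^sup>2 = A] (mod P)) then 1 else -1)"

definition L_series :: "('a :: {finite, field} poly \<Rightarrow> int) \<Rightarrow> complex \<Rightarrow> complex" where
  "L_series \<psi> s = (\<Sum>\<^sub>\<infinity>A\<in>monic_polys. of_int (\<psi> A) * of_real (poly_norm A) powr (-s))"

text \<open>
  The \<open>L\<close>-function is the entire function that agrees with the series on the half-plane
  \<open>Re s > 1\<close>; for \<open>\<psi> = quad_char P\<close> such a function exists and is unique, see
  \<open>L_function_well_defined\<close> below.
\<close>
definition L_function :: "('a :: {finite, field} poly \<Rightarrow> int) \<Rightarrow> complex \<Rightarrow> complex" where
  "L_function \<psi> = (THE f. f holomorphic_on UNIV \<and> (\<forall>s. Re s > 1 \<longrightarrow> f s = L_series \<psi> s))"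


subsection \<open>The $L$-function is well defined\<close>

definition monic_of_degree :: "nat \<Rightarrow> 'a :: {finite, field} poly set" where
  "monic_of_degree n = {A. lead_coeff A = 1 \<and> degree A = n}"

lemma finite_card_monic_of_degree:
  "finite (monic_of_degree n :: 'a :: {finite, field} poly set)"
  "card (monic_of_degree n :: 'a poly set) \<le> CARD('a) ^ n"
proof -
  let ?M = "monic_of_degree n :: 'a poly set"
  let ?f = "\<lambda>A :: 'a poly. map (coeff A) [0..<n]"
  let ?L = "{xs :: 'a list. set xs \<subseteq> UNIV \<and> length xs = n}"
  have inj: "inj_on ?f ?M"
  proof (rule inj_onI)
    fix A B :: "'a poly" assume A: "A \<in> ?M" and B: "B \<in> ?M" and eq: "?f A = ?f B"
    have "coeff A i = coeff B i" for i
    proof (cases i n rule: linorder_cases)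
      case less
      then show ?thesis using eq by (auto simp: map_eq_conv)
    next
      case equal
      then show ?thesis using A B by (auto simp: monic_of_degree_def)
    next
      case greater
      then show ?thesis using A B by (auto simp: monic_of_degree_def coeff_eq_0)
    qed
    then show "A = B" by (simp add: poly_eq_iff)
  qed
  have sub: "?f ` ?M \<subseteq> ?L" by auto
  have fin: "finite ?L" by (rule finite_lists_length_eq) simp
  show "finite ?M" using inj sub fin by (rule inj_on_finite)
  have "card ?M \<le> card ?L" using inj sub fin by (rule card_inj_on_le)
  also have "card ?L = CARD('a) ^ n"
    by (subst card_lists_length_eq) simp_all
  finally show "card ?M \<le> CARD('a) ^ n" .
qed

lemma finite_monic_irreducibles: "finite (monic_irreducibles n)"
  by (rule finite_subset[OF _ finite_card_monic_of_degree(1)[of n]])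
     (auto simp: monic_irreducibles_def monic_of_degree_def)

lemma finite_degree_less: "finite {A :: 'a :: {finite, field} poly. degree A < d}"
proof -
  let ?g = "\<lambda>A. A - monom (1 :: 'a) d"
  have "{A :: 'a poly. degree A < d} \<subseteq> ?g ` monic_of_degree d"
  proof
    fix A :: "'a poly" assume "A \<in> {A. degree A < d}"
    then have d: "degree A < d" by simp
    have deg: "degree (A + monom 1 d) = d"
      using d by (simp add: degree_add_eq_right degree_monom_eq)
    have "A + monom 1 d \<in> monic_of_degree d"
      using d unfolding monic_of_degree_def by (simp add: deg coeff_eq_0)
    moreover have "A = ?g (A + monom 1 d)" by simp
    ultimately show "A \<in> ?g ` monic_of_degree d" by blast
  qed
  then show ?thesis using finite_card_monic_of_degree(1) finite_surj by blast
qed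

lemma abs_quad_char_le: "\<bar>quad_char P A\<bar> \<le> 1"
  by (simp add: quad_char_def)

lemma quad_char_mod: "quad_char P (A mod P) = quad_char P A"
  by (simp add: quad_char_def cong_def dvd_mod_iff)

lemma sum_quad_char_residues:
  fixes P :: "'a :: {finite, field} poly"
  assumes odd: "odd CARD('a)" and irr: "irreducible P"
  shows "(\<Sum>B | degree B < degree P. quad_char P B) = 0"
proof -
  define d where "d = degree P"
  define R where "R = {B :: 'a poly. degree B < d \<and> B \<noteq> 0}"
  define f where "f = (\<lambda>B :: 'a poly. B\<^sup>2 mod P)"
  have P0: "P \<noteq> 0" using irr by auto
  have prime: "prime_elem P" using irr by (rule field_poly_irreducible_imp_prime)
  have d0: "d > 0"
    using irr P0 unfolding d_def by (metis gr0I irreducible_def is_unit_iff_degree)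
  have finR: "finite R"
    by (rule finite_subset[OF _ finite_degree_less[of d]]) (auto simp: R_def)
  have ndvd: "\<not> P dvd B" if "B \<in> R" for B
    using that dvd_imp_degree_le[of P B] by (auto simp: R_def d_def)
  have two: "(2 :: 'a) \<noteq> 0"
  proof
    assume *: "(2 :: 'a) = 0"
    have "inj (\<lambda>x :: 'a. x + 1)" by (simp add: inj_def)
    have "even (card (UNIV :: 'a set))"
    proof -
      have eq: "x + 1 + 1 = x" for x :: 'a
        using * by (metis add.assoc add.right_neutral one_add_one)
      define pairs where "pairs = (\<lambda>x :: 'a. {x, x + 1}) ` UNIV"
      have "card (\<Union>pairs) = (\<Sum>p\<in>pairs. card p)"
      proof (rule card_Union_disjoint)
        show "pairwise disjnt pairs"
          unfolding pairwise_def pairs_def disjnt_def using eq by auto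
      qed (auto simp: pairs_def)
      also have "\<dots> = (\<Sum>p\<in>pairs. 2)"
        by (intro sum.cong) (auto simp: pairs_def)
      finally have "even (card (\<Union>pairs))" by simp
      moreover have "\<Union>pairs = UNIV" by (auto simp: pairs_def)
      ultimately show ?thesis by simp
    qed
    with odd show False by simp
  qed
  have neg: "B \<noteq> -B" if "B \<in> R" for B :: "'a poly"
  proof
    assume "B = -B"
    then have "smult 2 B = 0"
      by (metis add.right_inverse one_add_one smult_1_left smult_add_left)
    then show False using that two by (simp add: R_def)
  qed
  have fR: "f B \<in> R" if "B \<in> R" for B
  proof -
    have "\<not> P dvd B\<^sup>2" using ndvd[OF that] prime prime_elem_dvd_power by blast
    then have "f B \<noteq> 0" by (simp add: f_def mod_eq_0_iff_dvd)
    moreover have "degree (f B) < d"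
      unfolding f_def d_def using degree_mod_less[OF P0, of "B\<^sup>2"] d0 by (auto simp: d_def)
    ultimately show ?thesis by (simp add: R_def)
  qed
  have fib: "{B \<in> R. f B = f C} = {C, -C}" if C: "C \<in> R" for C
  proof
    show "{C, -C} \<subseteq> {B \<in> R. f B = f C}" using C by (auto simp: R_def f_def)
    show "{B \<in> R. f B = f C} \<subseteq> {C, -C}"
    proof
      fix B assume "B \<in> {B \<in> R. f B = f C}"
      then have B: "B \<in> R" "f B = f C" by auto
      have "P dvd B\<^sup>2 - C\<^sup>2" using B(2) unfolding f_def by (simp add: mod_eq_dvd_iff)
      then have "P dvd (B - C) * (B + C)" by (simp add: power2_eq_square algebra_simps)
      then have "P dvd B - C \<or> P dvd B + C" using prime by (simp add: prime_elem_dvd_mult_iff)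
      moreover have "degree (B - C) < d" "degree (B + C) < d"
        using B(1) C by (auto simp: R_def intro: degree_diff_less degree_add_less)
      ultimately have "B - C = 0 \<or> B + C = 0"
        unfolding d_def by (meson dvd_imp_degree_le leD)
      then show "B \<in> {C, -C}" by (auto simp: add_eq_0_iff2)
    qed
  qed
  define S where "S = f ` R"
  have SR: "S \<subseteq> R" using fR by (auto simp: S_def)
  have "card R = (\<Sum>y\<in>S. card {B \<in> R. f B = y})"
    unfolding S_def using sum.image_gen[OF finR, of "\<lambda>_. 1 :: nat" f] by simp
  also have "\<dots> = (\<Sum>y\<in>S. 2)"
    by (intro sum.cong refl) (auto simp: S_def fib neg card_insert_if)
  finally have cR: "card R = 2 * card S" by simp
  have chi: "quad_char P B = (if B \<in> S then 1 else -1)" if B: "B \<in> R" for B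
  proof -
    have Bm: "B mod P = B" using B by (simp add: R_def d_def mod_poly_less)
    have "(\<exists>C. [C\<^sup>2 = B] (mod P)) \<longleftrightarrow> B \<in> S"
    proof
      assume "B \<in> S"
      then show "\<exists>C. [C\<^sup>2 = B] (mod P)" using Bm by (auto simp: S_def f_def cong_def)
    next
      assume "\<exists>C. [C\<^sup>2 = B] (mod P)"
      then obtain C where C: "C\<^sup>2 mod P = B" using Bm by (auto simp: cong_def)
      then have fC: "f (C mod P) = B" by (simp add: f_def power_mod)
      have "C mod P \<noteq> 0"
        using fC B by (auto simp: f_def R_def)
      moreover have "degree (C mod P) < d"
        using degree_mod_less[OF P0, of C] d0 by (auto simp: d_def)
      ultimately have "C mod P \<in> R" by (simp add: R_def)
      with fC show "B \<in> S" by (auto simp: S_def)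
    qed
    then show ?thesis using ndvd[OF B] by (simp add: quad_char_def)
  qed
  have fins: "finite S" using SR finR finite_subset by blast
  have "{B. degree B < degree P} = insert 0 R" using d0 by (auto simp: R_def d_def)
  then have "(\<Sum>B | degree B < degree P. quad_char P B) = (\<Sum>B\<in>R. quad_char P B)"
    using finR by (simp add: R_def quad_char_def)
  also have "\<dots> = (\<Sum>B\<in>R. if B \<in> S then 1 else -1)"
    by (intro sum.cong refl) (simp add: chi)
  also have "\<dots> = (\<Sum>B\<in>S. 1) + (\<Sum>B\<in>R - S. -1)"
    using SR finR by (subst sum.subset_diff[of S R]) (auto intro!: arg_cong2[where f = "(+)"] sum.cong)
  also have "\<dots> = int (card S) - int (card R - card S)"
    using card_Diff_subset[OF fins SR] by simp
  also have "\<dots> = 0" using cR by simp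
  finally show ?thesis .
qed

lemma sum_quad_char_monic:
  fixes P :: "'a :: {finite, field} poly"
  assumes odd: "odd CARD('a)" and irr: "irreducible P" and monic: "lead_coeff P = 1"
    and n: "n \<ge> degree P"
  shows "(\<Sum>A\<in>monic_of_degree n. quad_char P A) = 0"
proof -
  define d where "d = degree P"
  have P0: "P \<noteq> 0" using irr by auto
  have d0: "d > 0"
    using irr P0 unfolding d_def by (metis gr0I irreducible_def is_unit_iff_degree)
  let ?R = "{B :: 'a poly. degree B < d}"
  have "(\<Sum>A\<in>monic_of_degree n. quad_char P A) =
        (\<Sum>(Q, B)\<in>(monic_of_degree (n - d) :: 'a poly set) \<times> ?R. quad_char P B)"
  proof (rule sum.reindex_bij_witness[where j = "\<lambda>A. (A div P, A mod P)" and i = "\<lambda>(Q, B). P * Q + B"], goal_cases)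
    case (1 A)
    then show ?case by simp
  next
    case (2 A)
    have A: "lead_coeff A = 1" "degree A = n" using 2 by (auto simp: monic_of_degree_def)
    have R: "degree (A mod P) < d"
      using degree_mod_less[OF P0, of A] d0 by (auto simp: d_def)
    have eq: "A = P * (A div P) + A mod P" by simp
    have Q0: "A div P \<noteq> 0"
      using A n R eq by (metis add.left_neutral d_def leD mult_zero_right)
    have dPQ: "degree (P * (A div P)) = d + degree (A div P)"
      using Q0 P0 by (simp add: degree_mult_eq d_def)
    have dA: "degree A = d + degree (A div P)"
      using R dPQ degree_add_eq_left[of "A mod P" "P * (A div P)"] by simp
    have "coeff A (degree A) = coeff (P * (A div P)) (degree A) + coeff (A mod P) (degree A)"
      by (subst (1) eq) (rule coeff_add)
    also have "coeff (A mod P) (degree A) = 0" using R dA by (intro coeff_eq_0) simp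
    also have "coeff (P * (A div P)) (degree A) = lead_coeff (P * (A div P))"
      using dA dPQ by simp
    also have "\<dots> = lead_coeff (A div P)" using monic by (simp add: lead_coeff_mult)
    finally have "lead_coeff (A div P) = 1" using A by simp
    then show ?case using R dA A by (auto simp: monic_of_degree_def)
  next
    case (3 x)
    then obtain Q B where x: "x = (Q, B)" "Q \<in> monic_of_degree (n - d)" "degree B < d" by auto
    have "B mod P = B" "B div P = 0" using x by (simp_all add: mod_poly_less div_poly_less d_def)
    then show ?case using x P0 by (simp add: mod_add_eq[symmetric] poly_div_add_left)
  next
    case (4 x)
    then obtain Q B where x: "x = (Q, B)" "lead_coeff Q = 1" "degree Q = n - d" "degree B < d"
      by (auto simp: monic_of_degree_def)
    have Q0: "Q \<noteq> 0" using x by auto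
    have dPQ: "degree (P * Q) = n"
      using Q0 P0 n x by (simp add: degree_mult_eq d_def)
    have dB: "degree B < degree (P * Q)" using dPQ n x by (simp add: d_def)
    have "degree (P * Q + B) = n" using dB dPQ by (simp add: degree_add_eq_left)
    moreover have "lead_coeff (P * Q + B) = lead_coeff (P * Q)"
      using dB by (simp add: lead_coeff_add_le degree_add_eq_left coeff_eq_0)
    ultimately show ?case using x monic by (simp add: monic_of_degree_def lead_coeff_mult)
  next
    case (5 A)
    then show ?case by (simp add: quad_char_mod)
  qed
  also have "\<dots> = (\<Sum>Q\<in>(monic_of_degree (n - d) :: 'a poly set). \<Sum>B\<in>?R. quad_char P B)"
    by (rule sum.cartesian_product[symmetric])
  also have "\<dots> = 0" using sum_quad_char_residues[OF odd irr] by (simp add: d_def)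
  finally show ?thesis .
qed

lemma L_series_eq_sum:
  fixes \<psi> :: "'a :: {finite, field} poly \<Rightarrow> int"
  assumes bound: "\<And>A. \<bar>\<psi> A\<bar> \<le> 1"
    and zero: "\<And>n. n \<ge> d \<Longrightarrow> (\<Sum>A\<in>monic_of_degree n. \<psi> A) = 0"
    and s: "Re s > 1"
  shows "((\<lambda>A. of_int (\<psi> A) * of_real (poly_norm A) powr (-s)) has_sum
           (\<Sum>n<d. of_int (\<Sum>A\<in>monic_of_degree n. \<psi> A) * of_real (real CARD('a) ^ n) powr (-s)))
         monic_polys"
proof -
  define q where "q = real CARD('a)"
  have q1: "q > 1"
    unfolding q_def using card_mono[of UNIV "{0, 1 :: 'a}"] by simp
  let ?N = "monic_of_degree :: nat \<Rightarrow> 'a poly set"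
  define h where "h = (\<lambda>A :: 'a poly. complex_of_int (\<psi> A) * of_real (poly_norm A) powr (-s))"
  define w where "w = (\<lambda>n. complex_of_real (q ^ n) powr (-s))"
  have h: "h A = of_int (\<psi> A) * w n" if "A \<in> ?N n" for A n
    using that by (auto simp: h_def w_def monic_of_degree_def poly_norm_def q_def)
  have nw: "norm (w n) = (q powr - Re s) ^ n" for n
    using q1 by (simp add: w_def norm_powr_real_powr powr_realpow[symmetric] powr_powr
        powr_power mult.commute del: of_real_power)
  have fin: "finite (?N n)" for n by (rule finite_card_monic_of_degree)
  have g: "((\<lambda>A. h A) has_sum of_int (\<Sum>A\<in>?N n. \<psi> A) * w n) (?N n)" for n
  proof -
    have "(\<Sum>A\<in>?N n. h A) = of_int (\<Sum>A\<in>?N n. \<psi> A) * w n"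
      by (simp add: h sum_distrib_right)
    then show ?thesis using has_sum_finite[OF fin, of h n] by simp
  qed
  have abs: "(\<lambda>x. norm (case x of (n, A) \<Rightarrow> h A)) summable_on Sigma UNIV ?N"
  proof (subst Infinite_Sum.abs_summable_on_Sigma_iff, intro conjI ballI)
    fix n show "(\<lambda>y. norm (case (n, y) of (n, A) \<Rightarrow> h A)) summable_on ?N n"
      using fin by simp
  next
    define r where "r = q powr (1 - Re s)"
    have r: "0 \<le> r" "r < 1" using q1 s by (auto simp: r_def powr_less_one)
    have "(\<lambda>n. r ^ n) summable_on UNIV"
      using r by (intro norm_summable_imp_summable_on) (simp add: summable_geometric)
    moreover have "norm (infsum (\<lambda>y. norm (case (n, y) of (n, A) \<Rightarrow> h A)) (?N n)) \<le> r ^ n" for n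
    proof -
      have "(\<Sum>A\<in>?N n. norm (h A)) \<le> (\<Sum>A\<in>?N n. (q powr - Re s) ^ n)"
      proof (rule sum_mono)
        fix A assume A: "A \<in> ?N n"
        have "\<bar>real_of_int (\<psi> A)\<bar> \<le> 1" using bound[of A] by linarith
        then show "norm (h A) \<le> (q powr - Re s) ^ n"
          using h[OF A] by (simp add: norm_mult nw mult_left_le_one_le)
      qed
      also have "\<dots> = real (card (?N n)) * (q powr - Re s) ^ n" by simp
      also have "\<dots> \<le> q ^ n * (q powr - Re s) ^ n"
      proof (rule mult_right_mono)
        have "real (card (?N n)) \<le> real (CARD('a) ^ n)"
          using finite_card_monic_of_degree(2)[where 'a = 'a and n = n] of_nat_le_iff by blast
        then show "real (card (?N n)) \<le> q ^ n" by (simp add: q_def)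
      qed simp
      also have "\<dots> = r ^ n"
        using q1 by (simp add: r_def power_mult_distrib[symmetric] powr_diff powr_minus field_simps)
      finally show ?thesis using fin by (simp add: sum_nonneg)
    qed
    ultimately show "(\<lambda>n. norm (infsum (\<lambda>y. norm (case (n, y) of (n, A) \<Rightarrow> h A)) (?N n))) summable_on UNIV"
      by (intro Infinite_Sum.abs_summable_on_comparison_test'[of "\<lambda>n. r ^ n"]) auto
  qed
  have "((\<lambda>n. of_int (\<Sum>A\<in>?N n. \<psi> A) * w n) has_sum (\<Sum>n<d. of_int (\<Sum>A\<in>?N n. \<psi> A) * w n)) UNIV"
    by (rule has_sum_finite_neutralI) (auto simp: zero)
  then have "((\<lambda>(n, A). h A) has_sum (\<Sum>n<d. of_int (\<Sum>A\<in>?N n. \<psi> A) * w n)) (Sigma UNIV ?N)"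
    using g abs_summable_summable[OF abs] by (intro has_sum_SigmaI) auto
  moreover have "bij_betw snd (Sigma UNIV ?N) monic_polys"
    by (rule bij_betwI[where g = "\<lambda>A. (degree A, A)"])
       (auto simp: monic_polys_def monic_of_degree_def)
  ultimately have "(h has_sum (\<Sum>n<d. of_int (\<Sum>A\<in>?N n. \<psi> A) * w n)) monic_polys"
    by (subst has_sum_reindex_bij_betw[symmetric]) (auto simp: case_prod_unfold)
  then show ?thesis by (simp add: h_def w_def q_def)
qed

theorem L_function_well_defined:
  fixes P :: "'a :: {finite, field} poly"
  assumes odd: "odd CARD('a)" and P: "P \<in> monic_irreducibles n"
  shows "\<exists>!f. f holomorphic_on UNIV \<and> (\<forall>s. Re s > 1 \<longrightarrow> f s = L_series (quad_char P) s)"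
proof -
  let ?F = "\<lambda>s. \<Sum>k<degree P. of_int (\<Sum>A\<in>monic_of_degree k. quad_char P A) *
              complex_of_real (real CARD('a) ^ k) powr (-s)"
  have irr: "irreducible P" and monic: "lead_coeff P = 1"
    using P by (auto simp: monic_irreducibles_def)
  have eq: "L_series (quad_char P) s = ?F s" if "Re s > 1" for s
    unfolding L_series_def
    by (rule infsumI, rule L_series_eq_sum)
       (simp_all add: that abs_quad_char_le sum_quad_char_monic[OF odd irr monic])
  show ?thesis
  proof (rule ex1I[of _ ?F], intro conjI allI impI)
    show "?F holomorphic_on UNIV" by (intro holomorphic_intros)
    show "?F s = L_series (quad_char P) s" if "Re s > 1" for s
      using eq[OF that] by simp
    fix f assume f: "f holomorphic_on UNIV \<and> (\<forall>s. Re s > 1 \<longrightarrow> f s = L_series (quad_char P) s)"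
    show "f = ?F"
    proof
      fix z
      show "f z = ?F z"
      proof (rule analytic_continuation_open[of "{s. Re s > 1}" UNIV f ?F])
        show "open {s. Re s > 1}" by (rule open_halfspace_Re_gt)
        show "{s. Re s > 1} \<noteq> {}" by (auto intro!: exI[of _ 2])
        show "?F holomorphic_on UNIV" by (intro holomorphic_intros)
        show "f s = ?F s" if "s \<in> {s. Re s > 1}" for s
          using f eq that by auto
      qed (use f in auto)
    qed
  qed
qed

end

theory Submission
  imports Defs "HOL-Real_Asymp.Real_Asymp"
begin

text \<open>
  The proof is a resonance argument.  Summing \<open>L(\<sigma>, \<chi>\<^sub>P) R(P)\<^sup>2\<close> over \<open>P\<close>, where the resonator
  \<open>R(P) = (\<Sum>m. \<chi>\<^sub>P(m))\<close> runs over products of prescribed numbers \<open>J\<^sub>d\<close> of primes of each degree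
  \<open>d = d\<^sub>0 + k\<close> with \<open>q^d\<^sub>0 \<approx> g\<close> and \<open>(ln g)^(1/8) \<le> k \<le> (ln g)^(7/8)\<close>, the terms \<open>\<chi>\<^sub>P(A m m')\<close> with
  \<open>A m m'\<close> a square give the main term.  Only those pairs \<open>(m, m')\<close> are used that differ in exactly
  \<open>i\<^sub>d\<close> primes of each degree, where \<open>J\<^sub>d \<approx> g / (2 k\<^sup>2 ln ln g)\<close> and \<open>i\<^sub>d\<close> is close to the saddle point.
  This loses so little that \<open>C(\<kappa>)\<close> is attained without the \<open>o(1)\<close>.

  The remaining terms need square-root cancellation in \<open>\<Sum>P. \<chi>\<^sub>P(A)\<close> for non-squares \<open>A\<close> whose degree
  is polynomial in \<open>g\<close>.  By Euler's criterion this counts the \<open>P\<close> of degree \<open>n = 2 g + 1\<close> modulo which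
  \<open>A^((Q - 1)/2) = \<plusminus>1\<close>, \<open>Q = q^n\<close>, and Stepanov's auxiliary polynomial, which vanishes to high order at
  all these \<open>P\<close>, bounds both counts by \<open>Q / (2 n)\<close> up to an error of order \<open>\<surd>Q\<close>; the field of order \<open>Q\<close>
  is never needed.  The length of the Dirichlet polynomial is halved by the functional equation, which
  comes from pairing \<open>\<chi>\<^sub>P\<close> with the quadratic character of the coefficient of \<open>t^(2 g)\<close>
  modulo \<open>P\<close> instead of an additive character.
\<close>

subsection \<open>Euler's criterion in residue rings of polynomials\<close>

text \<open>Powers of q decide what is possible. Up to polynomials in g, a non-square costs q^g
  (\<open>E\<close>), the short sum for L contributes q^(g/2) (\<open>W\<close>), and there are q^(2
  g) primes; so a resonator with N terms is admissible while N stays below q^(g/2). The unfolded sum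
  of length 2 g would contribute q^g and use up the whole budget, which is why the functional
  equation is needed. The \<open>J\<close> are tuned to this bound: ln N comes to roughly (3/8) g ln
  q.

  Constants, in contrast, have slack. Cutting k to its window turns ln ln g into (3/4) ln ln g in
  the sum of 1/k. But the square of the saddle point carries a factor close to e^(-2 \<kappa>),
  where e^(-6 \<kappa>) is enough, and a further factor 4/9 is to spare. This pays for all the crude
  fractions such as 19/20 and 9/10, and \<epsilon> > 0 pays for the lower order terms.\<close>

definition below :: "nat \<Rightarrow> 'a :: {finite, field} poly set" where
  "below d = {A. \<forall>i\<ge>d. coeff A i = 0}"

text \<open>Since \<open>degree 0 = 0\<close>, the condition \<open>degree A < d\<close> goes wrong
  at \<open>d = 0\<close>. Bounding coefficients instead makes \<open>below d\<close> an F_q-space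
  of dimension \<open>d\<close> for every \<open>d\<close>.\<close>

lemma below_iff_degree: "d > 0 \<Longrightarrow> A \<in> below d \<longleftrightarrow> degree A < d"
  unfolding below_def by (auto simp: coeff_eq_0) (metis leading_coeff_0_iff degree_0 not_le)

lemma below_0 [simp]: "below 0 = {0}"
  by (auto simp: below_def poly_eq_iff)

lemma below_Suc: "below (Suc d) = (\<lambda>(a, A). pCons a A) ` (UNIV \<times> below d)"
proof -
  have "A \<in> (\<lambda>(a, A). pCons a A) ` (UNIV \<times> below d)" if "A \<in> below (Suc d)" for A :: "'a poly"
  proof -
    obtain a B where A: "A = pCons a B" by (cases A)
    have "coeff B i = 0" if "i \<ge> d" for i
      using \<open>A \<in> below (Suc d)\<close> that A unfolding below_def
      by (metis (mono_tags, lifting) Suc_le_mono coeff_pCons_Suc mem_Collect_eq)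
    then show ?thesis using A by (auto simp: below_def)
  qed
  moreover have "pCons a B \<in> below (Suc d)" if "B \<in> below d" for a and B :: "'a poly"
    using that by (auto simp: below_def coeff_pCons split: nat.splits)
  ultimately show ?thesis by auto
qed

lemma finite_below [simp]: "finite (below d)"
  by (induction d) (auto simp: below_Suc)

lemma card_below: "card (below d :: 'a :: {finite, field} poly set) = CARD('a) ^ d"
proof (induction d)
  case (Suc d)
  have "inj_on (\<lambda>(a, A). pCons a A) (UNIV \<times> (below d :: 'a poly set))"
    by (auto simp: inj_on_def)
  then show ?case using Suc by (simp add: below_Suc card_image card_cartesian_product)
qed simp

lemma below_closed [simp]:
  "0 \<in> below d" "A \<in> below d \<Longrightarrow> B \<in> below d \<Longrightarrow> A + B \<in> below d"
  "A \<in> below d \<Longrightarrow> B \<in> below d \<Longrightarrow> A - B \<in> below d"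
  "A \<in> below d \<Longrightarrow> - A \<in> below d"
  "A \<in> below d \<Longrightarrow> smult c A \<in> below d"
  by (auto simp: below_def)

lemma below_mono: "d \<le> e \<Longrightarrow> below d \<subseteq> below e"
  by (auto simp: below_def)

lemma monic_of_degree_eq: "monic_of_degree n = (\<lambda>A. monom 1 n + A) ` below n"
proof -
  have "A \<in> (\<lambda>A. monom 1 n + A) ` below n" if "A \<in> monic_of_degree n" for A :: "'a poly"
    using that by (intro image_eqI[of _ _ "A - monom 1 n"])
      (auto simp: below_def monic_of_degree_def coeff_eq_0)
  moreover have "monom 1 n + B \<in> monic_of_degree n" if "B \<in> below n" for B :: "'a poly"
  proof -
    have "degree (monom 1 n + B) \<le> n"
      using that by (intro degree_le) (auto simp: below_def)
    moreover have "coeff (monom 1 n + B) n = 1" using that by (simp add: below_def)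
    ultimately show ?thesis
      unfolding monic_of_degree_def using le_degree[of "monom 1 n + B" n] by force
  qed
  ultimately show ?thesis by auto
qed

lemma finite_monic_of_degree [simp]: "finite (monic_of_degree n)"
  by (rule finite_card_monic_of_degree)

lemma inj_monic: "inj_on (\<lambda>A. monom 1 n + A) X" for X :: "'a::{finite, field} poly set"
  by (auto simp: inj_on_def)

lemma card_monic_of_degree: "card (monic_of_degree n :: 'a :: {finite, field} poly set) = CARD('a) ^ n"
  by (simp add: monic_of_degree_eq card_image inj_monic card_below)

lemma sum_monic_of_degree: "(\<Sum>A\<in>monic_of_degree n. f A) = (\<Sum>u\<in>below n. f (monom 1 n + u))"
  by (simp add: monic_of_degree_eq sum.reindex inj_monic)

lemma monic_of_degree_0 [simp]: "monic_of_degree 0 = {1}"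
  by (simp add: monic_of_degree_eq one_pCons monom_0)

lemma card_field_ge_2: "CARD('a :: {finite, field}) \<ge> 2"
  using card_mono[of UNIV "{0, 1 :: 'a}"] by simp

section \<open>Frobenius on F_q and on F_q[t]\<close>

lemma field_power_card [simp]: "(a :: 'a :: {finite, field}) ^ CARD('a) = a"
proof (cases "a = 0")
  case False
  let ?S = "UNIV - {0 :: 'a}"
  have "(\<Prod>x\<in>?S. x) = (\<Prod>x\<in>?S. a * x)"
    by (rule prod.reindex_bij_witness[of _ "\<lambda>x. a * x" "\<lambda>x. x / a"]) (use False in auto)
  also have "\<dots> = a ^ (CARD('a) - 1) * (\<Prod>x\<in>?S. x)" 
    by (simp add: prod.distrib card_Diff_singleton)
  finally have "a ^ (CARD('a) - 1) = 1" by simp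
  then show ?thesis using card_field_ge_2[where 'a='a]
    by (metis mult.right_neutral power_eq_if not_numeral_le_zero)
qed (use card_field_ge_2[where 'a='a] in auto)

text \<open>The polynomial (1 + X)^q - X^q - 1 vanishes at all q elements of the field by
  \<open>field_power_card\<close>, yet has degree below q. So it is zero, and its coefficients are
  the binomials in question; the characteristic never has to be named.\<close>

lemma binomial_card_eq_0:
  assumes "0 < i" "i < CARD('a)"
  shows "of_nat (CARD('a) choose i) = (0 :: 'a :: {finite, field})"
proof -
  let ?q = "CARD('a)"
  define p where "p = [:1, 1 :: 'a:] ^ ?q - monom 1 ?q - 1"
  have "poly p x = 0" for x
    by (simp add: p_def poly_monom add.commute)
  then have roots: "{x. poly p x = 0} = UNIV" by auto
  have co: "coeff p j = of_nat (?q choose j) - (if j = ?q then 1 else 0) - (if j = 0 then 1 else 0)" for j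
  proof -
    have "[:1, 1 :: 'a:] ^ ?q = (\<Sum>k\<le>?q. of_nat (?q choose k) * [:0, 1:] ^ k)"
    proof -
      have "[:1, 1 :: 'a:] = [:0, 1:] + 1" by (simp add: one_pCons)
      then show ?thesis using binomial_ring[of "[:0, 1 :: 'a:]" 1 ?q] by simp
    qed
    also have "\<dots> = (\<Sum>k\<le>?q. monom (of_nat (?q choose k)) k)"
      by (intro sum.cong) (simp_all add: monom_altdef of_nat_poly)
    finally have "coeff ([:1, 1 :: 'a:] ^ ?q) j = of_nat (?q choose j)"
      by (cases "j \<le> ?q") (simp_all add: coeff_sum binomial_eq_0)
    then show ?thesis by (auto simp: p_def)
  qed
  have "degree p < ?q"
  proof -
    have "degree p \<le> ?q - 1"
    proof (rule degree_le, intro allI impI)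
      fix i assume "?q - 1 < i"
      then consider "i = ?q" | "i > ?q" by linarith
      then show "coeff p i = 0"
        by cases (use card_field_ge_2[where 'a='a] in \<open>auto simp: co binomial_eq_0\<close>)
    qed
    then show ?thesis using card_field_ge_2[where 'a='a] by linarith
  qed
  then have "p = 0" using card_poly_roots_bound[of p] roots by force
  then show ?thesis using co[of i] assms by simp
qed

lemma poly_add_power_card:
  "(A + B) ^ CARD('a) = A ^ CARD('a) + (B :: 'a :: {finite, field} poly) ^ CARD('a)"
proof -
  let ?q = "CARD('a)"
  have q: "?q > 0" by simp
  have "(A + B) ^ ?q = (\<Sum>k\<le>?q. of_nat (?q choose k) * A ^ k * B ^ (?q - k))"
    by (rule binomial_ring)
  also have "\<dots> = (\<Sum>k\<in>{0, ?q}. of_nat (?q choose k) * A ^ k * B ^ (?q - k))"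
  proof (rule sum.mono_neutral_right)
    show "\<forall>i\<in>{..?q} - {0, ?q}. of_nat (?q choose i) * A ^ i * B ^ (?q - i) = 0"
      by (auto simp: of_nat_poly binomial_card_eq_0)
  qed auto
  also have "\<dots> = A ^ ?q + B ^ ?q" using q by simp
  finally show ?thesis .
qed

lemma poly_power_card:
  "(A :: 'a :: {finite, field} poly) ^ CARD('a) = pcompose A (monom 1 CARD('a))"
proof (induction A)
  case (pCons a A)
  let ?q = "CARD('a)"
  have "pCons a A = [:a:] + [:0, 1:] * A" by simp
  then have "pCons a A ^ ?q = [:a:] ^ ?q + ([:0, 1:] * A) ^ ?q"
    by (simp only: poly_add_power_card)
  also have "\<dots> = [:a:] + monom 1 ?q * A ^ ?q"
    by (simp only: poly_const_pow power_mult_distrib monom_altdef field_power_card smult_1_left)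
  finally show ?case using pCons by (simp add: pcompose_pCons)
qed simp

lemma pcompose_power: "pcompose (A ^ k) B = pcompose (A :: 'a :: comm_ring_1 poly) B ^ k"
  by (induction k) (simp_all add: pcompose_mult pcompose_1)

text \<open>Iterated Frobenius. In Stepanov's argument it turns f^Q into f(t^Q), see
  \<open>G2\<close>.\<close>

lemma poly_power_card_power:
  "(A :: 'a :: {finite, field} poly) ^ (CARD('a) ^ n) = pcompose A (monom 1 (CARD('a) ^ n))"
proof (induction n)
  case 0
  then show ?case by (simp add: monom_altdef pcompose_idR)
next
  case (Suc n)
  let ?q = "CARD('a)"
  have "A ^ (?q ^ Suc n) = (A ^ (?q ^ n)) ^ ?q" by (metis power_Suc2 power_mult)
  also have "\<dots> = pcompose (pcompose A (monom 1 (?q ^ n))) (monom 1 ?q)"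
    by (simp add: Suc poly_power_card)
  also have "\<dots> = pcompose A (pcompose (monom 1 (?q ^ n)) (monom 1 ?q))"
    by (simp add: pcompose_assoc)
  also have "pcompose (monom 1 (?q ^ n)) (monom (1::'a) ?q) = monom 1 (?q ^ Suc n)"
    by (simp add: monom_altdef pcompose_power pcompose_pCons mult.commute flip: power_mult)
  finally show ?case .
qed

text \<open>Shifting the sum of all field elements by 1 gives q = 0 in the field; with 2 = 0 and q
  odd this would read 1 = 0.\<close>

lemma two_neq_0:
  assumes "odd CARD('a :: {finite, field})"
  shows "(2 :: 'a) \<noteq> 0"
proof
  assume two: "(2 :: 'a) = 0"
  have "(\<Sum>x\<in>UNIV. x :: 'a) = (\<Sum>x\<in>UNIV. x + 1)"
    by (rule sum.reindex_bij_witness[of _ "\<lambda>x. x + 1" "\<lambda>x. x - 1"]) auto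
  then have "of_nat CARD('a) = (0 :: 'a)" by (simp add: sum.distrib)
  moreover obtain k where "CARD('a) = 2 * k + 1" using assms by (elim oddE)
  ultimately show False using two by simp
qed

section \<open>Congruences modulo a prime\<close>

text \<open>Lagrange's bound on the number of roots in the residue field, phrased by divisibility so
  that F_q[t]/P need not be built as a field. A root is split off by synthetic division; roots
  incongruent to it remain roots of the quotient because \<open>p\<close> is prime.\<close>

lemma roots_mod_prime:
  fixes F :: "'a :: idom poly" and p :: 'a
  assumes p: "prime_elem p" and roots: "\<And>x. x \<in> X \<Longrightarrow> p dvd poly F x"
    and dist: "\<And>x y. x \<in> X \<Longrightarrow> y \<in> X \<Longrightarrow> x \<noteq> y \<Longrightarrow> \<not> p dvd x - y"
    and card: "card X > degree F"
  shows "p dvd coeff F i"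
  using assms(2-4)
proof (induction "degree F" arbitrary: F X i)
  case 0
  then obtain c where F: "F = [:c:]" by (metis degree_eq_zeroE)
  from 0 obtain x where "x \<in> X" by (metis card.empty equals0I less_numeral_extra(3))
  then show ?case using 0(2)[of x] by (cases i) (auto simp: F)
next
  case (Suc k)
  then obtain x where x: "x \<in> X" by (metis card.empty equals0I not_less_zero)
  define G where "G = synthetic_div F x"
  have F: "F + smult x G = pCons (poly F x) G"
    unfolding G_def by (rule synthetic_div_correct)
  then have F: "F = pCons (poly F x) G - smult x G" by (metis add_diff_cancel_right')
  have pF: "poly F y = poly F x + (y - x) * poly G y" for y
    by (subst F) (simp add: algebra_simps)
  have dG: "degree G = k" using Suc(2) by (simp add: G_def degree_synthetic_div)
  have "p dvd coeff G j" for j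
  proof (rule Suc(1))
    show "k = degree G" using dG by simp
    show "p dvd poly G y" if "y \<in> X - {x}" for y
    proof -
      have "p dvd poly F y - poly F x" using Suc(3) x that by (intro dvd_diff) auto
      then have "p dvd (y - x) * poly G y" using pF[of y] by simp
      then show ?thesis using Suc(4)[of y x] x that p by (auto simp: prime_elem_dvd_mult_iff)
    qed
    show "card (X - {x}) > degree G" using Suc(2,5) x dG by simp
  qed (use Suc(4) in auto)
  then show ?case
    using Suc(3)[OF x] by (subst F) (auto simp: coeff_pCons split: nat.splits)
qed

locale prime_poly =
  fixes P :: "'a :: {finite, field} poly"
  assumes odd_q: "odd CARD('a)" and irr: "irreducible P" and monic: "lead_coeff P = 1"
begin

abbreviation "n \<equiv> degree P"
abbreviation "chi \<equiv> quad_char P"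
abbreviation "R \<equiv> below n :: 'a poly set"

lemma P0 [simp]: "P \<noteq> 0" using irr by auto

lemma prime_P: "prime_elem P" using irr by (rule field_poly_irreducible_imp_prime)

lemma n0 [simp]: "n > 0"
  using irr P0 by (metis gr0I irreducible_def is_unit_iff_degree)

lemma not_dvd_1 [simp]: "\<not> P dvd 1"
  using prime_P by (metis prime_elem_not_unit)

lemma mod_in_R [simp]: "A mod P \<in> R"
  using degree_mod_less[OF P0, of A] n0 by (auto simp: below_iff_degree)

lemma R_mod: "A \<in> R \<Longrightarrow> A mod P = A"
  by (simp add: below_iff_degree mod_poly_less)

lemma R_dvd: "A \<in> R \<Longrightarrow> P dvd A \<longleftrightarrow> A = 0"
  using R_mod by (metis dvd_0_right dvd_imp_mod_0)

lemma dvd_mult_iff: "P dvd A * B \<longleftrightarrow> P dvd A \<or> P dvd B"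
  using prime_P by (rule prime_elem_dvd_mult_iff)

lemma dvd_prod_iff: "finite X \<Longrightarrow> P dvd prod f X \<longleftrightarrow> (\<exists>x\<in>X. P dvd f x)"
  by (induction X rule: finite_induct) (auto simp: dvd_mult_iff)

lemma bij_mult_mod:
  assumes "\<not> P dvd A"
  shows "bij_betw (\<lambda>B. (A * B) mod P) R R"
proof -
  have "inj_on (\<lambda>B. (A * B) mod P) R"
  proof (rule inj_onI)
    fix B C assume B: "B \<in> R" and C: "C \<in> R" and "A * B mod P = A * C mod P"
    then have "P dvd A * (B - C)" by (simp add: mod_eq_dvd_iff algebra_simps)
    then have "P dvd B - C" using assms by (simp add: dvd_mult_iff)
    then show "B = C" using R_dvd[of "B - C"] B C by simp
  qed
  moreover have "(\<lambda>B. (A * B) mod P) ` R \<subseteq> R" by auto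
  ultimately show ?thesis by (simp add: bij_betw_def endo_inj_surj)
qed

lemma sum_mult_mod:
  assumes "\<not> P dvd A"
  shows "(\<Sum>B\<in>R. f ((A * B) mod P)) = (\<Sum>B\<in>R. f B)"
  using bij_mult_mod[OF assms] by (rule sum.reindex_bij_betw)

lemma card_R: "card R = CARD('a) ^ n" by (rule card_below)

lemma fermat:
  assumes A: "\<not> P dvd A"
  shows "[A ^ (CARD('a) ^ n - 1) = 1] (mod P)"
proof -
  let ?S = "R - {0}"
  have bij: "bij_betw (\<lambda>B. (A * B) mod P) ?S ?S"
    by (rule bij_betw_DiffI[OF bij_mult_mod[OF A]]) (auto simp: bij_betw_def)
  have "(\<Prod>B\<in>?S. B) = (\<Prod>B\<in>?S. (A * B) mod P)"
    using prod.reindex_bij_betw[OF bij, of "\<lambda>x. x"] by simp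
  also have "[(\<Prod>B\<in>?S. (A * B) mod P) = (\<Prod>B\<in>?S. A * B)] (mod P)"
    by (intro cong_prod) (simp add: cong_def)
  also have "(\<Prod>B\<in>?S. A * B) = A ^ (CARD('a) ^ n - 1) * (\<Prod>B\<in>?S. B)"
    by (simp add: prod.distrib card_Diff_singleton card_R)
  finally have "P dvd A ^ (CARD('a) ^ n - 1) * (\<Prod>B\<in>?S. B) - (\<Prod>B\<in>?S. B)"
    using cong_iff_dvd_diff cong_sym by blast
  then have "P dvd (A ^ (CARD('a) ^ n - 1) - 1) * (\<Prod>B\<in>?S. B)" by (simp add: algebra_simps)
  moreover have "\<not> P dvd (\<Prod>B\<in>?S. B)"
    using R_dvd by (subst dvd_prod_iff) auto
  ultimately show ?thesis by (auto simp: dvd_mult_iff cong_iff_dvd_diff)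
qed

lemma fermat': "[A ^ (CARD('a) ^ n) = A] (mod P)"
proof (cases "P dvd A")
  case True
  then have "P dvd A ^ (CARD('a) ^ n)" by (intro dvd_trans[OF True dvd_power]) auto
  then show ?thesis using True by (simp add: cong_iff_dvd_diff)
next
  case False
  have "A ^ (CARD('a) ^ n) = A * A ^ (CARD('a) ^ n - 1)" by (metis power_eq_if power_not_zero zero_less_card_finite neq0_conv)
  then show ?thesis using cong_scalar_left[OF fermat[OF False], of A] by simp
qed

definition h :: nat where "h = (CARD('a) ^ n - 1) div 2"

lemma h: "2 * h = CARD('a) ^ n - 1" "h > 0"
proof -
  show "2 * h = CARD('a) ^ n - 1" using odd_q unfolding h_def by simp
  have "CARD('a) ^ n \<ge> CARD('a) ^ 1" using n0 by (intro power_increasing) (auto simp: Suc_le_eq simp del: n0)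
  moreover have "CARD('a) \<ge> 3" using card_field_ge_2[where 'a='a] odd_q by (cases "CARD('a) = 2") auto
  ultimately show "h > 0" by (simp add: h_def)
qed

lemma not_dvd_2: "\<not> P dvd 2"
proof -
  have "2 = [:2 :: 'a:]" by (simp add: numeral_poly)
  then have "is_unit (2 :: 'a poly)" using two_neq_0[OF odd_q]
    by (metis dvd_field_iff is_unit_const_poly_iff)
  then show ?thesis using not_dvd_1 dvd_trans by blast
qed

lemma sum_chi_R: "(\<Sum>B\<in>R. chi B) = 0"
proof -
  have "R = {B. degree B < n}" using below_iff_degree[OF n0] by blast
  then show ?thesis using sum_quad_char_residues[OF odd_q irr] by simp
qed

lemma chi_range: "chi A \<in> {-1, 0, 1}" by (simp add: quad_char_def)

text \<open>The character sum over all residues vanishes, so squares and non-squares share the q^n -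
  1 nonzero residues equally.\<close>

lemma card_squares: "card {B \<in> R. chi B = 1} = h"
proof -
  let ?S = "{B \<in> R. chi B = 1}" and ?N = "{B \<in> R. chi B = -1}"
  have chi: "chi B = 0 \<longleftrightarrow> B = 0" if "B \<in> R" for B using R_dvd[OF that] by (auto simp: quad_char_def)
  have R: "R = insert 0 (?S \<union> ?N)" using chi chi_range by fastforce
  have fin: "finite ?S" "finite ?N" by auto
  have c0: "chi 0 = 0" by (simp add: quad_char_def)
  have "card R = Suc (card (?S \<union> ?N))"
    by (subst R, subst card_insert_disjoint) (use fin c0 in auto)
  also have "card (?S \<union> ?N) = card ?S + card ?N" by (rule card_Un_disjoint) auto
  finally have 1: "CARD('a) ^ n = Suc (card ?S + card ?N)" by (simp add: card_R)
  have "(\<Sum>B\<in>R. chi B) = (\<Sum>B\<in>?S \<union> ?N. chi B)"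
    by (subst R, subst sum.insert) (use fin c0 in auto)
  also have "\<dots> = (\<Sum>B\<in>?S. chi B) + (\<Sum>B\<in>?N. chi B)"
    by (rule sum.union_disjoint) auto
  also have "\<dots> = int (card ?S) - int (card ?N)" by simp
  finally have "card ?S = card ?N" using sum_chi_R by simp
  then show ?thesis using 1 by (simp add: h_def)
qed

lemma euler1: "chi A = 1 \<Longrightarrow> [A ^ h = 1] (mod P)"
proof -
  assume "chi A = 1"
  then obtain B where B: "[B\<^sup>2 = A] (mod P)" and A: "\<not> P dvd A"
    by (auto simp: quad_char_def split: if_splits)
  have "P dvd B\<^sup>2 \<longleftrightarrow> P dvd A" by (rule cong_dvd_iff[OF B])
  then have "\<not> P dvd B" using A by (simp add: power2_eq_square dvd_mult_iff)
  then have 1: "[B ^ (2 * h) = 1] (mod P)" using fermat[of B] h(1) by simp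
  have "[B ^ (2 * h) = A ^ h] (mod P)" using cong_pow[OF B, of h] by (simp only: power_mult)
  from cong_trans[OF cong_sym[OF this] 1] show ?thesis .
qed

lemma cong_mod_right: "[A mod P = A] (mod P)" by (simp add: cong_def)

text \<open>\<open>A^h\<close> is 1 or -1. If it were 1, then \<open>A\<close> together with the
  \<open>h\<close> nonzero squares would give h + 1 incongruent roots of x^h - 1, against
  \<open>roots_mod_prime\<close>.\<close>

lemma euler2:
  assumes "chi A = -1" 
  shows "[A ^ h = -1] (mod P)"
proof -
  have A: "\<not> P dvd A" using assms by (auto simp: quad_char_def)
  have "[A ^ (2 * h) = 1] (mod P)" using fermat[OF A] h by simp
  then have "P dvd (A ^ h - 1) * (A ^ h + 1)"
    by (simp add: cong_iff_dvd_diff algebra_simps power_mult power2_eq_square power_mult_distrib mult_2 power_add)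
  moreover have "\<not> P dvd A ^ h - 1"
  proof
    assume A1: "P dvd A ^ h - 1"
    define S where "S = {B \<in> R. chi B = 1}"
    define X where "X = insert (A mod P) S"
    have "A mod P \<notin> S" using assms by (simp add: S_def quad_char_mod)
    then have cX: "card X = Suc h" using card_squares by (simp add: X_def S_def)
    have XR: "X \<subseteq> R" by (auto simp: X_def S_def)
    define F :: "'a poly poly" where "F = monom 1 h - 1"
    have dF: "degree F \<le> h" unfolding F_def by (intro degree_diff_le) (auto simp: degree_monom_le)
    have "P dvd coeff F h"
    proof (rule roots_mod_prime[OF prime_P, of X])
      fix x assume x: "x \<in> X"
      have "[x ^ h = 1] (mod P)"
      proof (cases "x \<in> S")
        case False
        then have "x = A mod P" using x by (simp add: X_def)
        then have "[x ^ h = A ^ h] (mod P)" using cong_mod_right cong_pow by blast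
        moreover have "[A ^ h = 1] (mod P)" using A1 by (simp add: cong_iff_dvd_diff)
        ultimately show ?thesis by (rule cong_trans)
      qed (auto simp: S_def intro: euler1)
      then show "P dvd poly F x" by (simp add: F_def poly_monom cong_iff_dvd_diff)
    next
      fix x y assume "x \<in> X" "y \<in> X" "x \<noteq> y"
      then have "x - y \<in> R" "x - y \<noteq> 0" using XR by (auto intro!: below_closed)
      then show "\<not> P dvd x - y" using R_dvd by simp
    qed (use cX dF in auto)
    then show False using h by (simp add: F_def)
  qed
  ultimately show ?thesis by (simp add: dvd_mult_iff cong_iff_dvd_diff)
qed

lemma euler: "[of_int (chi A) = A ^ h] (mod P)"
proof -
  consider "P dvd A" | "chi A = 1" | "chi A = -1" unfolding quad_char_def by presburger
  then show ?thesis
  proof cases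
    case 1
    then have "P dvd A ^ h" using h(2) by (meson dvd_power dvd_trans)
    then show ?thesis using 1 by (simp add: quad_char_def cong_iff_dvd_diff)
  next
    case 2
    show ?thesis using cong_sym[OF euler1[OF 2]] 2 by simp
  next
    case 3
    show ?thesis using cong_sym[OF euler2[OF 3]] 3 by simp
  qed
qed

text \<open>As q is odd, 2 is a unit and -1, 0, 1 stay distinct modulo \<open>P\<close>. Identities
  between values of \<open>chi\<close>, such as multiplicativity, can thus be read off from
  congruences between powers.\<close>

lemma small_int_cong:
  assumes "a \<in> {-1, 0, 1 :: int}" "b \<in> {-1, 0, 1}" "[of_int a = of_int b] (mod P)"
  shows "a = b"
proof -
  have "P dvd of_int (a - b)" using assms(3) by (simp add: cong_iff_dvd_diff)
  moreover have "a - b \<in> {0, 1, -1, 2, -2}" using assms(1,2) by auto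
  moreover have "\<not> P dvd of_int c" if "c \<in> {1, -1, 2, -2}" for c
    using that not_dvd_1 not_dvd_2 by (elim insertE) auto
  ultimately have "a - b = 0" by blast
  then show ?thesis by simp
qed

lemma chi_eqI: "a \<in> {-1, 0, 1} \<Longrightarrow> [of_int a = A ^ h] (mod P) \<Longrightarrow> chi A = a"
  by (rule small_int_cong[OF chi_range _ cong_trans[OF euler cong_sym]])

lemma chi_mult: "chi (A * B) = chi A * chi B"
proof (rule chi_eqI)
  show "chi A * chi B \<in> {-1, 0, 1}" using chi_range[of A] chi_range[of B] by auto
  show "[of_int (chi A * chi B) = (A * B) ^ h] (mod P)"
    using cong_mult[OF euler[of A] euler[of B]] by (simp add: power_mult_distrib)
qed

lemma chi_eq_0_iff: "chi A = 0 \<longleftrightarrow> P dvd A" by (simp add: quad_char_def)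

lemma chi_square: "\<not> P dvd A \<Longrightarrow> chi A * chi A = 1"
  using chi_range[of A] chi_eq_0_iff[of A] by auto

lemma chi_0 [simp]: "chi 0 = 0" by (simp add: chi_eq_0_iff)
lemma chi_1 [simp]: "chi 1 = 1" by (rule chi_eqI) simp_all

end

subsection \<open>Counting monic irreducible polynomials\<close>

text \<open>Summing \<open>degree P\<close> over these pairs amounts to summing the von Mangoldt
  function of F_q[t] over the monic polynomials of degree \<open>j\<close>.\<close>

definition prime_powers :: "nat \<Rightarrow> ('a :: {finite, field} poly \<times> nat) set" where
  "prime_powers j = {(P, k). lead_coeff P = 1 \<and> irreducible P \<and> k \<ge> 1 \<and> k * degree P = j}"

definition prime_power_divisors :: "'a :: {finite, field} poly \<Rightarrow> ('a poly \<times> nat) set" where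
  "prime_power_divisors A = {(P, k). lead_coeff P = 1 \<and> irreducible P \<and> k \<ge> 1 \<and> P ^ k dvd A}"

lemma irreducible_degree_pos: "irreducible P \<Longrightarrow> degree P > 0" for P :: "'a :: field poly"
  by (metis gr0I irreducible_def is_unit_iff_degree)

lemma degree_power_monic: "lead_coeff P = 1 \<Longrightarrow> degree (P ^ k) = k * degree P"
  for P :: "'a :: field poly"
  by (cases "P = 0") (simp_all add: degree_power_eq)

lemma exists_monic_irreducible_factor:
  fixes A :: "'a :: field poly"
  assumes "degree A > 0"
  shows "\<exists>P. lead_coeff P = 1 \<and> irreducible P \<and> P dvd A"
  using assms
proof (induction "degree A" arbitrary: A rule: less_induct)
  case less
  show ?case
  proof (cases "irreducible A")
    case True
    define c where "c = lead_coeff A"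
    have c: "c \<noteq> 0" using less.prems by (auto simp: c_def)
    define P where "P = smult (inverse c) A"
    have "A = [:c:] * P" using c by (simp add: P_def)
    moreover have "is_unit [:c:]" using c by (simp add: is_unit_const_poly_iff dvd_field_iff)
    ultimately have "irreducible P" using True by (metis irreducible_mult_unit_left)
    moreover have "lead_coeff P = 1" using c by (simp add: P_def c_def)
    moreover have "P dvd A" using \<open>A = [:c:] * P\<close> by (metis dvd_triv_right)
    ultimately show ?thesis by blast
  next
    case False
    have "A \<noteq> 0" using less.prems by auto
    then have "\<not> is_unit A" using less.prems by (simp add: is_unit_iff_degree)
    then obtain B C where BC: "A = B * C" "\<not> is_unit B" "\<not> is_unit C"
      using False \<open>A \<noteq> 0\<close> unfolding irreducible_def by blast
    have nz: "B \<noteq> 0" "C \<noteq> 0" using \<open>A \<noteq> 0\<close> BC by auto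
    then have "degree B > 0" "degree C > 0" using BC by (auto simp: is_unit_iff_degree)
    moreover have "degree A = degree B + degree C" using nz BC by (simp add: degree_mult_eq)
    ultimately obtain P where "lead_coeff P = 1" "irreducible P" "P dvd B"
      using less.hyps[of B] by auto
    then show ?thesis using BC by auto
  qed
qed

lemma prime_power_dvd_mult:
  fixes P :: "'a :: field poly"
  assumes "prime_elem P" "\<not> P dvd A" "P ^ k dvd A * B"
  shows "P ^ k dvd B"
  using assms(3)
proof (induction k arbitrary: B)
  case (Suc k)
  have "P dvd A * B" using Suc.prems by (meson dvd_trans dvd_power zero_less_Suc)
  then obtain C where C: "B = P * C" using assms(1,2) by (auto simp: prime_elem_dvd_mult_iff)
  have "P * P ^ k dvd P * (A * C)" using Suc.prems C by (simp add: algebra_simps)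
  then have "P ^ k dvd A * C" using assms(1) by (subst (asm) dvd_mult_cancel_left) auto
  then show ?case using Suc.IH[of C] C by simp
qed simp

lemma monic_irreducible_dvd_eq:
  fixes P P' :: "'a :: field poly"
  assumes "irreducible P" "lead_coeff P = 1" "irreducible P'" "lead_coeff P' = 1" "P dvd P'"
  shows "P = P'"
proof -
  obtain A where A: "P' = P * A" using assms(5) by auto
  then have "is_unit A" using assms irreducibleD[of P' P A] by (auto simp: irreducible_def)
  then obtain a where "A = [:a:]" by (auto simp: is_unit_poly_iff)
  then have P': "P' = smult a P" using A by simp
  then have "lead_coeff P' = a * lead_coeff P" by (simp only: lead_coeff_smult)
  then have "a = 1" unfolding assms by simp
  then show ?thesis using P' by simp
qed

lemma prime_powers_degree_bound:
  fixes P A :: "'a :: field poly"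
  assumes "lead_coeff P = 1" "irreducible P" "P ^ k dvd A" "A \<noteq> 0"
  shows "k * degree P \<le> degree A" "k \<le> degree A" "k \<ge> 1 \<Longrightarrow> degree P \<le> degree A"
proof -
  show *: "k * degree P \<le> degree A"
    using dvd_imp_degree_le[OF assms(3,4)] assms(1) by (simp add: degree_power_monic)
  have "degree P \<ge> 1" using irreducible_degree_pos[OF assms(2)] by simp
  then have "k * 1 \<le> k * degree P" by (intro mult_le_mono) auto
  then have "k * 1 \<le> degree A" using * by (rule order_trans)
  then show "k \<le> degree A" by simp
  assume "k \<ge> 1"
  then have "1 * degree P \<le> k * degree P" by (intro mult_le_mono) auto
  then have "1 * degree P \<le> degree A" using * by (rule order_trans)
  then show "degree P \<le> degree A" by simp
qed

lemma finite_monic_bounded: "finite {P :: 'a :: {finite, field} poly. lead_coeff P = 1 \<and> degree P \<le> d}"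
proof -
  have "{P :: 'a poly. lead_coeff P = 1 \<and> degree P \<le> d} = (\<Union>j\<in>{..d}. monic_of_degree j)"
    by (auto simp: monic_of_degree_def)
  then show ?thesis by simp
qed

lemma finite_prime_power_divisors:
  fixes A :: "'a :: {finite, field} poly"
  assumes "A \<noteq> 0"
  shows "finite (prime_power_divisors A)"
proof (rule finite_subset)
  show "prime_power_divisors A \<subseteq> {P. lead_coeff P = 1 \<and> degree P \<le> degree A} \<times> {..degree A}"
  proof (rule subsetI)
    fix x assume "x \<in> prime_power_divisors A"
    then obtain P k where x: "x = (P, k)" and P: "lead_coeff P = 1" "irreducible P" "k \<ge> 1" "P ^ k dvd A"
      by (auto simp: prime_power_divisors_def)
    show "x \<in> {P. lead_coeff P = 1 \<and> degree P \<le> degree A} \<times> {..degree A}"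
      using prime_powers_degree_bound(2,3)[OF P(1,2,4) assms] P x by simp
  qed
qed (simp add: finite_monic_bounded)

lemma finite_prime_powers:
  assumes "j > 0"
  shows "finite (prime_powers j :: ('a :: {finite, field} poly \<times> nat) set)"
proof (rule finite_subset)
  show "prime_powers j \<subseteq> {P :: 'a poly. lead_coeff P = 1 \<and> degree P \<le> j} \<times> {..j}"
    using irreducible_degree_pos by (force simp: prime_powers_def)
qed (simp add: finite_monic_bounded)

text \<open>The analogue of log n being the sum of the von Mangoldt function over the divisors of n.
  Splitting one prime \<open>p\<close> off \<open>A = p * B\<close> creates exactly one new
  pair.\<close>

lemma degree_eq_sum_prime_powers:
  assumes "lead_coeff A = 1"
  shows "degree A = (\<Sum>(P, k)\<in>prime_power_divisors A. degree P)"
  using assms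
proof (induction "degree A" arbitrary: A rule: less_induct)
  case less
  have A0: "A \<noteq> 0" using less.prems by auto
  show ?case
  proof (cases "degree A = 0")
    case True
    have False if "lead_coeff P = 1" "irreducible P" "k \<ge> 1" "P ^ k dvd A" for P k
      using prime_powers_degree_bound(2)[OF that(1,2,4) A0] that(3) True by simp
    then have "prime_power_divisors A = {}"
      unfolding prime_power_divisors_def by blast
    then show ?thesis using True by simp
  next
    case False
    then obtain p where p: "lead_coeff p = 1" "irreducible p" "p dvd A"
      using exists_monic_irreducible_factor by blast
    then obtain B where AB: "A = p * B" by auto
    have B0: "B \<noteq> 0" and p0: "p \<noteq> 0" using A0 AB by auto
    have prime: "prime_elem p" using p(2) by (rule field_poly_irreducible_imp_prime)
    have B1: "lead_coeff B = 1" using less.prems p AB by (simp add: lead_coeff_mult)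
    have dA: "degree A = degree p + degree B" using AB B0 p0 by (simp add: degree_mult_eq)
    \<comment> \<open>\<open>j\<close> is one more than the multiplicity of \<open>p\<close> in
      \<open>B\<close>, hence its multiplicity in \<open>A\<close>: the pair \<open>(p, j)\<close>
      is the one that \<open>B\<close> lacks.\<close>
    define j where "j = (LEAST j. \<not> p ^ j dvd B)"
    have ex: "\<not> p ^ Suc (degree B) dvd B"
      using prime_powers_degree_bound(2)[OF p(1,2) _ B0, of "Suc (degree B)"] by auto
    have j: "\<not> p ^ j dvd B" unfolding j_def by (rule LeastI[of _ "Suc (degree B)"]) (rule ex)
    have pj: "p ^ i dvd B \<longleftrightarrow> i < j" for i
      using j not_less_Least[of i "\<lambda>j. \<not> p ^ j dvd B"] le_imp_power_dvd[of j i p] dvd_trans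
      unfolding j_def[symmetric] by (meson not_le)
    have eq: "prime_power_divisors A = insert (p, j) (prime_power_divisors B)"
    proof (rule set_eqI, clarify)
      fix P :: "'a poly" and k
      show "(P, k) \<in> prime_power_divisors A \<longleftrightarrow> (P, k) \<in> insert (p, j) (prime_power_divisors B)"
      proof (cases "P = p")
        case True
        have "p ^ k dvd A \<longleftrightarrow> k - 1 < j" if "k \<ge> 1"
        proof -
          have "p ^ k = p * p ^ (k - 1)" using that by (metis power_eq_if not_one_le_zero)
          then have "p ^ k dvd A \<longleftrightarrow> p ^ (k - 1) dvd B" using AB p0 by simp
          then show ?thesis by (simp add: pj)
        qed
        moreover have "j \<ge> 1" using pj[of 0] by simp
        ultimately show ?thesis using True p pj[of k] by (auto simp: prime_power_divisors_def)
      next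
        case False
        have "P ^ k dvd A \<longleftrightarrow> P ^ k dvd B" if P: "lead_coeff P = 1" "irreducible P"
        proof
          assume *: "P ^ k dvd A"
          have "\<not> P dvd p"
            using monic_irreducible_dvd_eq[OF P(2,1) p(2,1)] False by blast
          then show "P ^ k dvd B"
            using prime_power_dvd_mult[OF field_poly_irreducible_imp_prime[OF P(2)], of p k B] * AB by auto
        qed (use AB in auto)
        then show ?thesis using False by (auto simp: prime_power_divisors_def)
      qed
    qed
    have "(p, j) \<notin> prime_power_divisors B" using j by (auto simp: prime_power_divisors_def)
    then have "(\<Sum>(P, k)\<in>prime_power_divisors A. degree P) = degree p + (\<Sum>(P, k)\<in>prime_power_divisors B. degree P)"
      unfolding eq using finite_prime_power_divisors[OF B0] by simp
    also have "(\<Sum>(P, k)\<in>prime_power_divisors B. degree P) = degree B"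
      using less.hyps[of B] B1 dA irreducible_degree_pos[OF p(2)] by simp
    finally show ?thesis using dA by simp
  qed
qed

lemma card_monic_multiples:
  fixes B :: "'a :: {finite, field} poly"
  assumes "lead_coeff B = 1" "degree B \<le> n"
  shows "card {A \<in> monic_of_degree n. B dvd A} = CARD('a) ^ (n - degree B)"
proof -
  have B0: "B \<noteq> 0" using assms by auto
  have "{A \<in> monic_of_degree n. B dvd A} = (\<lambda>C. B * C) ` monic_of_degree (n - degree B)"
  proof (rule set_eqI, rule iffI)
    fix A assume A: "A \<in> {A \<in> monic_of_degree n. B dvd A}"
    then obtain C where C: "A = B * C" by auto
    then have "C \<noteq> 0" using A by (auto simp: monic_of_degree_def)
    then have "C \<in> monic_of_degree (n - degree B)"
      using A C assms B0 by (auto simp: monic_of_degree_def coeff_mult_degree_sum degree_mult_eq)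
    then show "A \<in> (\<lambda>C. B * C) ` monic_of_degree (n - degree B)" using C by (intro image_eqI[of _ _ C])
  next
    fix A assume "A \<in> (\<lambda>C. B * C) ` monic_of_degree (n - degree B)"
    then obtain C where A: "A = B * C" and "C \<in> monic_of_degree (n - degree B)" by blast
    then have C: "A = B * C" "lead_coeff C = 1" "degree C = n - degree B"
      by (auto simp: monic_of_degree_def)
    then have "C \<noteq> 0" by auto
    moreover have "coeff (B * C) n = 1" using coeff_mult_degree_sum[of B C] C assms by simp
    ultimately show "A \<in> {A \<in> monic_of_degree n. B dvd A}"
      using C assms B0
      by (simp add: monic_of_degree_def degree_mult_eq)
  qed
  moreover have "inj_on (\<lambda>C. B * C) (monic_of_degree (n - degree B))"
    using B0 by (auto simp: inj_on_def)
  ultimately show ?thesis by (simp add: card_image card_monic_of_degree)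
qed

text \<open>The increment of Chebyshev's psi function at degree \<open>j\<close>; the type argument
  only fixes the field.\<close>

definition Psi :: "'a :: {finite, field} itself \<Rightarrow> nat \<Rightarrow> nat" where
  "Psi _ j = (\<Sum>(P :: 'a poly, k)\<in>prime_powers j. degree P)"

text \<open>The total degree of all monic polynomials of degree \<open>n\<close>, computed twice:
  directly, and by distributing each degree over prime powers and using that a prime power of degree
  \<open>j\<close> divides q^(n - j) of them.\<close>

lemma sum_Psi:
  "n * CARD('a :: {finite, field}) ^ n = (\<Sum>j=1..n. CARD('a) ^ (n - j) * Psi TYPE('a) j)"
proof -
  let ?M = "monic_of_degree n :: 'a poly set"
  let ?U = "\<Union>j\<in>{1..n}. prime_powers j :: ('a poly \<times> nat) set"
  have finU: "finite ?U" by (intro finite_UN_I finite_prime_powers) auto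
  have "n * CARD('a) ^ n = (\<Sum>A\<in>?M. degree A)"
    by (simp add: monic_of_degree_def card_monic_of_degree[unfolded monic_of_degree_def])
  also have "\<dots> = (\<Sum>A\<in>?M. \<Sum>(P, k)\<in>?U. if P ^ k dvd A then degree P else 0)"
  proof (rule sum.cong[OF refl])
    fix A assume A: "A \<in> ?M"
    have A0: "A \<noteq> 0" and A1: "lead_coeff A = 1" using A by (auto simp: monic_of_degree_def)
    have dA: "degree A = n" using A by (simp add: monic_of_degree_def)
    have "k * degree P \<in> {1..n}"
      if "lead_coeff P = 1" "irreducible P" "k \<ge> 1" "P ^ k dvd A" for P k
      using prime_powers_degree_bound(1)[OF that(1,2,4) A0] that(3) dA irreducible_degree_pos[OF that(2)]
      by simp
    then have "prime_power_divisors A = {x \<in> ?U. fst x ^ snd x dvd A}"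
      unfolding prime_power_divisors_def prime_powers_def by auto
    then have "degree A = (\<Sum>x\<in>{x \<in> ?U. fst x ^ snd x dvd A}. degree (fst x))"
      using degree_eq_sum_prime_powers[OF A1] by (simp add: case_prod_unfold)
    also have "\<dots> = (\<Sum>x\<in>?U. if fst x ^ snd x dvd A then degree (fst x) else 0)"
      using finU by (rule sum.inter_filter)
    finally show "degree A = (\<Sum>(P, k)\<in>?U. if P ^ k dvd A then degree P else 0)"
      by (simp add: case_prod_unfold)
  qed
  also have "\<dots> = (\<Sum>(P, k)\<in>?U. \<Sum>A\<in>?M. if P ^ k dvd A then degree P else 0)"
    by (subst sum.swap) (simp add: case_prod_unfold)
  also have "\<dots> = (\<Sum>(P, k)\<in>?U. CARD('a) ^ (n - k * degree P) * degree P)"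
  proof (rule sum.cong[OF refl], clarify)
    fix P :: "'a poly" and k j assume Pk: "(P, k) \<in> prime_powers j" "j \<in> {1..n}"
    then have P: "lead_coeff P = 1" "k * degree P \<le> n" by (auto simp: prime_powers_def)
    have "lead_coeff (P ^ k) = 1" using P by (simp only: lead_coeff_power power_one)
    then have "card {A \<in> ?M. P ^ k dvd A} = CARD('a) ^ (n - k * degree P)"
      using card_monic_multiples[of "P ^ k" n] P by (simp add: degree_power_monic)
    then show "(\<Sum>A\<in>?M. if P ^ k dvd A then degree P else 0) = CARD('a) ^ (n - k * degree P) * degree P"
      by (simp flip: sum.inter_filter)
  qed
  also have "\<dots> = (\<Sum>j=1..n. \<Sum>(P :: 'a poly, k)\<in>prime_powers j. CARD('a) ^ (n - k * degree P) * degree P)"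
    by (rule sum.UNION_disjoint) (auto intro!: finite_prime_powers, auto simp: prime_powers_def)
  also have "\<dots> = (\<Sum>j=1..n. CARD('a) ^ (n - j) * Psi TYPE('a) j)"
    by (intro sum.cong refl) (auto simp: Psi_def sum_distrib_left prime_powers_def intro!: sum.cong)
  finally show ?thesis .
qed

text \<open>Subtracting q times the identity \<open>sum_Psi\<close> at m from the one at m + 1
  isolates the last term. No zeta function is involved.\<close>

lemma Psi_eq:
  assumes "n > 0"
  shows "Psi TYPE('a :: {finite, field}) n = CARD('a) ^ n"
proof -
  obtain m where n: "n = Suc m" using assms by (cases n) auto
  let ?S = "\<lambda>n. \<Sum>j=1..n. CARD('a) ^ (n - j) * Psi TYPE('a) j"
  have "?S (Suc m) = (\<Sum>j=1..m. CARD('a) ^ (Suc m - j) * Psi TYPE('a) j) + Psi TYPE('a) (Suc m)"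
    by simp
  also have "(\<Sum>j=1..m. CARD('a) ^ (Suc m - j) * Psi TYPE('a) j) = CARD('a) * ?S m"
    unfolding sum_distrib_left by (intro sum.cong refl) (simp add: Suc_diff_le)
  finally have "Suc m * CARD('a) ^ Suc m = m * CARD('a) ^ Suc m + Psi TYPE('a) (Suc m)"
    unfolding sum_Psi[symmetric] by (simp add: algebra_simps)
  then show ?thesis by (simp add: n)
qed

abbreviation prime_count :: "'a :: {finite, field} itself \<Rightarrow> nat \<Rightarrow> nat" where
  "prime_count _ d \<equiv> card (monic_irreducibles d :: 'a poly set)"

lemma prime_count_upper:
  assumes "d > 0"
  shows "d * prime_count TYPE('a :: {finite, field}) d \<le> CARD('a) ^ d"
proof -
  have "d * prime_count TYPE('a) d = (\<Sum>(P, k)\<in>monic_irreducibles d \<times> {1 :: nat}. degree (P :: 'a poly))"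
  proof -
    have "(\<Sum>(P, k)\<in>monic_irreducibles d \<times> {1 :: nat}. degree (P :: 'a poly)) =
        (\<Sum>x\<in>(monic_irreducibles d :: 'a poly set) \<times> {1 :: nat}. d)"
      by (intro sum.cong refl) (auto simp: monic_irreducibles_def)
    then show ?thesis by (simp add: card_cartesian_product)
  qed
  also have "\<dots> \<le> Psi TYPE('a) d"
    unfolding Psi_def by (rule sum_mono2[OF finite_prime_powers[OF assms]])
      (auto simp: prime_powers_def monic_irreducibles_def)
  finally show ?thesis by (simp add: Psi_eq[OF assms])
qed

text \<open>Proper powers \<open>P^k\<close> of degree \<open>d\<close> have k \<ge> 2, so degree P
  is at most d div 2, and \<open>P\<close> determines \<open>k\<close>. By
  \<open>prime_count_upper\<close> they contribute at most the sum of q^e for e \<le> d div 2, a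
  geometric sum.\<close>

lemma prime_count_lower:
  assumes "d > 0"
  shows "CARD('a) ^ d \<le> d * prime_count TYPE('a :: {finite, field}) d + 2 * CARD('a) ^ (d div 2)"
proof -
  let ?I = "\<lambda>e. monic_irreducibles e :: 'a poly set"
  let ?B = "{x \<in> (prime_powers d :: ('a poly \<times> nat) set). snd x \<ge> 2}"
  have fin: "finite (prime_powers d :: ('a poly \<times> nat) set)" by (rule finite_prime_powers[OF assms])
  have eq: "prime_powers d = ?I d \<times> {1} \<union> ?B"
    by (auto simp: prime_powers_def monic_irreducibles_def)
  have "(\<Sum>x\<in>prime_powers d. degree (fst x :: 'a poly)) \<le>
      (\<Sum>x\<in>?I d \<times> {1 :: nat}. degree (fst x)) + (\<Sum>x\<in>?B. degree (fst x))"
    by (subst eq, subst sum.union_disjoint) (use fin in \<open>auto simp: finite_monic_irreducibles\<close>)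
  also have "(\<Sum>x\<in>?I d \<times> {1 :: nat}. degree (fst x)) = d * card (?I d)"
  proof -
    have "(\<Sum>x\<in>?I d \<times> {1 :: nat}. degree (fst x)) = (\<Sum>x\<in>?I d \<times> {1 :: nat}. d)"
      by (intro sum.cong refl) (auto simp: monic_irreducibles_def)
    then show ?thesis by (simp add: card_cartesian_product)
  qed
  also have "(\<Sum>x\<in>?B. degree (fst x)) = (\<Sum>P\<in>fst ` ?B. degree P)"
  proof (subst sum.reindex)
    show "inj_on fst ?B"
      using assms by (auto simp: inj_on_def prime_powers_def)
  qed simp
  also have "\<dots> \<le> (\<Sum>P\<in>(\<Union>e\<in>{1..d div 2}. ?I e). degree P)"
  proof (rule sum_mono2)
    show "fst ` ?B \<subseteq> (\<Union>e\<in>{1..d div 2}. ?I e)"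
    proof clarify
      fix P :: "'a poly" and k assume "(P, k) \<in> prime_powers d" "2 \<le> snd (P, k)"
      then have P: "lead_coeff P = 1" "irreducible P" "k * degree P = d" "k \<ge> 2" by (auto simp: prime_powers_def)
      have "2 * degree P \<le> k * degree P" using P(4) by (rule mult_le_mono1)
      then have "degree P \<le> d div 2" using P by simp
      then show "fst (P, k) \<in> (\<Union>e\<in>{1..d div 2}. ?I e)"
        using P irreducible_degree_pos[OF P(2)] by (auto simp: monic_irreducibles_def)
    qed
  qed (auto simp: finite_monic_irreducibles)
  also have "\<dots> = (\<Sum>e=1..d div 2. e * card (?I e))"
    by (subst sum.UNION_disjoint) (auto simp: finite_monic_irreducibles, auto simp: monic_irreducibles_def mult.commute)
  also have "\<dots> \<le> (\<Sum>e=1..d div 2. CARD('a) ^ e)"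
    by (intro sum_mono prime_count_upper) auto
  also have "\<dots> \<le> 2 * CARD('a) ^ (d div 2)"
  proof (induction "d div 2")
    case (Suc m)
    have "(\<Sum>e=1..m. CARD('a) ^ e) \<le> 2 * CARD('a) ^ m" for m
    proof (induction m)
      case (Suc m)
      have le: "2 * CARD('a) ^ m \<le> CARD('a) ^ Suc m" using card_field_ge_2[where 'a='a] by simp
      show ?case using order_trans[OF Suc le] by simp
    qed simp
    then show ?case .
  qed simp
  finally show ?thesis using Psi_eq[OF assms, where 'a='a] by (simp add: Psi_def case_prod_unfold)
qed

subsection \<open>The functional equation\<close>

lemma below_mult:
  assumes "A \<in> below a" "B \<in> below b"
  shows "A * B \<in> below (a + b - 1)"
proof (cases "a = 0 \<or> b = 0")
  case False
  then have "degree A \<le> a - 1" "degree B \<le> b - 1"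
    using assms below_iff_degree[of a A] below_iff_degree[of b B] by auto
  then have "degree (A * B) \<le> (a - 1) + (b - 1)"
    using degree_mult_le[of A B] by linarith
  then have "degree (A * B) < a + b - 1" using False by linarith
  then show ?thesis using below_iff_degree[of "a + b - 1" "A * B"] by linarith
qed (use assms in auto)

lemma sum_below_shift:
  assumes "v \<in> below m"
  shows "(\<Sum>u\<in>below m. f (u + v)) = (\<Sum>u\<in>below m. f u)"
  by (rule sum.reindex_bij_witness[of _ "\<lambda>u. u - v" "\<lambda>u. u + v"]) (use assms in auto)

locale odd_degree_prime = prime_poly P for P :: "'a :: {finite, field} poly" +
  fixes g :: nat
  assumes degree_P: "degree P = 2 * g + 1"
begin

text \<open>For odd degree of \<open>P\<close> this is the nontrivial quadratic character of F_q. It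
  takes the place of an additive character, and all sums stay in the integers.\<close>

definition eta :: "'a \<Rightarrow> int" where "eta b = chi [:b:]"
text \<open>\<open>lam (A * B)\<close> is a symmetric bilinear form on residues for which
  \<open>below m\<close> and \<open>below (2 * g + 1 - m)\<close> are orthogonal complements. This
  duality exchanges degrees j and 2 g - j.\<close>

definition lam :: "'a poly \<Rightarrow> 'a" where "lam B = coeff (B mod P) (2 * g)"
definition acoef :: "nat \<Rightarrow> int" where "acoef j = (\<Sum>A\<in>monic_of_degree j. chi A)"

lemma eta_mult: "eta (b * c) = eta b * eta c"
  using chi_mult[of "[:b:]" "[:c:]"] by (simp add: eta_def mult.commute)

lemma eta_0 [simp]: "eta 0 = 0" by (simp add: eta_def)

lemma not_dvd_const: "b \<noteq> 0 \<Longrightarrow> \<not> P dvd [:b:]"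
  using R_dvd[of "[:b:]"] n0 by (simp add: below_iff_degree)

lemma eta_square: "b \<noteq> 0 \<Longrightarrow> eta b * eta b = 1"
  unfolding eta_def using not_dvd_const by (rule chi_square)

lemma chi_smult: "chi (smult b A) = eta b * chi A"
  using chi_mult[of "[:b:]" A] by (simp add: eta_def)

lemma field_power_card_minus_1:
  assumes "(b :: 'a) \<noteq> 0"
  shows "b ^ (CARD('a) - 1) = 1"
proof -
  have "b * b ^ (CARD('a) - 1) = b ^ CARD('a)" by (metis power_eq_if zero_less_card_finite neq0_conv)
  then show ?thesis using assms by simp
qed

text \<open>Here the odd degree enters: h = e S with e = (q - 1)/2 and S = 1 + q + ... + q^(n-1),
  and S has the parity of n. So \<open>b^e = -1\<close> implies \<open>b^h = -1\<close>; such a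
  \<open>b\<close> exists since x^e - 1 has at most e < q - 1 roots.\<close>

lemma eta_minus_1: "\<exists>b. eta b = -1"
proof -
  define e where "e = (CARD('a) - 1) div 2"
  define S where "S = (\<Sum>i<n. CARD('a) ^ i)"
  have e: "2 * e = CARD('a) - 1" using odd_q by (simp add: e_def)
  then have e0: "e > 0" using card_field_ge_2[where 'a='a] by linarith
  have "(CARD('a) - 1) * S = CARD('a) ^ n - 1"
  proof -
    have "CARD('a) \<noteq> 0" by simp
    then obtain r where r: "CARD('a) = Suc r" using not0_implies_Suc by blast
    have "(CARD('a) - 1) * (\<Sum>i<m. CARD('a) ^ i) + 1 = CARD('a) ^ m" for m
      unfolding r by (induction m) (auto simp: algebra_simps)
    from this[of n] show ?thesis unfolding S_def by linarith
  qed
  then have "2 * (e * S) = 2 * h" using h(1) e by (metis mult.assoc)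
  then have hS: "h = e * S" by simp
  have "odd S"
  proof -
    have "even (\<Sum>i<m. CARD('a) ^ i) \<longleftrightarrow> even m" for m using odd_q by (induction m) auto
    then have "even S \<longleftrightarrow> even n" unfolding S_def by blast
    moreover have "odd n" by (simp add: degree_P)
    ultimately show ?thesis by blast
  qed
  obtain b :: 'a where b: "b \<noteq> 0" "b ^ e \<noteq> 1"
  proof (rule ccontr)
    assume "\<not> thesis"
    then have all: "b ^ e = 1" if "b \<noteq> 0" for b :: 'a using that \<open>\<And>b. b \<noteq> 0 \<Longrightarrow> b ^ e \<noteq> 1 \<Longrightarrow> thesis\<close> by blast
    define F :: "'a poly" where "F = monom 1 e - 1"
    have F0: "F \<noteq> 0"
    proof
      assume "F = 0"
      then have "coeff F e = 0" by simp
      then show False using e0 by (simp add: F_def)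
    qed
    have "degree F \<le> e" unfolding F_def by (intro degree_diff_le) (auto simp: degree_monom_le)
    moreover have "card {x. poly F x = 0} \<le> degree F" using F0 by (rule card_poly_roots_bound)
    moreover have "UNIV - {0} \<subseteq> {x. poly F x = 0}" by (auto simp: F_def poly_monom all)
    then have "card (UNIV - {0 :: 'a}) \<le> card {x. poly F x = 0}" by (intro card_mono) auto
    then have "CARD('a) - 1 \<le> card {x. poly F x = 0}" by (simp add: card_Diff_singleton)
    ultimately show False using e e0 by linarith
  qed
  have "(b ^ e)\<^sup>2 = 1" using field_power_card_minus_1[OF b(1)] e by (simp add: power_mult[symmetric] mult.commute)
  then have be: "b ^ e = -1" using b(2) by (simp add: power2_eq_1_iff)
  have "[:b:] ^ h = [:(b ^ e) ^ S:]" by (simp add: poly_const_pow hS power_mult)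
  also have "\<dots> = -1" using be \<open>odd S\<close> by (simp add: one_pCons)
  finally have "eta b = -1" unfolding eta_def by (intro chi_eqI) auto
  then show ?thesis ..
qed

lemma sum_eta: "(\<Sum>b\<in>UNIV. eta b) = 0"
proof -
  obtain c where c: "eta c = -1" using eta_minus_1 by blast
  then have c0: "c \<noteq> 0" by auto
  have "(\<Sum>b\<in>UNIV. eta b) = (\<Sum>b\<in>UNIV. eta (c * b))"
    by (rule sum.reindex_bij_witness[of _ "\<lambda>b. c * b" "\<lambda>b. b / c"]) (use c0 in auto)
  also have "\<dots> = - (\<Sum>b\<in>UNIV. eta b)" by (simp add: eta_mult c sum_negf)
  finally show ?thesis by simp
qed

lemma sum_eta_affine: "d \<noteq> 0 \<Longrightarrow> (\<Sum>b\<in>UNIV. eta (a + b * d)) = 0"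
proof -
  assume d: "d \<noteq> 0"
  have "(\<Sum>b\<in>UNIV. eta (a + b * d)) = (\<Sum>b\<in>UNIV. eta b)"
    by (rule sum.reindex_bij_witness[of _ "\<lambda>b. (b - a) / d" "\<lambda>b. a + b * d"]) (use d in auto)
  then show ?thesis by (simp add: sum_eta)
qed

text \<open>Averaging over translations by multiples of \<open>u0\<close> lets the argument of
  \<open>eta\<close> run through all of F_q, where the sum of \<open>eta\<close> vanishes.\<close>

lemma sum_eta_functional:
  assumes add: "\<And>u v. \<phi> (u + v) = \<phi> u + \<phi> v" and smult: "\<And>c u. \<phi> (smult c u) = c * \<phi> u"
    and u0: "u0 \<in> below m" "\<phi> u0 \<noteq> 0"
  shows "(\<Sum>u\<in>below m. eta (a + \<phi> u)) = 0"
proof -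
  let ?T = "\<Sum>u\<in>below m. eta (a + \<phi> u)"
  have "int CARD('a) * ?T = (\<Sum>b\<in>(UNIV :: 'a set). ?T)" by simp
  also have "\<dots> = (\<Sum>b\<in>UNIV. \<Sum>u\<in>below m. eta (a + \<phi> (u + smult b u0)))"
    by (intro sum.cong refl sum_below_shift[symmetric]) (use u0 in auto)
  also have "\<dots> = (\<Sum>u\<in>below m. \<Sum>b\<in>UNIV. eta ((a + \<phi> u) + b * \<phi> u0))"
    by (subst sum.swap) (simp add: add smult add.assoc)
  also have "\<dots> = 0" using sum_eta_affine[OF u0(2)] by simp
  finally show ?thesis by simp
qed

lemma lam_add: "lam (A + B) = lam A + lam B" by (simp add: lam_def poly_mod_add_left)
lemma lam_smult: "lam (smult c A) = c * lam A" by (simp add: lam_def mod_smult_left)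
lemma lam_mod: "lam (A mod P) = lam A" by (simp add: lam_def)
lemma lam_0 [simp]: "lam 0 = 0" by (simp add: lam_def)

lemma lam_below: "A \<in> below (2 * g + 1) \<Longrightarrow> lam A = coeff A (2 * g)"
  using R_mod[of A] by (simp add: lam_def degree_P)

lemma lam_below': "A \<in> below (2 * g) \<Longrightarrow> lam A = 0"
  using lam_below[of A] below_mono[of "2 * g" "2 * g + 1"] by (auto simp: below_def)

lemma sum_eta_lam_mult:
  assumes C: "C \<in> R" and m: "m \<le> 2 * g + 1"
  shows "(\<Sum>u\<in>below m. eta (a + lam (u * C))) =
    (if C \<in> below (2 * g + 1 - m) then int CARD('a) ^ m * eta a else 0)"
proof (cases "C \<in> below (2 * g + 1 - m)")
  case True
  have "lam (u * C) = 0" if "u \<in> below m" for u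
    using below_mult[OF that True] m by (intro lam_below') simp
  then show ?thesis using True by (simp add: card_below)
next
  case False
  then have C0: "C \<noteq> 0" by auto
  have dC: "degree C \<le> 2 * g" using C n0 by (simp add: below_iff_degree degree_P)
  have "2 * g + 1 - m \<le> degree C"
    using False C0 by (cases "2 * g + 1 - m = 0") (auto simp: below_iff_degree)
  then have lt: "2 * g - degree C < m" using dC m by linarith
  \<comment> \<open>This monomial moves the leading coefficient of \<open>C\<close> to position 2 g,
    where \<open>lam\<close> reads it; it lies in \<open>below m\<close> exactly because
    \<open>C\<close> is too large for the orthogonal complement.\<close>
  define u0 :: "'a poly" where "u0 = monom 1 (2 * g - degree C)"
  have u0: "u0 \<in> below m" using lt by (auto simp: u0_def below_def)
  have "u0 * C \<in> below (2 * g + 1)"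
  proof -
    have "degree (u0 * C) \<le> degree u0 + degree C" by (rule degree_mult_le)
    also have "degree u0 \<le> 2 * g - degree C" by (simp add: u0_def degree_monom_le)
    finally show ?thesis using dC by (simp add: below_iff_degree)
  qed
  then have "lam (u0 * C) = coeff (u0 * C) (2 * g)" by (rule lam_below)
  also have "\<dots> = lead_coeff C" using dC by (simp add: u0_def coeff_monom_mult)
  finally have "lam (u0 * C) \<noteq> 0" using C0 by simp
  then have "(\<Sum>u\<in>below m. eta (a + lam (u * C))) = 0"
    using u0 by (intro sum_eta_functional[of "\<lambda>u. lam (u * C)" u0])
      (simp_all add: lam_add lam_smult distrib_right)
  then show ?thesis using False by simp
qed

definition gauss :: int where "gauss = (\<Sum>B\<in>R. chi B * eta (lam B))"

text \<open>Only the substitution of k B for B and the multiplicativity of \<open>chi\<close> are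
  used, no additivity of \<open>eta\<close>; that is why \<open>eta\<close> can replace the
  exponential. For \<open>P dvd k\<close> both sides are zero because
  \<open>eta 0 = 0\<close>.\<close>

lemma gauss_twist: "(\<Sum>B\<in>R. chi B * eta (lam (k * B))) = chi k * gauss"
proof (cases "P dvd k")
  case True
  then have "lam (k * B) = 0" for B by (simp add: lam_def)
  then show ?thesis using True by (simp add: chi_eq_0_iff[THEN iffD2])
next
  case False
  have "chi B * eta (lam (k * B)) = chi k * (chi ((k * B) mod P) * eta (lam ((k * B) mod P)))" for B
    using chi_square[OF False] by (simp add: quad_char_mod lam_mod chi_mult mult.assoc[symmetric])
  then have "(\<Sum>B\<in>R. chi B * eta (lam (k * B))) =
      chi k * (\<Sum>B\<in>R. chi ((k * B) mod P) * eta (lam ((k * B) mod P)))"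
    by (simp add: sum_distrib_left)
  also have "(\<Sum>B\<in>R. chi ((k * B) mod P) * eta (lam ((k * B) mod P))) = gauss"
    unfolding gauss_def by (rule sum_mult_mod[OF False])
  finally show ?thesis .
qed

lemma card_square_roots:
  assumes B: "B \<in> R"
  shows "int (card {C \<in> R. C\<^sup>2 mod P = B}) = 1 + chi B"
proof -
  have root: "C' = C \<or> C' = - C" if "C \<in> R" "C' \<in> R" "C'\<^sup>2 mod P = C\<^sup>2 mod P" for C C'
  proof -
    have "P dvd C'\<^sup>2 - C\<^sup>2" using that(3) by (simp add: mod_eq_dvd_iff[symmetric])
    then have "P dvd (C' - C) * (C' + C)" by (simp add: power2_eq_square algebra_simps)
    then have "P dvd C' - C \<or> P dvd C' + C" by (simp add: dvd_mult_iff)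
    moreover have "C' - C \<in> R" "C' + C \<in> R" using that by auto
    ultimately have "C' - C = 0 \<or> C' + C = 0" using R_dvd by blast
    then show ?thesis by (auto simp: add_eq_0_iff2)
  qed
  consider "B = 0" | "B \<noteq> 0" "chi B = 1" | "B \<noteq> 0" "chi B = -1"
    using chi_range[of B] chi_eq_0_iff[of B] R_dvd[OF B] by auto
  then show ?thesis
  proof cases
    case 1
    have "{C \<in> R. C\<^sup>2 mod P = B} = {0}"
      using 1 R_dvd by (auto simp: power2_eq_square dvd_mult_iff mod_eq_0_iff_dvd)
    then show ?thesis using 1 by simp
  next
    case 2
    then obtain D where "[D\<^sup>2 = B] (mod P)" by (auto simp: quad_char_def split: if_splits)
    then have D: "(D mod P)\<^sup>2 mod P = B" using R_mod[OF B] by (simp add: cong_def power_mod)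
    define C where "C = D mod P"
    have C: "C \<in> R" "C\<^sup>2 mod P = B" using D by (simp_all add: C_def)
    have "{C \<in> R. C\<^sup>2 mod P = B} = {C, - C}" using C root[OF C(1)] by auto
    moreover have "C \<noteq> - C"
    proof
      assume "C = - C"
      then have "2 * C = 0" by (metis add.right_inverse mult_2)
      then have "P dvd 2 * C" by (metis dvd_0_right)
      then have "P dvd C" using not_dvd_2 dvd_mult_iff by blast
      then show False using C 2 by (simp add: R_dvd)
    qed
    ultimately show ?thesis using 2 by simp
  next
    case 3
    then have "{C \<in> R. C\<^sup>2 mod P = B} = {}"
      using R_mod[OF B] by (auto simp: quad_char_def cong_def split: if_splits)
    then show ?thesis using 3 by simp
  qed
qed

lemma sum_over_squares:
  "(\<Sum>C\<in>R. F (C\<^sup>2 mod P)) = (\<Sum>B\<in>R. (1 + chi B) * F B)" for F :: "'a poly \<Rightarrow> int"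
proof -
  have "(\<Sum>C\<in>R. F (C\<^sup>2 mod P)) = (\<Sum>B\<in>R. \<Sum>C | C \<in> R \<and> C\<^sup>2 mod P = B. F (C\<^sup>2 mod P))"
    by (rule sum.group[symmetric]) auto
  also have "\<dots> = (\<Sum>B\<in>R. int (card {C \<in> R. C\<^sup>2 mod P = B}) * F B)"
    by (intro sum.cong refl) simp
  also have "\<dots> = (\<Sum>B\<in>R. (1 + chi B) * F B)"
    by (intro sum.cong refl) (simp add: card_square_roots)
  finally show ?thesis .
qed

text \<open>The quadratic form \<open>C \<mapsto> lam (C\<^sup>2)\<close> vanishes on the \<open>g\<close>-dimensional space of polynomials of
  degree \<open>< g\<close>, whose orthogonal complement consists of the polynomials of degree \<open>\<le> g\<close>.  This
  determines the sign of the Gauss sum.\<close>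

lemma gauss_eq: "gauss = (int CARD('a) - 1) * int CARD('a) ^ g"
proof -
  have two: "(2 :: 'a) \<noteq> 0" using odd_q by (rule two_neq_0)
  \<comment> \<open>Adding this zero replaces \<open>chi B\<close> by \<open>1 + chi B\<close>, the
    number of square roots of B, and turns the Gauss sum into a sum of \<open>eta\<close> over
    values of a quadratic form.\<close>
  have "(\<Sum>B\<in>R. eta (lam B)) = 0"
    using sum_eta_functional[of lam "monom 1 (2 * g)" n 0]
      lam_below[of "monom 1 (2 * g)"] by (simp add: lam_add lam_smult degree_P below_def)
  then have "gauss = (\<Sum>B\<in>R. (1 + chi B) * eta (lam B))"
    by (simp add: gauss_def distrib_right sum.distrib)
  also have "\<dots> = (\<Sum>C\<in>R. eta (lam (C\<^sup>2)))"
    by (subst sum_over_squares[symmetric]) (simp add: lam_mod)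
  finally have c: "gauss = (\<Sum>C\<in>R. eta (lam (C\<^sup>2)))" .
  have sq: "lam ((C + u)\<^sup>2) = lam (C\<^sup>2) + lam (u * smult 2 C)" if u: "u \<in> below g" for u C
  proof -
    have s2: "smult 2 C = C + C" by (metis one_add_one smult_1_left smult_add_left)
    have "(C + u)\<^sup>2 = C\<^sup>2 + u * smult 2 C + u\<^sup>2"
      unfolding s2 by (simp add: power2_eq_square algebra_simps)
    moreover have "u\<^sup>2 \<in> below (2 * g)"
      unfolding power2_eq_square using below_mult[OF u u] by (rule subsetD[OF below_mono, rotated]) simp
    ultimately show ?thesis by (simp add: lam_add lam_below')
  qed
  have "int CARD('a) ^ g * gauss = (\<Sum>u\<in>(below g :: 'a poly set). gauss)"
    by (simp add: card_below)
  also have "\<dots> = (\<Sum>u\<in>below g. \<Sum>C\<in>R. eta (lam ((C + u)\<^sup>2)))"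
    unfolding c
    by (intro sum.cong refl sum_below_shift[symmetric]) (use below_mono[of g n] in \<open>auto simp: degree_P\<close>)
  also have "\<dots> = (\<Sum>u\<in>below g. \<Sum>C\<in>R. eta (lam (C\<^sup>2) + lam (u * smult 2 C)))"
    by (intro sum.cong refl) (simp add: sq)
  also have "\<dots> = (\<Sum>C\<in>R. \<Sum>u\<in>below g. eta (lam (C\<^sup>2) + lam (u * smult 2 C)))"
    by (rule sum.swap)
  also have "\<dots> = (\<Sum>C\<in>R. if C \<in> below (g + 1) then int CARD('a) ^ g * eta (lam (C\<^sup>2)) else 0)"
  proof (rule sum.cong[OF refl])
    fix C assume C: "C \<in> R"
    have "smult 2 C \<in> below (g + 1) \<longleftrightarrow> C \<in> below (g + 1)" using two by (auto simp: below_def)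
    then show "(\<Sum>u\<in>below g. eta (lam (C\<^sup>2) + lam (u * smult 2 C))) =
        (if C \<in> below (g + 1) then int CARD('a) ^ g * eta (lam (C\<^sup>2)) else 0)"
      using sum_eta_lam_mult[of "smult 2 C" g "lam (C\<^sup>2)"] C by (simp add: mult_2)
  qed
  also have "\<dots> = (\<Sum>C\<in>{C \<in> R. C \<in> below (g + 1)}. int CARD('a) ^ g * eta (lam (C\<^sup>2)))"
    by (rule sum.inter_filter[symmetric]) simp
  also have "{C \<in> R. C \<in> below (g + 1)} = below (g + 1)"
    using below_mono[of "g + 1" n] by (auto simp: degree_P)
  also have "(\<Sum>C\<in>below (g + 1). int CARD('a) ^ g * eta (lam (C\<^sup>2))) =
      int CARD('a) ^ g * (\<Sum>C\<in>(below (g + 1) :: 'a poly set). if C \<in> below g then 0 else 1)"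
    unfolding sum_distrib_left
  proof (intro sum.cong refl arg_cong2[where f = "(*)"])
    fix C :: "'a poly" assume C: "C \<in> below (g + 1)"
    then have "C\<^sup>2 \<in> below (2 * g + 1)"
      using below_mult[OF C C] by (simp add: power2_eq_square mult_2)
    then have "lam (C\<^sup>2) = coeff (C\<^sup>2) (2 * g)" by (rule lam_below)
    also have "\<dots> = coeff C g * coeff C g"
    proof -
      have "coeff (C * C) (g + g) = (\<Sum>i\<le>g+g. coeff C i * coeff C (g + g - i))"
        by (rule coeff_mult)
      also have "\<dots> = (\<Sum>i\<in>{g}. coeff C i * coeff C (g + g - i))"
      proof (rule sum.mono_neutral_right)
        show "\<forall>i\<in>{..g+g} - {g}. coeff C i * coeff C (g + g - i) = 0"
        proof
          fix i assume "i \<in> {..g+g} - {g}"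
          then have "i \<ge> g + 1 \<or> g + g - i \<ge> g + 1" by auto
          then show "coeff C i * coeff C (g + g - i) = 0" using C by (auto simp: below_def)
        qed
      qed auto
      finally show ?thesis by (simp add: power2_eq_square mult_2)
    qed
    finally have "eta (lam (C\<^sup>2)) = eta (coeff C g) * eta (coeff C g)" by (simp add: eta_mult)
    moreover have "C \<in> below g \<longleftrightarrow> coeff C g = 0"
      using C unfolding below_def by (auto simp: le_Suc_eq dest: le_neq_implies_less)
    ultimately show "eta (lam (C\<^sup>2)) = (if C \<in> below g then 0 else 1)"
      using eta_square[of "coeff C g"] by auto
  qed
  also have "(\<Sum>C\<in>(below (g + 1) :: 'a poly set). if C \<in> below g then 0 else 1) = (int CARD('a) - 1) * int CARD('a) ^ g"
  proof -
    have "(\<Sum>C\<in>(below (g + 1) :: 'a poly set). if C \<in> below g then 0 else (1::int)) =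
        (\<Sum>C\<in>(below (g + 1) - below g :: 'a poly set). 1)"
      by (rule sum.mono_neutral_cong_right) auto
    also have "\<dots> = int (card (below (g + 1) - below g :: 'a poly set))" by simp
    also have "card (below (g + 1) - below g :: 'a poly set) = CARD('a) ^ (g + 1) - CARD('a) ^ g"
      using below_mono[of g "g + 1"] by (subst card_Diff_subset) (auto simp: card_below)
    finally show ?thesis by (simp add: of_nat_diff algebra_simps)
  qed
  finally show ?thesis by simp
qed

text \<open>Writing B = b A with A monic, the two factors \<open>eta b\<close> cancel, so every b
  contributes the same sum over monic A.\<close>

lemma sum_chi_eta_lead:
  "(\<Sum>B\<in>below (d + 1). chi B * eta (coeff B d)) = (int CARD('a) - 1) * acoef d"
proof -
  have "(\<Sum>B\<in>below (d + 1). chi B * eta (coeff B d)) =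
      (\<Sum>B\<in>{B \<in> below (d + 1). coeff B d \<noteq> 0}. chi B * eta (coeff B d))"
    by (rule sum.mono_neutral_right) auto
  also have "\<dots> = (\<Sum>(b :: 'a, A)\<in>(UNIV - {0}) \<times> monic_of_degree d. chi A)"
  proof (rule sum.reindex_bij_witness[where i = "\<lambda>(b, A). smult b A" and
        j = "\<lambda>B. (coeff B d, smult (inverse (coeff B d)) B)"], goal_cases)
    case (2 B)
    then have "coeff B d \<noteq> 0" "degree B \<le> d" by (auto simp: below_iff_degree)
    then have "degree B = d" by (metis le_degree le_antisym)
    then show ?case using 2 by (auto simp: monic_of_degree_def)
  next
    case (4 x)
    then show ?case by (auto simp: monic_of_degree_def below_iff_degree)
  next
    case (5 B)
    then have "chi B = eta (coeff B d) * chi (smult (inverse (coeff B d)) B)"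
      by (subst chi_smult[symmetric]) simp
    then have "chi B * eta (coeff B d) =
        (eta (coeff B d) * eta (coeff B d)) * chi (smult (inverse (coeff B d)) B)"
      by (simp only: ac_simps)
    also have "eta (coeff B d) * eta (coeff B d) = 1" using 5 by (intro eta_square) simp
    finally show ?case by simp
  qed (auto simp: monic_of_degree_def)
  also have "\<dots> = (\<Sum>b\<in>UNIV - {0 :: 'a}. acoef d)"
    by (simp add: acoef_def sum.cartesian_product[symmetric])
  also have "\<dots> = (int CARD('a) - 1) * acoef d"
    by (simp add: card_Diff_singleton of_nat_diff)
  finally show ?thesis .
qed

text \<open>Sum \<open>chi B * eta (lam (k * B))\<close> over all residues B and all monic k of
  degree j. Summing over B first gives \<open>gauss * acoef j\<close> by twisting. Summing over k =
  t^j + u first kills every B outside \<open>below (2 * g - j + 1)\<close>, and on the rest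
  \<open>lam (t^j B)\<close> is the coefficient of t^(2 g - j), so \<open>sum_chi_eta_lead\<close>
  applies.\<close>

theorem functional_equation:
  assumes j: "j \<le> 2 * g"
  shows "int CARD('a) ^ g * acoef j = int CARD('a) ^ j * acoef (2 * g - j)"
proof -
  have "gauss * acoef j = (\<Sum>k\<in>monic_of_degree j. \<Sum>B\<in>R. chi B * eta (lam (k * B)))"
    by (simp add: acoef_def sum_distrib_left gauss_twist mult.commute)
  also have "\<dots> = (\<Sum>B\<in>R. chi B * (\<Sum>k\<in>monic_of_degree j. eta (lam (k * B))))"
    by (subst sum.swap) (simp add: sum_distrib_left)
  also have "\<dots> = (\<Sum>B\<in>R. chi B * (\<Sum>u\<in>below j. eta (lam (monom 1 j * B) + lam (u * B))))"
    by (simp add: sum_monic_of_degree distrib_right lam_add)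
  also have "\<dots> = (\<Sum>B\<in>R. if B \<in> below (2 * g - j + 1)
      then int CARD('a) ^ j * (chi B * eta (coeff B (2 * g - j))) else 0)"
  proof (rule sum.cong[OF refl])
    fix B assume B: "B \<in> R"
    have eq: "2 * g + 1 - j = 2 * g - j + 1" using j by simp
    have "lam (monom 1 j * B) = coeff B (2 * g - j)" if "B \<in> below (2 * g - j + 1)"
    proof -
      have "monom 1 j \<in> (below (j + 1) :: 'a poly set)" by (auto simp: below_def)
      from below_mult[OF this that] have "monom 1 j * B \<in> below (2 * g + 1)" using j by simp
      then show ?thesis using j by (simp add: lam_below coeff_monom_mult)
    qed
    then show "chi B * (\<Sum>u\<in>below j. eta (lam (monom 1 j * B) + lam (u * B))) =
        (if B \<in> below (2 * g - j + 1) then int CARD('a) ^ j * (chi B * eta (coeff B (2 * g - j))) else 0)"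
      using sum_eta_lam_mult[OF B, of j "lam (monom 1 j * B)"] j unfolding eq by simp
  qed
  also have "\<dots> = (\<Sum>B\<in>{B \<in> R. B \<in> below (2 * g - j + 1)}.
      int CARD('a) ^ j * (chi B * eta (coeff B (2 * g - j))))"
    by (rule sum.inter_filter[symmetric]) simp
  also have "{B \<in> R. B \<in> below (2 * g - j + 1)} = below (2 * g - j + 1)"
    using below_mono[of "2 * g - j + 1" n] by (auto simp: degree_P)
  also have "(\<Sum>B\<in>below (2 * g - j + 1). int CARD('a) ^ j * (chi B * eta (coeff B (2 * g - j)))) =
      int CARD('a) ^ j * ((int CARD('a) - 1) * acoef (2 * g - j))"
    by (simp only: sum_distrib_left[symmetric] sum_chi_eta_lead)
  finally have "(int CARD('a) - 1) * (int CARD('a) ^ g * acoef j) =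
      (int CARD('a) - 1) * (int CARD('a) ^ j * acoef (2 * g - j))"
    by (simp add: gauss_eq algebra_simps)
  moreover have "int CARD('a) - 1 \<noteq> 0" using card_field_ge_2[where 'a='a] by linarith
  ultimately show ?thesis by simp
qed

end

section \<open>Polynomials in two variables, as polynomials over F_q[t]\<close>

abbreviation poly_X :: "'a :: {finite, field} poly" where "poly_X \<equiv> [:0, 1:]"

text \<open>The space of unknowns in Stepanov's construction, of dimension J D over F_q. Its outer
  variable is going to be replaced by t^Q.\<close>

definition bibelow :: "nat \<Rightarrow> nat \<Rightarrow> 'a :: {finite, field} poly poly set" where
  "bibelow J D = {r. (\<forall>i. coeff r i \<in> below D) \<and> (\<forall>i\<ge>J. coeff r i = 0)}"

lemma bibelow_0 [simp]: "bibelow 0 D = {0}"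
  by (auto simp: bibelow_def poly_eq_iff)

lemma bibelow_Suc: "bibelow (Suc J) D = (\<lambda>(a, r). pCons a r) ` (below D \<times> bibelow J D)"
proof (rule set_eqI, rule iffI)
  fix r :: "'a poly poly" assume r: "r \<in> bibelow (Suc J) D"
  obtain a r' where eq: "r = pCons a r'" by (cases r)
  have "coeff r 0 \<in> below D" using r unfolding bibelow_def by blast
  then have "a \<in> below D" by (simp add: eq)
  moreover have "coeff r' i \<in> below D" for i
  proof -
    have "coeff r (Suc i) \<in> below D" using r unfolding bibelow_def by blast
    then show ?thesis by (simp add: eq)
  qed
  moreover have "coeff r' i = 0" if "i \<ge> J" for i
  proof -
    have "coeff r (Suc i) = 0" using r that unfolding bibelow_def by blast
    then show ?thesis by (simp add: eq)
  qed
  ultimately show "r \<in> (\<lambda>(a, r). pCons a r) ` (below D \<times> bibelow J D)"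
    unfolding eq bibelow_def by blast
next
  fix r :: "'a poly poly" assume "r \<in> (\<lambda>(a, r). pCons a r) ` (below D \<times> bibelow J D)"
  then show "r \<in> bibelow (Suc J) D"
    by (auto simp: bibelow_def coeff_pCons split: nat.splits)
qed

lemma finite_bibelow [simp]: "finite (bibelow J D)"
  by (induction J) (auto simp: bibelow_Suc)

lemma card_bibelow: "card (bibelow J D :: 'a :: {finite, field} poly poly set) = CARD('a) ^ (J * D)"
proof (induction J)
  case (Suc J)
  have "inj_on (\<lambda>(a, r). pCons a r) (below D \<times> (bibelow J D :: 'a poly poly set))"
    by (auto simp: inj_on_def)
  then show ?case using Suc
    by (simp add: bibelow_Suc card_image card_cartesian_product card_below power_add)
qed simp

lemma bibelow_diff: "r \<in> bibelow J D \<Longrightarrow> r' \<in> bibelow J D \<Longrightarrow> r - r' \<in> bibelow J D"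
  by (auto simp: bibelow_def)

lemma below_multI: "A \<in> below a \<Longrightarrow> B \<in> below b \<Longrightarrow> a + b \<le> c + 1 \<Longrightarrow> A * B \<in> below c"
  by (rule subsetD[OF below_mono below_mult]) auto

text \<open>Re-expanding in powers of Y after substituting t + Y for the outer variable costs at
  most one degree in t per outer power, hence at most J - 1.\<close>

lemma coeff_shift_below:
  assumes "D > 0" "r \<in> bibelow J D"
  shows "coeff (pcompose r [:poly_X, 1:]) l \<in> below (D + J - 1)"
  using assms(2)
proof (induction J arbitrary: r l)
  case (Suc J)
  obtain a r' where r: "r = pCons a r'" "a \<in> below D" "r' \<in> bibelow J D"
    using Suc.prems by (auto simp: bibelow_Suc)
  have a: "a \<in> below (D + Suc J - 1)" using r(2) below_mono[of D "D + Suc J - 1"] by auto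
  have c: "coeff (pcompose r' [:poly_X, 1:]) k \<in> below (D + J - 1)" for k
    using r(3) by (rule Suc.IH)
  then have c1: "coeff (pcompose r' [:poly_X, 1:]) k \<in> below (D + Suc J - 1)" for k
    using below_mono[of "D + J - 1" "D + Suc J - 1"] by auto
  have c2: "poly_X * coeff (pcompose r' [:poly_X, 1:]) k \<in> below (D + Suc J - 1)" for k
    by (rule below_multI[OF _ c[of k], of _ 2]) (use assms(1) in \<open>auto simp: below_iff_degree\<close>)
  show ?case
    using a c1 c2 by (cases l) (auto simp: r(1) pcompose_pCons simp del: coeff_pcompose_0)
qed simp

lemma degree_poly_bibelow:
  fixes T :: "'a :: {finite, field} poly"
  assumes r: "r \<in> bibelow J D" and J: "J > 0"
  shows "degree (poly r T) \<le> D + (J - 1) * degree T"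
proof -
  have "degree r \<le> J - 1"
    using r J by (intro degree_le) (auto simp: bibelow_def)
  have "degree (coeff r i * T ^ i) \<le> D + (J - 1) * degree T" if "i \<le> degree r" for i
  proof -
    have "degree (coeff r i) \<le> D"
      using r by (intro degree_le) (auto simp: bibelow_def below_def)
    moreover have "degree (T ^ i) \<le> degree T * i" by (rule degree_power_le)
    moreover have "degree T * i \<le> (J - 1) * degree T" 
      using that \<open>degree r \<le> J - 1\<close> by (metis le_trans mult.commute mult_le_mono1)
    ultimately show ?thesis using degree_mult_le[of "coeff r i" "T ^ i"] by linarith
  qed
  then show ?thesis unfolding poly_altdef by (intro degree_sum_le) auto
qed

subsection \<open>Square roots of power series over a ring containing one half\<close>

lemma smult_2: "smult 2 A = A + (A :: 'a :: field poly)"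
  by (metis one_add_one smult_1_left smult_add_left)

text \<open>The recursion solves 2 c_i + (sum of c_a c_(i-a) for 0 < a < i) = \<phi>_i, the Cauchy
  product equation of a square root with constant term 1; the only division is by 2.\<close>

fun sqrt_series :: "(nat \<Rightarrow> 'a :: field poly) \<Rightarrow> nat \<Rightarrow> 'a poly" where
  "sqrt_series \<phi> i = (if i = 0 then 1 else
     smult (inverse 2) (\<phi> i - (\<Sum>a\<in>{1..<i}. sqrt_series \<phi> a * sqrt_series \<phi> (i - a))))"

declare sqrt_series.simps [simp del]

lemma sqrt_series_0 [simp]: "sqrt_series \<phi> 0 = 1"
  by (simp add: sqrt_series.simps)

lemma sqrt_series_square:
  fixes \<phi> :: "nat \<Rightarrow> 'a :: field poly"
  assumes "(2 :: 'a) \<noteq> 0" "\<phi> 0 = 1"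
  shows "(\<Sum>a\<le>i. sqrt_series \<phi> a * sqrt_series \<phi> (i - a)) = \<phi> i"
proof (cases "i = 0")
  case False
  let ?c = "sqrt_series \<phi>"
  have "{..i} = insert 0 (insert i {1..<i})" using False by auto
  then have "(\<Sum>a\<le>i. ?c a * ?c (i - a)) = ?c i + (?c i + (\<Sum>a\<in>{1..<i}. ?c a * ?c (i - a)))"
    using False by simp
  also have "\<dots> = smult 2 (?c i) + (\<Sum>a\<in>{1..<i}. ?c a * ?c (i - a))"
    by (simp add: smult_2 add.assoc)
  also have "smult 2 (?c i) = \<phi> i - (\<Sum>a\<in>{1..<i}. ?c a * ?c (i - a))"
    using False assms(1) by (subst sqrt_series.simps) simp
  finally show ?thesis by simp
qed (use assms in simp)

lemma sqrt_series_degree: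
  fixes \<phi> :: "nat \<Rightarrow> 'a :: field poly"
  assumes "\<And>i. degree (\<phi> i) \<le> i * m"
  shows "degree (sqrt_series \<phi> i) \<le> i * m"
proof (induction i rule: less_induct)
  case (less i)
  have "degree (sqrt_series \<phi> a * sqrt_series \<phi> (i - a)) \<le> i * m" if "a \<in> {1..<i}" for a
  proof -
    have "degree (sqrt_series \<phi> a * sqrt_series \<phi> (i - a)) \<le> a * m + (i - a) * m"
      using degree_mult_le add_mono[OF less.IH[of a] less.IH[of "i - a"]] that order_trans by fastforce
    also have "\<dots> = i * m" using that by (simp add: add_mult_distrib[symmetric])
    finally show ?thesis .
  qed
  then have "degree (\<Sum>a\<in>{1..<i}. sqrt_series \<phi> a * sqrt_series \<phi> (i - a)) \<le> i * m"
    by (intro degree_sum_le) auto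
  then show ?case
    using assms[of i] by (subst sqrt_series.simps) (auto intro: degree_diff_le order_trans[OF degree_smult_le])
qed

subsection \<open>Stepanov's method\<close>

lemma square_dvd_square:
  fixes A B :: "'a :: field poly"
  assumes "A\<^sup>2 dvd B\<^sup>2" "A \<noteq> 0"
  shows "A dvd B"
  using assms
proof (induction "degree A" arbitrary: A B rule: less_induct)
  case less
  show ?case
  proof (cases "degree A = 0")
    case True
    then show ?thesis using less.prems by (metis is_unit_iff_degree unit_imp_dvd)
  next
    case False
    then obtain p where p: "irreducible p" "p dvd A"
      using exists_monic_irreducible_factor[of A] by auto
    have prime: "prime_elem p" using p(1) by (rule field_poly_irreducible_imp_prime)
    obtain A' where A': "A = p * A'" using p(2) by auto
    have nz: "p \<noteq> 0" "A' \<noteq> 0" using A' less.prems by auto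
    have "p dvd B\<^sup>2" using less.prems(1) p(2) by (metis dvd_trans dvd_mult2 power2_eq_square)
    then have "p dvd B" using prime by (metis prime_elem_dvd_power)
    then obtain B' where B': "B = p * B'" by auto
    have "A'\<^sup>2 dvd B'\<^sup>2" using less.prems(1) nz by (simp add: A' B' power_mult_distrib)
    moreover have "degree A' < degree A"
      using A' nz irreducible_degree_pos[OF p(1)] by (simp add: degree_mult_eq)
    ultimately show ?thesis using less.hyps[of A' B'] nz by (simp add: A' B')
  qed
qed

lemma poly_dvd_polyI: "p dvd q \<Longrightarrow> poly p x dvd poly q x"
  by (elim dvdE) simp

lemma prime_elem_X: "prime_elem (poly_X :: 'a :: {finite, field} poly)"
  by (intro field_poly_irreducible_imp_prime irreducible_linear_field_poly) simp

lemma prod_prime_powers_dvd: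
  fixes S :: "'a :: field poly set"
  assumes "finite S" "\<And>P. P \<in> S \<Longrightarrow> irreducible P \<and> lead_coeff P = 1" "\<And>P. P \<in> S \<Longrightarrow> P ^ k dvd R"
  shows "(\<Prod>P\<in>S. P ^ k) dvd R"
  using assms
proof (induction S rule: finite_induct)
  case (insert P S)
  have "(\<Prod>P\<in>S. P ^ k) dvd R" by (rule insert.IH) (use insert.prems in auto)
  then obtain K where K: "R = (\<Prod>P\<in>S. P ^ k) * K" by auto
  have P: "irreducible P" "lead_coeff P = 1" using insert.prems(1)[of P] by auto
  have prime: "prime_elem P" using P(1) by (rule field_poly_irreducible_imp_prime)
  have "\<not> P dvd P' ^ k" if "P' \<in> S" for P'
  proof
    assume "P dvd P' ^ k"
    then have "P dvd P'" using prime prime_elem_dvd_power by blast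
    then have "P = P'"
      using P insert.prems(1)[of P'] that by (intro monic_irreducible_dvd_eq) auto
    then show False using that insert.hyps by simp
  qed
  note ndvd = this
  have "\<not> P dvd (\<Prod>P\<in>F. P ^ k)" if "finite F" "F \<subseteq> S" for F
    using that prime_elem_not_unit[OF prime]
    by (induction F rule: finite_induct) (auto simp: prime_elem_dvd_mult_iff[OF prime] ndvd)
  then have nd: "\<not> P dvd (\<Prod>P\<in>S. P ^ k)" using insert.hyps(1) by blast
  have "P ^ k dvd R" by (rule insert.prems(2)) simp
  then have "P ^ k dvd (\<Prod>P\<in>S. P ^ k) * K" by (simp only: K)
  then have "P ^ k dvd K" by (rule prime_power_dvd_mult[OF prime nd])
  then show ?case
    using insert.hyps K by (simp add: mult.commute[of "P ^ k"] mult_dvd_mono)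
qed simp

locale stepanov =
  fixes f :: "'a :: {finite, field} poly" and g :: nat and e :: int
  assumes odd_q: "odd CARD('a)" and monic: "lead_coeff f = 1"
    and nonsquare: "\<And>B. f \<noteq> B\<^sup>2" and not_X2: "\<not> poly_X\<^sup>2 dvd f"
    and large: "CARD('a) ^ g \<ge> 2 * degree f + 3"
    and e: "e = 1 \<or> e = -1"
begin

abbreviation "m \<equiv> degree f"
definition Q :: nat where "Q = CARD('a) ^ (2 * g + 1)"
definition h :: nat where "h = (Q - 1) div 2"
text \<open>\<open>M\<close> is the order of vanishing and \<open>J\<close> the number of powers of
  t^Q in each component. The auxiliary polynomial has degree about J Q, so J close to M/2 bounds the
  total degree of the primes by about Q/2. \<open>D\<close> is as large as independence permits,
  which requires m + 2 (D - 1) < Q. The extra 2 m + 3 in \<open>J\<close> pays for the degrees added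
  by \<open>f^M\<close> and \<open>H\<close>.\<close>

definition M :: nat where "M = CARD('a) ^ g"
definition J :: nat where "J = (M + 2 * m + 3) div 2"
definition D :: nat where "D = (Q - m) div 2"
definition T :: "'a poly" where "T = monom 1 Q"
definition U :: "'a poly" where "U = T - poly_X"
definition G :: "'a poly" where "G = f ^ h"

lemma f0: "f \<noteq> 0" using monic by auto

lemma two: "(2 :: 'a) \<noteq> 0" using odd_q by (rule two_neq_0)

lemma q3: "CARD('a) \<ge> 3"
  using card_field_ge_2[where 'a='a] odd_q by (cases "CARD('a) = 2") auto

lemma Q_eq: "Q = CARD('a) * M * M"
  by (simp add: Q_def M_def power_add mult_2)

lemma odd_Q: "odd Q" and odd_M: "odd M" using odd_q by (auto simp: Q_def M_def)

lemma M_ge: "M \<ge> 2 * m + 3" using large by (simp add: M_def)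

lemma Q_ge: "Q \<ge> 3 * M * M"
proof -
  have "3 * (M * M) \<le> CARD('a) * (M * M)" by (rule mult_le_mono1[OF q3])
  then show ?thesis by (simp add: Q_eq mult.assoc)
qed

lemma Q_ge': "Q \<ge> 9 * M"
proof -
  have "3 * 3 * M \<le> 3 * M * M" using M_ge by (intro mult_le_mono) auto
  then show ?thesis using Q_ge by linarith
qed

lemma h: "2 * h + 1 = Q"
  unfolding h_def using odd_Q Q_ge' M_ge by presburger

lemma h_pos: "h > 0" using h Q_ge' M_ge by linarith

lemma J: "2 * J = M + 2 * m + 3"
proof -
  have "even (M + 2 * m + 3)" using odd_M by simp
  then show ?thesis by (simp add: J_def)
qed

lemma D: "2 * D \<le> Q - m" "Q - m \<le> 2 * D + 1" "D > 0"
  using Q_ge' M_ge by (auto simp: D_def)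

text \<open>On the left the number of linear conditions, M coefficients lying in
  \<open>below (D + J + m * M)\<close>; on the right the number of free parameters in a pair
  \<open>(r, s)\<close>. After cancelling M D, the surplus (2 m + 3) D beats (m + 1) M^2 because D
  is at least (3/4) M^2; \<open>large\<close> ensures J \<le> M.\<close>

lemma counting: "M * (D + J + m * M) < 2 * (J * D)"
proof -
  have JM: "J \<le> M" using J M_ge by linarith
  have "4 * D \<ge> Q" using D(2) Q_ge' M_ge by linarith
  then have 1: "3 * (M * M) \<le> 4 * D" using Q_ge by (simp add: mult.assoc)
  have "M * (J + m * M) \<le> M * (M + m * M)" using JM by simp
  also have "\<dots> = (m + 1) * (M * M)" by (simp add: algebra_simps)
  finally have 2: "M * (J + m * M) \<le> (m + 1) * (M * M)" .
  have "3 * ((m + 1) * (M * M)) = (m + 1) * (3 * (M * M))" by simp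
  also have "\<dots> \<le> (m + 1) * (4 * D)" using 1 by (rule mult_le_mono2)
  also have "\<dots> < 3 * ((2 * m + 3) * D)" using D(3) by (simp add: algebra_simps)
  finally have "M * (J + m * M) < (2 * m + 3) * D" using 2 by linarith
  moreover have "2 * (J * D) = (M + 2 * m + 3) * D" using J by (metis mult.assoc)
  ultimately show ?thesis by (simp add: algebra_simps)
qed

text \<open>The left side is f^(2 h + 1) = f^Q, and Frobenius does the rest.\<close>

lemma G2: "f * G\<^sup>2 = pcompose f T"
proof -
  have "f * G\<^sup>2 = f ^ Q" by (simp add: G_def flip: power_mult h) (simp add: mult.commute)
  then show ?thesis using poly_power_card_power[of f "2 * g + 1"] by (simp only: Q_def T_def)
qed

lemma T_dvd_pcompose: "T dvd pcompose f T - [:coeff f 0:]"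
  by (cases f) (simp add: pcompose_pCons)

lemma degree_T: "degree T = Q" by (simp add: T_def degree_monom_eq)

lemma T_not_0: "T \<noteq> 0" by (simp add: T_def)

text \<open>Multiplying by \<open>f * (r - G * s)\<close> removes the square root G: modulo T = t^Q
  it leaves f r^2 - f(0) s^2, which has degree below Q and so is zero. If f(0) is nonzero, f would
  be a square unless r = s = 0. If f(0) = 0, then r = 0, and since t^2 does not divide f, the factor
  t occurs in G only h times; thus t^(h+1) divides s, whose degree is too small for that.\<close>

lemma independence_step:
  assumes r: "r \<in> below D" and s: "s \<in> below D" and dvd: "T dvd r + G * s"
  shows "r = 0 \<and> s = 0"
proof -
  let ?f0 = "coeff f 0"
  have dr: "degree r \<le> D - 1" "degree s \<le> D - 1"
    using r s D(3) by (auto simp: below_iff_degree)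
  have "T dvd f * ((r + G * s) * (r - G * s))" using dvd by simp
  also have "f * ((r + G * s) * (r - G * s)) = f * r\<^sup>2 - (f * G\<^sup>2) * s\<^sup>2"
    by (simp add: power2_eq_square algebra_simps)
  finally have "T dvd f * r\<^sup>2 - pcompose f T * s\<^sup>2" by (simp add: G2)
  moreover have "T dvd (pcompose f T - [:?f0:]) * s\<^sup>2" using T_dvd_pcompose by simp
  ultimately have "T dvd (f * r\<^sup>2 - pcompose f T * s\<^sup>2) + (pcompose f T - [:?f0:]) * s\<^sup>2"
    by (rule dvd_add)
  then have dvd2: "T dvd f * r\<^sup>2 - [:?f0:] * s\<^sup>2" by (simp add: algebra_simps)
  have "degree (f * r\<^sup>2) \<le> m + (D - 1) * 2"
  proof -
    have "degree (r\<^sup>2) \<le> degree r * 2" by (rule degree_power_le)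
    then show ?thesis using degree_mult_le[of f "r\<^sup>2"] dr by linarith
  qed
  moreover have "degree ([:?f0:] * s\<^sup>2) \<le> (D - 1) * 2"
  proof -
    have "degree (s\<^sup>2) \<le> degree s * 2" by (rule degree_power_le)
    then show ?thesis using degree_mult_le[of "[:?f0:]" "s\<^sup>2"] dr by (simp del: mult_pCons_left)
  qed
  ultimately have "degree (f * r\<^sup>2 - [:?f0:] * s\<^sup>2) \<le> m + (D - 1) * 2"
    by (intro degree_diff_le) auto
  also have "\<dots> < Q" using D by linarith
  finally have "f * r\<^sup>2 - [:?f0:] * s\<^sup>2 = 0"
    using dvd_imp_degree_le[OF dvd2] degree_T by linarith
  then have eq: "f * r\<^sup>2 = smult ?f0 (s\<^sup>2)" by simp
  show ?thesis
  proof (cases "?f0 = 0")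
    case False
    have "r = 0"
    proof (rule ccontr)
      assume r0: "r \<noteq> 0"
      then have s0: "s \<noteq> 0" using eq f0 by auto
      define b where "b = lead_coeff r / lead_coeff s"
      have "lead_coeff (f * r\<^sup>2) = lead_coeff (smult ?f0 (s\<^sup>2))" by (simp only: eq)
      then have "(lead_coeff r)\<^sup>2 = ?f0 * (lead_coeff s)\<^sup>2"
        unfolding lead_coeff_mult lead_coeff_smult lead_coeff_power monic by simp
      then have "?f0 = b\<^sup>2" using s0 by (simp add: b_def field_simps)
      then have eq': "f * r\<^sup>2 = (smult b s)\<^sup>2" using eq by (simp add: power2_eq_square)
      then have "r\<^sup>2 dvd (smult b s)\<^sup>2" by (metis dvd_triv_right)
      then obtain Y where "smult b s = r * Y" using square_dvd_square[OF _ r0] by blast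
      then have "f * r\<^sup>2 = Y\<^sup>2 * r\<^sup>2" using eq' by (simp add: power_mult_distrib)
      then have "f = Y\<^sup>2" using r0 by simp
      then show False using nonsquare by blast
    qed
    then show ?thesis using eq False by simp
  next
    case True
    then have r0: "r = 0" using eq f0 by auto
    have "poly_X dvd f" using True by (cases f) (auto simp: dvd_def)
    then obtain f1 where f1: "f = poly_X * f1" by auto
    have nX: "\<not> poly_X dvd f1"
    proof
      assume "poly_X dvd f1"
      then have "poly_X\<^sup>2 dvd f" unfolding f1 power2_eq_square by (rule mult_dvd_mono[OF dvd_refl])
      then show False using not_X2 by contradiction
    qed
    have "G = poly_X ^ h * f1 ^ h" unfolding G_def by (subst f1) (rule power_mult_distrib)
    then have "poly_X ^ Q dvd poly_X ^ h * (f1 ^ h * s)"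
      using dvd r0 by (simp add: T_def monom_altdef mult.assoc)
    moreover have "Q = h + (h + 1)" using h by simp
    ultimately have "poly_X ^ h * poly_X ^ (h + 1) dvd poly_X ^ h * (f1 ^ h * s)"
      by (simp only: power_add)
    then have dv: "poly_X ^ (h + 1) dvd f1 ^ h * s" by (subst (asm) dvd_mult_cancel_left) auto
    have nd: "\<not> poly_X dvd f1 ^ h" using nX prime_elem_X prime_elem_dvd_power by blast
    have X: "poly_X ^ (h + 1) dvd s" by (rule prime_power_dvd_mult[OF prime_elem_X nd dv])
    have "degree (poly_X ^ (h + 1) :: 'a poly) = h + 1" by (simp add: degree_power_eq del: power_Suc)
    moreover have "D \<le> h" using D h by linarith
    ultimately have "s = 0" using dvd_imp_degree_le[OF X] dr by linarith
    then show ?thesis using r0 by simp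
  qed
qed

text \<open>The terms free of T vanish by \<open>independence_step\<close>; then divide by T and
  repeat. This is what makes the auxiliary polynomial nonzero.\<close>

lemma independence:
  assumes "r \<in> bibelow k D" "s \<in> bibelow k D" "poly r T + G * poly s T = 0"
  shows "r = 0 \<and> s = 0"
  using assms
proof (induction k arbitrary: r s)
  case (Suc k)
  obtain r0 r' where r: "r = pCons r0 r'" "r0 \<in> below D" "r' \<in> bibelow k D"
    using Suc.prems(1) by (auto simp: bibelow_Suc)
  obtain s0 s' where s: "s = pCons s0 s'" "s0 \<in> below D" "s' \<in> bibelow k D"
    using Suc.prems(2) by (auto simp: bibelow_Suc)
  have eq: "(r0 + G * s0) + T * (poly r' T + G * poly s' T) = 0"
    using Suc.prems(3) by (simp add: r s algebra_simps)
  then have "T dvd r0 + G * s0" by (metis add_eq_0_iff2 dvd_minus_iff dvd_triv_left)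
  then have 0: "r0 = 0 \<and> s0 = 0" using r s by (intro independence_step)
  then have "poly r' T + G * poly s' T = 0" using eq T_not_0 by simp
  then have "r' = 0 \<and> s' = 0" using r s by (intro Suc.IH)
  then show ?case using 0 r s by simp
qed simp

text \<open>This is A(t + Y), with Y the outer variable; at Y = U = t^Q - t it becomes
  A(t^Q).\<close>

definition lift :: "'a poly \<Rightarrow> 'a poly poly" where
  "lift A = pcompose (map_poly (\<lambda>c. [:c:]) A) [:poly_X, 1:]"

lemma poly_U_shift: "poly [:poly_X, 1:] U = T"
  by (simp add: U_def)

lemma poly_lift_U: "poly (lift f) U = f * G\<^sup>2"
proof -
  have "poly (lift f) U = poly (map_poly (\<lambda>c. [:c:]) f) T"
    by (simp only: lift_def poly_pcompose poly_U_shift)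
  also have "\<dots> = pcompose f T" by (rule pcompose_altdef[symmetric])
  finally show ?thesis by (simp only: G2)
qed

lemma lift_bibelow: "map_poly (\<lambda>c. [:c:]) f \<in> bibelow (m + 1) 1"
  by (auto simp: bibelow_def coeff_map_poly coeff_eq_0 below_def coeff_pCons split: nat.splits)

lemma coeff_lift_0: "coeff (lift f) 0 = f"
proof -
  have "coeff (lift f) 0 = poly (map_poly (\<lambda>c. [:c:]) f) poly_X" by (simp add: lift_def)
  also have "\<dots> = pcompose f poly_X" by (simp add: pcompose_altdef)
  finally show ?thesis by simp
qed

lemma degree_coeff_lift: "degree (coeff (lift f) i) \<le> m"
proof -
  have "coeff (lift f) i \<in> below (m + 1)"
    using coeff_shift_below[OF _ lift_bibelow, of i] by (simp add: lift_def)
  then show ?thesis by (simp add: below_iff_degree)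
qed

text \<open>\<open>c i / f^i\<close> is the coefficient of Y^i in the square root of f(t + Y) /
  f(t): scaling Y by f clears the denominators and produces the factor
  \<open>f ^ (i - 1)\<close>.\<close>

definition c :: "nat \<Rightarrow> 'a poly" where
  "c = sqrt_series (\<lambda>i. if i = 0 then 1 else coeff (lift f) i * f ^ (i - 1))"

lemma c_0 [simp]: "c 0 = 1" by (simp add: c_def)

lemma c_square:
  assumes "i > 0"
  shows "(\<Sum>a\<le>i. c a * c (i - a)) = coeff (lift f) i * f ^ (i - 1)"
  using assms two unfolding c_def by (subst sqrt_series_square) auto

lemma degree_c: "degree (c i) \<le> i * m"
  unfolding c_def
proof (rule sqrt_series_degree)
  fix i
  have "degree (coeff (lift f) i * f ^ (i - 1)) \<le> i * m" if "i \<noteq> 0"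
  proof -
    have "degree (coeff (lift f) i * f ^ (i - 1)) \<le> m + m * (i - 1)"
      using degree_mult_le[of "coeff (lift f) i" "f ^ (i - 1)"] degree_coeff_lift[of i]
        degree_power_le[of f "i - 1"] by linarith
    also have "\<dots> = i * m" using that by (cases i) auto
    finally show ?thesis .
  qed
  then show "degree (if i = 0 then 1 else coeff (lift f) i * f ^ (i - 1)) \<le> i * m" by simp
qed

text \<open>\<open>H\<close> is \<open>f^M\<close> times the truncated Taylor expansion of \<open>sqrt (f(t + Y) / f(t))\<close>,
  which represents \<open>G = f^((Q-1)/2)\<close> up to sign at \<open>Y = U = t^Q - t\<close>.\<close>

definition H :: "'a poly poly" where
  "H = (\<Sum>i<M. monom (c i * f ^ (M - i)) i)"

lemma coeff_H: "coeff H i = (if i < M then c i * f ^ (M - i) else 0)"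
  by (simp add: H_def coeff_sum)

lemma M_pos: "M > 0" using M_ge by linarith

lemma coeff_H_0: "coeff H 0 = f ^ M"
  using M_pos by (simp add: coeff_H)

lemma coeff_H_below: "coeff H i \<in> below (m * M + 1)"
proof -
  have "degree (c i * f ^ (M - i)) \<le> m * M" if "i < M"
  proof -
    have "degree (c i * f ^ (M - i)) \<le> i * m + m * (M - i)"
      using degree_mult_le[of "c i" "f ^ (M - i)"] degree_c[of i] degree_power_le[of f "M - i"] by linarith
    also have "\<dots> = m * M" using that by (simp add: algebra_simps flip: distrib_left)
    finally show ?thesis .
  qed
  then show ?thesis by (auto simp: below_iff_degree coeff_H)
qed

text \<open>As polynomials in Y, H^2 and f^(2 M - 1) f(t + Y) agree up to Y^M; at Y = U the latter
  is (f^M G)^2. Only squares are compared here; the sign is settled at each prime separately in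
  \<open>stepanov_bound\<close>.\<close>

lemma H_square: "U ^ M dvd (poly H U)\<^sup>2 - (f ^ M * G)\<^sup>2"
proof -
  have "coeff (H\<^sup>2 - smult (f ^ (2 * M - 1)) (lift f)) l = 0" if l: "l < M" for l
  proof (cases "l = 0")
    case True
    have "coeff (H\<^sup>2) 0 = f ^ M * f ^ M" by (simp add: power2_eq_square coeff_mult coeff_H_0)
    also have "\<dots> = f ^ (2 * M - 1) * f"
      using M_pos by (simp flip: power_add power_Suc2 add: mult_2)
    finally show ?thesis using True by (simp add: coeff_lift_0)
  next
    case False
    have "coeff (H\<^sup>2) l = (\<Sum>a\<le>l. coeff H a * coeff H (l - a))"
      by (simp add: power2_eq_square coeff_mult)
    also have "\<dots> = (\<Sum>a\<le>l. f ^ (2 * M - l) * (c a * c (l - a)))"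
    proof (rule sum.cong[OF refl])
      fix a assume "a \<in> {..l}"
      then have a: "a \<le> l" by simp
      have "f ^ (M - a) * f ^ (M - (l - a)) = f ^ (2 * M - l)"
        unfolding power_add[symmetric] using a l by (intro arg_cong[of _ _ "\<lambda>k. f ^ k"]) linarith
      then show "coeff H a * coeff H (l - a) = f ^ (2 * M - l) * (c a * c (l - a))"
        using a l by (simp add: coeff_H)
    qed
    also have "\<dots> = f ^ (2 * M - l) * (coeff (lift f) l * f ^ (l - 1))"
      using False by (simp only: sum_distrib_left[symmetric] c_square)
    also have "\<dots> = (f ^ (2 * M - l) * f ^ (l - 1)) * coeff (lift f) l" by (simp only: ac_simps)
    also have "f ^ (2 * M - l) * f ^ (l - 1) = f ^ (2 * M - 1)"
      unfolding power_add[symmetric] using False l by (intro arg_cong[of _ _ "\<lambda>k. f ^ k"]) linarith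
    finally show ?thesis by simp
  qed
  then have "monom 1 M dvd H\<^sup>2 - smult (f ^ (2 * M - 1)) (lift f)" by (simp add: monom_1_dvd_iff')
  then have "poly (monom 1 M) U dvd poly (H\<^sup>2 - smult (f ^ (2 * M - 1)) (lift f)) U"
    by (rule poly_dvd_polyI)
  moreover have "f ^ (2 * M - 1) * (f * G\<^sup>2) = (f ^ M * G)\<^sup>2"
  proof -
    have "f ^ (2 * M - 1) * f = f ^ (2 * M)" using M_pos by (simp flip: power_Suc2)
    then show ?thesis by (simp add: power_mult_distrib mult.assoc[symmetric] power_mult[symmetric] mult.commute)
  qed
  ultimately show ?thesis by (simp add: poly_monom poly_lift_U)
qed

text \<open>At Y = U this is f^M (r(T) + G s(T)) with f^M G replaced by e H(U), a replacement valid
  modulo P^M when G = e modulo P. In this form the vanishing to order M at U is a linear condition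
  on coefficients of small degree.\<close>

definition Fb :: "'a poly poly \<Rightarrow> 'a poly poly \<Rightarrow> 'a poly poly" where
  "Fb r s = smult (f ^ M) (pcompose r [:poly_X, 1:]) + of_int e * H * pcompose s [:poly_X, 1:]"

lemma Fb_diff: "Fb (r - r') (s - s') = Fb r s - Fb r' s'"
  by (simp add: Fb_def pcompose_diff algebra_simps smult_diff_right)

lemma coeff_mult_below:
  fixes r s :: "'a poly poly"
  assumes "\<And>i. coeff r i \<in> below a" "\<And>i. coeff s i \<in> below b" "a + b \<le> k + 1"
  shows "coeff (r * s) l \<in> below k"
proof -
  have *: "coeff r i * coeff s (l - i) \<in> below k" for i
    by (rule below_multI[OF assms])
  have "(\<Sum>i\<in>X. coeff r i * coeff s (l - i)) \<in> below k" if "finite X" for X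
    using that by (induction X rule: finite_induct) (auto simp: *)
  then show ?thesis by (simp add: coeff_mult)
qed

lemma coeff_Fb_below:
  assumes "r \<in> bibelow J D" "s \<in> bibelow J D"
  shows "coeff (Fb r s) l \<in> below (D + J + m * M)"
proof -
  have "degree (f ^ M) \<le> m * M" by (rule degree_power_le)
  then have "f ^ M \<in> below (m * M + 1)" by (simp add: below_iff_degree)
  then have 1: "f ^ M * coeff (pcompose r [:poly_X, 1:]) l \<in> below (D + J + m * M)"
    using coeff_shift_below[OF D(3) assms(1)] by (rule below_multI) simp
  have 2: "coeff (H * pcompose s [:poly_X, 1:]) l \<in> below (D + J + m * M)"
    by (rule coeff_mult_below[OF coeff_H_below coeff_shift_below[OF D(3) assms(2)]]) simp
  from e show ?thesis using 1 2 by (auto simp: Fb_def)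
qed

text \<open>Pigeonhole instead of linear algebra: by \<open>counting\<close> there are more pairs
  than vectors of coefficients, and since \<open>Fb\<close> is additive the difference of two
  colliding pairs works.\<close>

lemma auxiliary_exists:
  "\<exists>r s. r \<in> bibelow J D \<and> s \<in> bibelow J D \<and> (r, s) \<noteq> (0, 0) \<and> (\<forall>l<M. coeff (Fb r s) l = 0)"
proof -
  let ?V = "bibelow J D \<times> bibelow J D :: ('a poly poly \<times> 'a poly poly) set"
  let ?W = "PiE {..<M} (\<lambda>_. below (D + J + m * M)) :: (nat \<Rightarrow> 'a poly) set"
  let ?\<theta> = "\<lambda>(r, s). restrict (coeff (Fb r s)) {..<M}"
  have "card ?W = CARD('a) ^ (M * (D + J + m * M))"
    by (simp add: card_PiE card_below power_mult[symmetric] mult.commute)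
  also have "\<dots> < CARD('a) ^ (2 * (J * D))"
    using counting card_field_ge_2[where 'a='a] by (intro power_strict_increasing) auto
  also have "\<dots> = card ?V" by (simp add: card_cartesian_product card_bibelow power_add[symmetric] mult_2)
  finally have "card ?V > card ?W" .
  moreover have "?\<theta> ` ?V \<subseteq> ?W"
  proof (rule image_subsetI)
    fix x assume "x \<in> ?V"
    then obtain r s where x: "x = (r, s)" "r \<in> bibelow J D" "s \<in> bibelow J D" by auto
    show "?\<theta> x \<in> ?W" unfolding x(1) prod.case
      by (subst restrict_PiE_iff) (use coeff_Fb_below[OF x(2,3)] in blast)
  qed
  moreover have "finite ?W" by (intro finite_PiE) auto
  ultimately have "\<not> inj_on ?\<theta> ?V" using card_inj_on_le[of ?\<theta> ?V ?W] by linarith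
  then obtain r s r' s' where rs: "r \<in> bibelow J D" "s \<in> bibelow J D" "r' \<in> bibelow J D" "s' \<in> bibelow J D"
    "(r, s) \<noteq> (r', s')" "restrict (coeff (Fb r s)) {..<M} = restrict (coeff (Fb r' s')) {..<M}"
    unfolding inj_on_def by auto
  have "coeff (Fb (r - r') (s - s')) l = 0" if "l < M" for l
    using fun_cong[OF rs(6), of l] that by (simp add: Fb_diff)
  moreover have "(r - r', s - s') \<noteq> (0, 0)" using rs(5) by auto
  moreover have "r - r' \<in> bibelow J D" "s - s' \<in> bibelow J D"
    using rs(1-4) by (auto intro: bibelow_diff)
  ultimately show ?thesis by (intro exI[of _ "r - r'"] exI[of _ "s - s'"]) simp
qed

theorem stepanov_bound:
  assumes S: "\<And>P. P \<in> S \<Longrightarrow> P \<in> monic_irreducibles (2 * g + 1) \<and> [f ^ h = of_int e] (mod P)"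
  shows "2 * ((2 * g + 1) * card S) \<le> Q + (3 * m + 2) * CARD('a) ^ (g + 1)"
proof -
  obtain r s where rs: "r \<in> bibelow J D" "s \<in> bibelow J D" "(r, s) \<noteq> (0, 0)"
    and van: "\<And>l. l < M \<Longrightarrow> coeff (Fb r s) l = 0"
    using auxiliary_exists by blast
  define R where "R = poly r T + G * poly s T"
  have R0: "R \<noteq> 0" using independence[OF rs(1,2)] rs(3) by (auto simp: R_def)
  have UF: "U ^ M dvd f ^ M * poly r T + of_int e * poly H U * poly s T"
  proof -
    have "monom 1 M dvd Fb r s" using van by (simp add: monom_1_dvd_iff')
    then have "poly (monom 1 M) U dvd poly (Fb r s) U" by (rule poly_dvd_polyI)
    then show ?thesis using e by (auto simp: poly_monom Fb_def poly_pcompose U_def)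
  qed
  have ee: "of_int e * of_int e = (1 :: 'a poly)" using e by auto
  have PR: "P ^ M dvd R" if "P \<in> S" for P
  proof -
    have P: "lead_coeff P = 1" "irreducible P" "degree P = 2 * g + 1" and fe: "[f ^ h = of_int e] (mod P)"
      using S[OF that] by (auto simp: monic_irreducibles_def)
    interpret pp: prime_poly P using odd_q P by unfold_locales auto
    \<comment> \<open>By Fermat every prime of degree 2 g + 1 divides U, so vanishing to order M
      along U is inherited by all of them at once.\<close>
    have "[poly_X ^ Q = poly_X] (mod P)" using pp.fermat'[of poly_X] P(3) by (simp add: Q_def)
    then have PU: "P dvd U" by (simp add: U_def T_def monom_altdef cong_iff_dvd_diff)
    have nf: "\<not> P dvd f"
    proof
      assume "P dvd f"
      then have "P dvd f ^ h" using h_pos by (meson dvd_power dvd_trans)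
      then have "P dvd of_int e" using fe cong_dvd_iff by blast
      then have "P dvd of_int e * of_int e" by (rule dvd_mult2)
      then show False by (simp add: ee)
    qed
    then have nfM: "\<not> P dvd f ^ M" using pp.prime_P prime_elem_dvd_power by blast
    have G: "P dvd G - of_int e" using fe by (simp add: G_def cong_iff_dvd_diff)
    have H0: "P dvd poly H U - f ^ M"
    proof -
      have "poly H U - poly H 0 = poly H U - f ^ M" by (simp add: poly_0_coeff_0 coeff_H_0)
      moreover have "U dvd poly H U - poly H 0"
        by (cases H) simp
      ultimately show ?thesis using PU dvd_trans by metis
    qed
    have "(poly H U)\<^sup>2 - (f ^ M * G)\<^sup>2 =
        (poly H U + of_int e * f ^ M * G) * (poly H U - of_int e * f ^ M * G)"
      using e by (auto simp: power2_eq_square algebra_simps)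
    then have "U ^ M dvd (poly H U + of_int e * f ^ M * G) * (poly H U - of_int e * f ^ M * G)"
      using H_square by simp
    moreover have "P ^ M dvd U ^ M" using PU by (rule dvd_power_same)
    ultimately have dv: "P ^ M dvd (poly H U + of_int e * f ^ M * G) * (poly H U - of_int e * f ^ M * G)"
      using dvd_trans by blast
    \<comment> \<open>Modulo P, H(U) is f^M and G is e, so this factor is 2 f^M, prime to P. The
      whole power P^M falls to the other factor, which fixes the sign of the square root.\<close>
    have "\<not> P dvd poly H U + of_int e * f ^ M * G"
    proof
      assume *: "P dvd poly H U + of_int e * f ^ M * G"
      have "P dvd of_int e * f ^ M * (G - of_int e)" using G by simp
      then have "P dvd (poly H U + of_int e * f ^ M * G) - (poly H U - f ^ M) - of_int e * f ^ M * (G - of_int e)"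
        by (rule dvd_diff[OF dvd_diff[OF * H0]])
      also have "(poly H U + of_int e * f ^ M * G) - (poly H U - f ^ M) - of_int e * f ^ M * (G - of_int e) = 2 * f ^ M"
        using e by (auto simp: algebra_simps)
      finally show False using nfM pp.not_dvd_2 by (simp add: pp.dvd_mult_iff)
    qed
    then have "P ^ M dvd poly H U - of_int e * f ^ M * G"
      using prime_power_dvd_mult[OF pp.prime_P] dv by blast
    then have dv1: "P ^ M dvd (poly H U - of_int e * f ^ M * G) * (of_int e * poly s T)" by (rule dvd_mult2)
    have dv2: "P ^ M dvd f ^ M * poly r T + of_int e * poly H U * poly s T"
      using UF \<open>P ^ M dvd U ^ M\<close> dvd_trans by blast
    \<comment> \<open>Exchanging e H(U) for f^M G turns the value of \<open>Fb\<close> at U into f^M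
      R, as e^2 = 1.\<close>
    have "P ^ M dvd (f ^ M * poly r T + of_int e * poly H U * poly s T) -
        (poly H U - of_int e * f ^ M * G) * (of_int e * poly s T)" by (rule dvd_diff[OF dv2 dv1])
    also have "\<dots> = f ^ M * R" using e by (auto simp: R_def algebra_simps)
    finally show ?thesis using prime_power_dvd_mult[OF pp.prime_P nfM] by blast
  qed
  have finS: "finite S"
    by (rule finite_subset[OF _ finite_monic_irreducibles[of "2 * g + 1"]]) (use S in auto)
  have SP: "irreducible P \<and> lead_coeff P = 1" "degree P = 2 * g + 1" if "P \<in> S" for P
    using S[OF that] unfolding monic_irreducibles_def by blast+
  have "(\<Prod>P\<in>S. P ^ M) dvd R"
    by (rule prod_prime_powers_dvd[OF finS SP(1) PR])
  then have "degree (\<Prod>P\<in>S. P ^ M) \<le> degree R" using R0 by (rule dvd_imp_degree_le)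
  moreover have "degree (\<Prod>P\<in>S. P ^ M) = (\<Sum>P\<in>S. degree (P ^ M))"
  proof (rule degree_prod_eq_sum_degree, rule ballI)
    fix P assume "P \<in> S"
    then have "lead_coeff P = 1" using SP(1) by blast
    then show "P ^ M \<noteq> 0" by auto
  qed
  moreover have "(\<Sum>P\<in>S. degree (P ^ M)) = (\<Sum>P\<in>S. M * (2 * g + 1))"
    using SP by (intro sum.cong refl) (metis degree_power_monic)
  ultimately have 1: "card S * (M * (2 * g + 1)) \<le> degree R" by simp
  have Jp: "J > 0" using J by linarith
  have "degree (poly r T) \<le> D + (J - 1) * Q" "degree (poly s T) \<le> D + (J - 1) * Q"
    using degree_poly_bibelow[OF rs(1) Jp, of T] degree_poly_bibelow[OF rs(2) Jp, of T] by (simp_all add: degree_T)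
  moreover have "degree G \<le> m * h" unfolding G_def by (rule degree_power_le)
  ultimately have 2: "degree R \<le> m * h + (D + (J - 1) * Q)"
    unfolding R_def using degree_mult_le[of G "poly s T"] by (intro degree_add_le) linarith+
  have "2 * (m * h) \<le> m * Q" using mult_le_mono2[of "2 * h" Q m] h by (simp add: mult.left_commute)
  moreover have "2 * D \<le> Q" using D by linarith
  moreover have "2 * ((J - 1) * Q) = (M + 2 * m + 1) * Q"
  proof -
    have "2 * (J - 1) = M + 2 * m + 1" using J by linarith
    then show ?thesis by (metis mult.assoc)
  qed
  ultimately have "2 * (card S * (M * (2 * g + 1))) \<le> m * Q + Q + (M + 2 * m + 1) * Q"
    using 1 2 by linarith
  \<comment> \<open>After division by M the first term gives Q, so half the expected total; as Q = q
    M^2, the second becomes a multiple of q M = q^(g+1), the square root error.\<close>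
  also have "\<dots> = M * Q + (3 * m + 2) * Q" by (simp add: algebra_simps)
  also have "\<dots> = M * Q + (3 * m + 2) * (CARD('a) * M * M)" by (simp only: Q_eq[symmetric])
  finally have "M * (2 * ((2 * g + 1) * card S)) \<le> M * (Q + (3 * m + 2) * (CARD('a) * M))"
    by (simp add: algebra_simps)
  then show ?thesis using M_pos by (simp add: M_def)
qed

end

subsection \<open>Character sums over primes\<close>

lemma monic_irreducibles_odd_degree_prime:
  assumes "odd CARD('a)" "P \<in> monic_irreducibles (2 * g + 1)"
  shows "odd_degree_prime (P :: 'a :: {finite, field} poly) g"
  using assms by unfold_locales (auto simp: monic_irreducibles_def)

text \<open>Stepanov bounds the primes with value 1 and those with value -1 from above only.
  Together they exhaust all primes but the few dividing f, and the prime count is known from below,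
  so each upper bound yields a lower bound for the other class.\<close>

lemma char_sum_bound_aux:
  fixes f :: "'a :: {finite, field} poly"
  assumes odd: "odd CARD('a)" and monic: "lead_coeff f = 1" and nonsquare: "\<And>B. f \<noteq> B\<^sup>2"
    and not_X2: "\<not> poly_X\<^sup>2 dvd f" and large: "CARD('a) ^ g \<ge> 2 * degree f + 3"
  shows "int (2 * g + 1) * \<bar>\<Sum>P\<in>monic_irreducibles (2 * g + 1). quad_char P f\<bar>
      \<le> int ((4 * degree f + 4) * CARD('a) ^ (g + 1))"
proof -
  let ?n = "2 * g + 1" and ?m = "degree f"
  let ?I = "monic_irreducibles ?n :: 'a poly set"
  define S where "S = (\<lambda>a. {P \<in> ?I. quad_char P f = a})"
  have finI: "finite ?I" by (rule finite_monic_irreducibles)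
  have fin: "finite (S a)" for a using finI by (simp add: S_def)
  have f0: "f \<noteq> 0" using monic by auto
  have bound: "2 * (?n * card (S a)) \<le> CARD('a) ^ ?n + (3 * ?m + 2) * CARD('a) ^ (g + 1)"
    if a: "a = 1 \<or> a = -1" for a
  proof -
    interpret st: stepanov f g a
      using assms a by unfold_locales auto
    have "P \<in> ?I \<and> [f ^ st.h = of_int a] (mod P)" if P: "P \<in> S a" for P
    proof -
      interpret pp: odd_degree_prime P g
        using P odd by (intro monic_irreducibles_odd_degree_prime) (auto simp: S_def)
      have "st.h = pp.h" by (simp add: st.h_def pp.h_def st.Q_def pp.degree_P)
      then show ?thesis using P pp.euler[of f] by (auto simp: S_def cong_sym)
    qed
    then show ?thesis using st.stepanov_bound[of "S a"] by (simp add: st.Q_def)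
  qed
  have "(\<Prod>P\<in>S 0. P ^ 1) dvd f"
    by (rule prod_prime_powers_dvd[OF fin])
      (auto simp: S_def monic_irreducibles_def quad_char_def split: if_splits)
  then have "degree (\<Prod>P\<in>S 0. P) \<le> ?m" using f0 by (intro dvd_imp_degree_le) auto
  also have "degree (\<Prod>P\<in>S 0. P) = (\<Sum>P\<in>S 0. degree P)"
    by (rule degree_prod_eq_sum_degree) (auto simp: S_def monic_irreducibles_def)
  also have "\<dots> = (\<Sum>P\<in>S 0. ?n)"
    by (intro sum.cong refl) (auto simp: S_def monic_irreducibles_def)
  finally have zero: "?n * card (S 0) \<le> ?m" by (simp add: mult.commute)
  have I: "?I = S 1 \<union> S (-1) \<union> S 0"
  proof -
    have "quad_char P f \<in> {-1, 0, 1}" for P by (simp add: quad_char_def)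
    then show ?thesis by (auto simp: S_def)
  qed
  have disj: "S 1 \<inter> S (-1) = {}" "(S 1 \<union> S (-1)) \<inter> S 0 = {}" by (auto simp: S_def)
  have card: "card ?I = card (S 1) + card (S (-1)) + card (S 0)"
    unfolding I using fin by (simp add: card_Un_disjoint disj)
  have "(\<Sum>P\<in>?I. quad_char P f) = (\<Sum>P\<in>S 1. quad_char P f) + (\<Sum>P\<in>S (-1). quad_char P f) + (\<Sum>P\<in>S 0. quad_char P f)"
    unfolding I using fin by (simp add: sum.union_disjoint disj)
  also have "\<dots> = int (card (S 1)) - int (card (S (-1)))" by (simp add: S_def)
  finally have sum: "(\<Sum>P\<in>?I. quad_char P f) = int (card (S 1)) - int (card (S (-1)))" .
  have lower: "CARD('a) ^ ?n \<le> ?n * card ?I + 2 * CARD('a) ^ g"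
    using prime_count_lower[of ?n, where 'a = 'a] by simp
  have "int ?n * \<bar>int (card (S 1)) - int (card (S (-1)))\<bar> = \<bar>int (?n * card (S 1)) - int (?n * card (S (-1)))\<bar>"
    by (simp only: right_diff_distrib[symmetric] of_nat_mult abs_mult abs_of_nat)
  also have "\<dots> \<le> int ((3 * ?m + 2) * CARD('a) ^ (g + 1)) + 2 * int (CARD('a) ^ g) + int ?m"
  proof -
    have "?n * card ?I = ?n * card (S 1) + ?n * card (S (-1)) + ?n * card (S 0)"
      unfolding card by (simp add: algebra_simps)
    then show ?thesis using bound[of 1] bound[of "-1"] zero lower by linarith
  qed
  also have "\<dots> \<le> int ((4 * ?m + 4) * CARD('a) ^ (g + 1))"
  proof -
    have "CARD('a) ^ g \<le> CARD('a) ^ (g + 1)" by (rule power_increasing) auto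
    moreover have "?m \<le> ?m * CARD('a) ^ (g + 1)" by simp
    moreover have "(4 * ?m + 4) * CARD('a) ^ (g + 1) =
        (3 * ?m + 2) * CARD('a) ^ (g + 1) + 2 * CARD('a) ^ (g + 1) + ?m * CARD('a) ^ (g + 1)"
      by (simp add: algebra_simps)
    ultimately show ?thesis by linarith
  qed
  finally show ?thesis using sum by simp
qed

text \<open>Stepanov's independence needs f free of t^2. Dividing t^2 out changes neither the values
  of the character nor the property of being a non-square.\<close>

theorem char_sum_bound:
  fixes A :: "'a :: {finite, field} poly"
  assumes odd: "odd CARD('a)" and monic: "lead_coeff A = 1" and nonsquare: "\<And>B. A \<noteq> B\<^sup>2"
    and large: "CARD('a) ^ g \<ge> 2 * degree A + 3"
  shows "int (2 * g + 1) * \<bar>\<Sum>P\<in>monic_irreducibles (2 * g + 1). quad_char P A\<bar>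
      \<le> int ((4 * degree A + 4) * CARD('a) ^ (g + 1))"
  using assms(2-4)
proof (induction "degree A" arbitrary: A rule: less_induct)
  case less
  show ?case
  proof (cases "poly_X\<^sup>2 dvd A")
    case False
    then show ?thesis using char_sum_bound_aux[OF odd less.prems(1,2)] less.prems(3) by blast
  next
    case True
    then obtain B where B: "A = poly_X\<^sup>2 * B" by auto
    have A0: "A \<noteq> 0" using less.prems(1) by auto
    then have B0: "B \<noteq> 0" using B by auto
    have "degree (poly_X\<^sup>2 :: 'a poly) = 2" by (simp add: degree_power_eq)
    then have dA: "degree A = degree B + 2" using B B0 by (simp add: degree_mult_eq)
    have "lead_coeff A = lead_coeff (poly_X :: 'a poly)^2 * lead_coeff B"
      by (simp only: B lead_coeff_mult lead_coeff_power)
    then have monB: "lead_coeff B = 1" using less.prems(1) by simp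
    have nsB: "B \<noteq> C\<^sup>2" for C
    proof
      assume "B = C\<^sup>2"
      then have "A = (poly_X * C)\<^sup>2" by (simp only: B power_mult_distrib)
      then show False using less.prems(2) by blast
    qed
    have g: "g > 0" using less.prems(3) by (cases g) auto
    have eq: "quad_char P A = quad_char P B" if P: "P \<in> monic_irreducibles (2 * g + 1)" for P
    proof -
      interpret pp: odd_degree_prime P g
        by (rule monic_irreducibles_odd_degree_prime[OF odd P])
      have "\<not> P dvd poly_X" using dvd_imp_degree_le[of P poly_X] pp.degree_P g by auto
      then show ?thesis unfolding B power2_eq_square pp.chi_mult by (simp add: pp.chi_square)
    qed
    have "int (2 * g + 1) * \<bar>\<Sum>P\<in>monic_irreducibles (2 * g + 1). quad_char P B\<bar>
      \<le> int ((4 * degree B + 4) * CARD('a) ^ (g + 1))"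
      by (rule less.hyps) (use dA monB nsB less.prems(3) in auto)
    also have "\<dots> \<le> int ((4 * degree A + 4) * CARD('a) ^ (g + 1))"
      unfolding of_nat_le_iff by (intro mult_le_mono1) (use dA in simp)
    finally show ?thesis using eq by simp
  qed
qed

subsection \<open>The $L$-function as a short sum\<close>

lemma L_function_eq_sum:
  fixes P :: "'a :: {finite, field} poly"
  assumes odd: "odd CARD('a)" and P: "P \<in> monic_irreducibles n"
  shows "L_function (quad_char P) s =
    (\<Sum>k<n. of_int (\<Sum>A\<in>monic_of_degree k. quad_char P A) * complex_of_real (real CARD('a) ^ k) powr (-s))"
proof -
  let ?F = "\<lambda>s. \<Sum>k<n. of_int (\<Sum>A\<in>monic_of_degree k. quad_char P A) *
              complex_of_real (real CARD('a) ^ k) powr (-s)"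
  have irr: "irreducible P" and monic: "lead_coeff P = 1" and deg: "degree P = n"
    using P by (auto simp: monic_irreducibles_def)
  have "L_series (quad_char P) s = ?F s" if "Re s > 1" for s
    unfolding L_series_def
    by (rule infsumI, rule L_series_eq_sum)
       (simp_all add: that abs_quad_char_le sum_quad_char_monic[OF odd irr monic] deg)
  moreover have "?F holomorphic_on UNIV" by (intro holomorphic_intros)
  ultimately have "L_function (quad_char P) = ?F"
    unfolding L_function_def by (intro the1_equality[OF L_function_well_defined[OF odd P]]) auto
  then show ?thesis by simp
qed

text \<open>The functional equation folds the term 2 g - j onto the term j, and the middle term g is
  counted once. The folding is exact. All weights are nonnegative, which the resonance inequality
  needs.\<close>

definition afe_weight :: "nat \<Rightarrow> nat \<Rightarrow> real \<Rightarrow> nat \<Rightarrow> real" where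
  "afe_weight q g \<sigma> j = real q powr (- (real j * \<sigma>)) *
     (if j < g then 1 + real q powr (- ((real g - real j) * (2 * \<sigma> - 1))) else 1)"

theorem approximate_functional_equation:
  fixes P :: "'a :: {finite, field} poly"
  assumes odd: "odd CARD('a)" and P: "P \<in> monic_irreducibles (2 * g + 1)"
  shows "L_function (quad_char P) (complex_of_real \<sigma>) =
    of_real (\<Sum>j\<le>g. afe_weight CARD('a) g \<sigma> j * of_int (\<Sum>A\<in>monic_of_degree j. quad_char P A))"
proof -
  interpret pp: odd_degree_prime P g
    by (rule monic_irreducibles_odd_degree_prime[OF odd P])
  let ?q = "real CARD('a)"
  have q1: "?q > 1" using card_field_ge_2[where 'a = 'a] by linarith
  define b where "b = (\<lambda>j. real_of_int (pp.acoef j) * ?q powr (- (real j * \<sigma>)))"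
  have "L_function (quad_char P) (complex_of_real \<sigma>) = (\<Sum>j<2 * g + 1. of_real (b j))"
    unfolding L_function_eq_sum[OF odd P]
  proof (intro sum.cong refl)
    fix j
    have "complex_of_real (?q ^ j) powr (- complex_of_real \<sigma>) = of_real ((?q ^ j) powr (- \<sigma>))"
      using q1 by (simp add: powr_of_real[symmetric] del: of_real_power)
    also have "(?q ^ j) powr (- \<sigma>) = ?q powr (- (real j * \<sigma>))"
      using q1 by (simp add: powr_realpow[symmetric] powr_powr)
    finally show "complex_of_int (\<Sum>A\<in>monic_of_degree j. quad_char P A) *
        complex_of_real (?q ^ j) powr (- complex_of_real \<sigma>) = of_real (b j)"
      by (simp add: b_def pp.acoef_def)
  qed
  also have "\<dots> = of_real (\<Sum>j<2 * g + 1. b j)" by simp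
  also have "(\<Sum>j<2 * g + 1. b j) = (\<Sum>j\<le>g. b j) + (\<Sum>j\<in>{g<..2 * g}. b j)"
  proof -
    have eq: "{..<2 * g + 1} = {..g} \<union> {g<..2 * g}" by auto
    show ?thesis unfolding eq by (rule sum.union_disjoint) auto
  qed
  also have "(\<Sum>j\<in>{g<..2 * g}. b j) = (\<Sum>j<g. b (2 * g - j))"
    by (rule sum.reindex_bij_witness[of _ "\<lambda>j. 2 * g - j" "\<lambda>j. 2 * g - j"]) auto
  also have "\<dots> = (\<Sum>j<g. b j * ?q powr (- ((real g - real j) * (2 * \<sigma> - 1))))"
  proof (intro sum.cong refl)
    fix j assume "j \<in> {..<g}"
    then have j: "j < g" by simp
    have "int CARD('a) ^ g * pp.acoef j = int CARD('a) ^ j * pp.acoef (2 * g - j)"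
      using j by (intro pp.functional_equation) simp
    then have "real_of_int (int CARD('a) ^ g * pp.acoef j) = real_of_int (int CARD('a) ^ j * pp.acoef (2 * g - j))"
      by simp
    then have "?q ^ g * real_of_int (pp.acoef j) = ?q ^ j * real_of_int (pp.acoef (2 * g - j))" by simp
    then have "real_of_int (pp.acoef (2 * g - j)) = ?q powr (real g - real j) * real_of_int (pp.acoef j)"
      using q1 by (simp add: powr_diff powr_realpow field_simps)
    then have "b (2 * g - j) = (?q powr (real g - real j) * ?q powr (- (real (2 * g - j) * \<sigma>))) * real_of_int (pp.acoef j)"
      by (simp add: b_def)
    also have "?q powr (real g - real j) * ?q powr (- (real (2 * g - j) * \<sigma>)) =
        ?q powr (- (real j * \<sigma>)) * ?q powr (- ((real g - real j) * (2 * \<sigma> - 1)))"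
      using j by (simp add: powr_add[symmetric] of_nat_diff algebra_simps)
    finally show "b (2 * g - j) = b j * ?q powr (- ((real g - real j) * (2 * \<sigma> - 1)))"
      by (simp add: b_def)
  qed
  also have "(\<Sum>j\<le>g. b j) + \<dots> = (\<Sum>j\<le>g. afe_weight CARD('a) g \<sigma> j * of_int (pp.acoef j))"
  proof -
    have "{..g} = insert g {..<g}" by auto
    then show ?thesis
      by (simp add: sum.distrib[symmetric] b_def afe_weight_def algebra_simps)
  qed
  finally show ?thesis by (simp add: pp.acoef_def)
qed

lemma afe_weight_bounds:
  assumes "q \<ge> 2" "\<sigma> \<ge> 1 / 2"
  shows "real q powr (- (real j * \<sigma>)) \<le> afe_weight q g \<sigma> j"
    and "0 \<le> afe_weight q g \<sigma> j"
    and "afe_weight q g \<sigma> j \<le> 2 * real q powr (- (real j / 2))"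
proof -
  have q: "real q > 1" using assms by simp
  show 1: "real q powr (- (real j * \<sigma>)) \<le> afe_weight q g \<sigma> j"
    unfolding afe_weight_def by (intro mult_le_cancel_left1[THEN iffD2]) auto
  show "0 \<le> afe_weight q g \<sigma> j" by (rule order_trans[OF powr_ge_zero 1])
  have "(if j < g then 1 + real q powr (- ((real g - real j) * (2 * \<sigma> - 1))) else 1) \<le> 2"
  proof (cases "j < g")
    case True
    then have "real q powr (- ((real g - real j) * (2 * \<sigma> - 1))) \<le> real q powr 0"
      using q assms by (intro powr_mono) auto
    then show ?thesis using q by simp
  qed simp
  moreover have "real q powr (- (real j * \<sigma>)) \<le> real q powr (- (real j / 2))"
    using q assms mult_left_mono[of "1/2" \<sigma> "real j"] by (intro powr_mono) auto
  ultimately have "afe_weight q g \<sigma> j \<le> real q powr (- (real j / 2)) * 2"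
    unfolding afe_weight_def by (intro mult_mono) auto
  then show "afe_weight q g \<sigma> j \<le> 2 * real q powr (- (real j / 2))" by simp
qed

subsection \<open>The resonance inequality\<close>

text \<open>Compare the sum of L times Res^2 over P with X times the sum of Res^2. Above,
  \<open>distinct\<close> leaves only diagonal squares, so each other pair costs at most E. Below,
  each pair in \<P> finds its completing factor \<open>kk x y\<close> in the sum of degree K and
  gains \<pi>, while every other triple loses at most E.\<close>

lemma resonance:
  fixes mm :: "'i \<Rightarrow> 'a :: {finite, field} poly" and kk :: "'i \<Rightarrow> 'i \<Rightarrow> 'a poly"
  assumes odd: "odd CARD('a)" and fin: "finite \<M>"
    and monic: "\<And>x. x \<in> \<M> \<Longrightarrow> lead_coeff (mm x) = 1"
    and deg: "\<And>x. x \<in> \<M> \<Longrightarrow> degree (mm x) \<le> Y"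
    and distinct: "\<And>x y C. x \<in> \<M> \<Longrightarrow> y \<in> \<M> \<Longrightarrow> x \<noteq> y \<Longrightarrow> mm x * mm y \<noteq> C\<^sup>2"
    and pairs: "\<P> \<subseteq> \<M> \<times> \<M>"
    and kk: "\<And>x y. (x, y) \<in> \<P> \<Longrightarrow> kk x y \<in> monic_of_degree K" and K: "K \<le> g"
    and square: "\<And>x y. (x, y) \<in> \<P> \<Longrightarrow> \<exists>C. kk x y * mm x * mm y = C\<^sup>2"
    and coprime: "\<And>x y P. (x, y) \<in> \<P> \<Longrightarrow> P \<in> monic_irreducibles (2 * g + 1) \<Longrightarrow> \<not> P dvd kk x y * mm x * mm y"
    and large: "CARD('a) ^ g \<ge> 2 * (g + 2 * Y) + 3"
    and \<sigma>: "\<sigma> \<ge> 1 / 2"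
    and X: "\<And>P :: 'a poly. P \<in> monic_irreducibles (2 * g + 1) \<Longrightarrow> cmod (L_function (quad_char P) (complex_of_real \<sigma>)) \<le> X"
      "X \<ge> 0"
  defines "\<pi> \<equiv> real (card (monic_irreducibles (2 * g + 1) :: 'a poly set))"
    and "E \<equiv> (4 * real (g + 2 * Y) + 4) * real CARD('a) ^ (g + 1)"
    and "W \<equiv> \<Sum>j\<le>g. real CARD('a) ^ j * afe_weight CARD('a) g \<sigma> j"
  shows "\<pi> * real (card \<P>) * real CARD('a) powr (- (real K * \<sigma>)) - E * W * (real (card \<M>))\<^sup>2
    \<le> X * (\<pi> * real (card \<M>) + E * (real (card \<M>))\<^sup>2)"
proof -
  let ?I = "monic_irreducibles (2 * g + 1) :: 'a poly set"
  let ?N = "real (card \<M>)"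
  define \<omega> where "\<omega> = afe_weight CARD('a) g \<sigma>"
  define S where "S = (\<lambda>A. \<Sum>P\<in>?I. real_of_int (quad_char P A))"
  define Res where "Res = (\<lambda>P. \<Sum>x\<in>\<M>. real_of_int (quad_char P (mm x)))"
  have \<omega>: "\<omega> j \<ge> 0" "\<omega> j \<ge> real CARD('a) powr (- (real j * \<sigma>))" for j
    using afe_weight_bounds[OF card_field_ge_2[where 'a = 'a] \<sigma>] by (auto simp: \<omega>_def)
  have E0: "E \<ge> 0" by (simp add: E_def)
  have finI: "finite ?I" by (rule finite_monic_irreducibles)
  have S_ns: "\<bar>S A\<bar> \<le> E" if A: "lead_coeff A = 1" "degree A \<le> g + 2 * Y" and ns: "\<And>C. A \<noteq> C\<^sup>2" for A
  proof -
    have "int (2 * g + 1) * \<bar>\<Sum>P\<in>?I. quad_char P A\<bar> \<le> int ((4 * degree A + 4) * CARD('a) ^ (g + 1))"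
      using A large by (intro char_sum_bound[OF odd A(1) ns]) auto
    also have "\<dots> \<le> int ((4 * (g + 2 * Y) + 4) * CARD('a) ^ (g + 1))"
      unfolding of_nat_le_iff by (intro mult_le_mono1) (use A in simp)
    finally have le: "int (2 * g + 1) * \<bar>\<Sum>P\<in>?I. quad_char P A\<bar> \<le> int ((4 * (g + 2 * Y) + 4) * CARD('a) ^ (g + 1))" .
    have "1 * \<bar>\<Sum>P\<in>?I. quad_char P A\<bar> \<le> int (2 * g + 1) * \<bar>\<Sum>P\<in>?I. quad_char P A\<bar>"
      by (intro mult_right_mono) auto
    then have "\<bar>\<Sum>P\<in>?I. quad_char P A\<bar> \<le> int ((4 * (g + 2 * Y) + 4) * CARD('a) ^ (g + 1))"
      using le by linarith
    then have "real_of_int \<bar>\<Sum>P\<in>?I. quad_char P A\<bar> \<le> real_of_int (int ((4 * (g + 2 * Y) + 4) * CARD('a) ^ (g + 1)))"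
      by (simp only: of_int_le_iff)
    then show ?thesis by (simp add: S_def E_def)
  qed
  have chi_sq: "quad_char P (C\<^sup>2) \<ge> 0" if P: "P \<in> ?I" for P C
  proof -
    interpret pp: odd_degree_prime P g by (rule monic_irreducibles_odd_degree_prime[OF odd P])
    show ?thesis by (simp add: power2_eq_square pp.chi_mult)
  qed
  \<comment> \<open>Squares outside the listed pairs can be discarded at no cost: the character is
    nonnegative on squares.\<close>
  have S_lower: "S A \<ge> - E" if A: "lead_coeff A = 1" "degree A \<le> g + 2 * Y" for A
  proof (cases "\<exists>C. A = C\<^sup>2")
    case True
    then have "S A \<ge> 0" unfolding S_def using chi_sq by (auto intro!: sum_nonneg)
    then show ?thesis using E0 by linarith
  next
    case False
    then show ?thesis using S_ns[OF A] by force
  qed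
  have S_square: "S A = \<pi>" if A: "A = C\<^sup>2" "\<And>P. P \<in> ?I \<Longrightarrow> \<not> P dvd A" for A C
  proof -
    have "quad_char P A = 1" if P: "P \<in> ?I" for P
    proof -
      interpret pp: odd_degree_prime P g by (rule monic_irreducibles_odd_degree_prime[OF odd P])
      have "P dvd A" if "P dvd C" using that by (simp add: A(1) power2_eq_square)
      then have "\<not> P dvd C" using A(2)[OF P] by blast
      then show ?thesis by (simp add: A(1) power2_eq_square pp.chi_mult pp.chi_square)
    qed
    then show ?thesis by (simp add: S_def \<pi>_def)
  qed
  have S_upper: "S A \<le> \<pi>" for A
  proof -
    have "S A \<le> (\<Sum>P\<in>?I. 1)" unfolding S_def
    proof (rule sum_mono)
      fix P show "real_of_int (quad_char P A) \<le> 1" by (simp add: quad_char_def)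
    qed
    then show ?thesis by (simp add: \<pi>_def)
  qed
  have chi3: "quad_char P (A * B) = quad_char P A * quad_char P B" if P: "P \<in> ?I" for P A B
  proof -
    interpret pp: odd_degree_prime P g by (rule monic_irreducibles_odd_degree_prime[OF odd P])
    show ?thesis by (rule pp.chi_mult)
  qed
  have "(\<Sum>P\<in>?I. (Res P)\<^sup>2) = (\<Sum>x\<in>\<M>. \<Sum>y\<in>\<M>. S (mm x * mm y))"
  proof -
    have "(\<Sum>P\<in>?I. (Res P)\<^sup>2) = (\<Sum>P\<in>?I. \<Sum>x\<in>\<M>. \<Sum>y\<in>\<M>. real_of_int (quad_char P (mm x * mm y)))"
      by (intro sum.cong refl) (simp add: Res_def power2_eq_square sum_product chi3)
    also have "\<dots> = (\<Sum>x\<in>\<M>. \<Sum>P\<in>?I. \<Sum>y\<in>\<M>. real_of_int (quad_char P (mm x * mm y)))" by (rule sum.swap)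
    also have "\<dots> = (\<Sum>x\<in>\<M>. \<Sum>y\<in>\<M>. S (mm x * mm y))"
      unfolding S_def by (intro sum.cong refl sum.swap)
    finally show ?thesis .
  qed
  also have "\<dots> \<le> (\<Sum>x\<in>\<M>. \<Sum>y\<in>\<M>. (if x = y then \<pi> else 0) + E)"
  proof (intro sum_mono)
    fix x y assume xy: "x \<in> \<M>" "y \<in> \<M>"
    show "S (mm x * mm y) \<le> (if x = y then \<pi> else 0) + E"
    proof (cases "x = y")
      case True
      then show ?thesis using S_upper[of "mm x * mm y"] E0 by simp
    next
      case False
      have "lead_coeff (mm x * mm y) = 1" using monic[OF xy(1)] monic[OF xy(2)] by (simp only: lead_coeff_mult mult_1)
      moreover have "degree (mm x * mm y) \<le> g + 2 * Y"
        using degree_mult_le[of "mm x" "mm y"] deg[OF xy(1)] deg[OF xy(2)] by linarith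
      ultimately show ?thesis using S_ns[of "mm x * mm y"] distinct[OF xy False] False by force
    qed
  qed
  also have "\<dots> = \<pi> * ?N + E * ?N\<^sup>2"
    using fin by (simp add: sum.distrib power2_eq_square algebra_simps)
  finally have upper: "(\<Sum>P\<in>?I. (Res P)\<^sup>2) \<le> \<pi> * ?N + E * ?N\<^sup>2" .
  define L where "L = (\<lambda>P :: 'a poly. \<Sum>j\<le>g. \<omega> j * (\<Sum>A\<in>monic_of_degree j. real_of_int (quad_char P A)))"
  have LX: "L P \<le> X" if P: "P \<in> ?I" for P
  proof -
    have "L_function (quad_char P) (complex_of_real \<sigma>) = of_real (L P)"
      using approximate_functional_equation[OF odd P, of \<sigma>] by (simp add: L_def \<omega>_def)
    then show ?thesis using X(1)[OF P] by simp
  qed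
  have "(\<Sum>P\<in>?I. L P * (Res P)\<^sup>2) =
      (\<Sum>j\<le>g. \<omega> j * (\<Sum>A\<in>monic_of_degree j. \<Sum>x\<in>\<M>. \<Sum>y\<in>\<M>. S (A * mm x * mm y)))"
  proof -
    have "(\<Sum>P\<in>?I. L P * (Res P)\<^sup>2) =
      (\<Sum>P\<in>?I. \<Sum>j\<le>g. \<omega> j * (\<Sum>A\<in>monic_of_degree j. \<Sum>x\<in>\<M>. \<Sum>y\<in>\<M>. real_of_int (quad_char P (A * mm x * mm y))))"
    proof (intro sum.cong refl)
      fix P assume P: "P \<in> ?I"
      have "L P * (Res P)\<^sup>2 = (\<Sum>j\<le>g. \<omega> j * (\<Sum>A\<in>monic_of_degree j. real_of_int (quad_char P A) * (Res P * Res P)))"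
        by (simp add: L_def sum_distrib_right power2_eq_square mult.assoc)
      also have "\<dots> = (\<Sum>j\<le>g. \<omega> j * (\<Sum>A\<in>monic_of_degree j. \<Sum>x\<in>\<M>. \<Sum>y\<in>\<M>. real_of_int (quad_char P (A * mm x * mm y))))"
        unfolding Res_def sum_product by (simp add: sum_distrib_left chi3[OF P] mult.assoc)
      finally show "L P * (Res P)\<^sup>2 = \<dots>" .
    qed
    also have "\<dots> = (\<Sum>j\<le>g. \<Sum>P\<in>?I. \<omega> j * (\<Sum>A\<in>monic_of_degree j. \<Sum>x\<in>\<M>. \<Sum>y\<in>\<M>. real_of_int (quad_char P (A * mm x * mm y))))"
      by (rule sum.swap)
    also have "\<dots> = (\<Sum>j\<le>g. \<omega> j * (\<Sum>A\<in>monic_of_degree j. \<Sum>x\<in>\<M>. \<Sum>y\<in>\<M>. S (A * mm x * mm y)))"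
    proof (intro sum.cong refl)
      fix j
      have "(\<Sum>P\<in>?I. \<Sum>A\<in>monic_of_degree j. \<Sum>x\<in>\<M>. \<Sum>y\<in>\<M>. real_of_int (quad_char P (A * mm x * mm y)))
        = (\<Sum>A\<in>monic_of_degree j. \<Sum>x\<in>\<M>. \<Sum>y\<in>\<M>. \<Sum>P\<in>?I. real_of_int (quad_char P (A * mm x * mm y)))"
        by (subst sum.swap, intro sum.cong refl, subst sum.swap, intro sum.cong refl, rule sum.swap)
      then show "(\<Sum>P\<in>?I. \<omega> j * (\<Sum>A\<in>monic_of_degree j. \<Sum>x\<in>\<M>. \<Sum>y\<in>\<M>. real_of_int (quad_char P (A * mm x * mm y))))
        = \<omega> j * (\<Sum>A\<in>monic_of_degree j. \<Sum>x\<in>\<M>. \<Sum>y\<in>\<M>. S (A * mm x * mm y))"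
        by (simp only: sum_distrib_left[symmetric] S_def)
    qed
    finally show ?thesis .
  qed
  also have "\<dots> \<ge> (\<Sum>j\<le>g. \<omega> j * (\<Sum>A\<in>monic_of_degree j. \<Sum>x\<in>\<M>. \<Sum>y\<in>\<M>.
      (if (x, y) \<in> \<P> \<and> A = kk x y then \<pi> else 0) - E))" (is "_ \<ge> ?Z")
  proof (intro sum_mono mult_left_mono \<omega>)
    fix j and A :: "'a poly" and x y assume j: "j \<in> {..g}" and A: "A \<in> monic_of_degree j" and xy: "x \<in> \<M>" "y \<in> \<M>"
    show "(if (x, y) \<in> \<P> \<and> A = kk x y then \<pi> else 0) - E \<le> S (A * mm x * mm y)"
    proof (cases "(x, y) \<in> \<P> \<and> A = kk x y")
      case True
      then obtain C where C: "A * mm x * mm y = C\<^sup>2" using square by blast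
      have nd: "\<not> P dvd A * mm x * mm y" if "P \<in> ?I" for P
        using coprime[OF _ that] True by blast
      have "S (A * mm x * mm y) = \<pi>" by (rule S_square[OF C nd])
      then show ?thesis using True E0 by simp
    next
      case False
      have "lead_coeff A = 1" "degree A \<le> g" using A j by (auto simp: monic_of_degree_def)
      then have "lead_coeff (A * mm x * mm y) = 1"
        using monic[OF xy(1)] monic[OF xy(2)] by (simp only: lead_coeff_mult mult_1)
      moreover have "degree (A * mm x * mm y) \<le> g + 2 * Y"
        using degree_mult_le[of "A * mm x" "mm y"] degree_mult_le[of A "mm x"] deg[OF xy(1)] deg[OF xy(2)] \<open>degree A \<le> g\<close>
        by linarith
      ultimately have "S (A * mm x * mm y) \<ge> - E" by (rule S_lower)
      then show ?thesis unfolding if_not_P[OF False] by simp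
    qed
  qed
  finally have lower1: "?Z \<le> (\<Sum>P\<in>?I. L P * (Res P)\<^sup>2)" .
  have finP: "finite \<P>" using pairs fin finite_subset by blast
  have "?Z = (\<Sum>j\<le>g. \<omega> j * (\<Sum>A\<in>monic_of_degree j. (\<Sum>x\<in>\<M>. \<Sum>y\<in>\<M>. if (x, y) \<in> \<P> \<and> A = kk x y then \<pi> else 0) - E * ?N\<^sup>2))"
    by (simp add: sum_subtractf power2_eq_square mult_ac)
  also have "\<dots> = (\<Sum>j\<le>g. \<omega> j * (\<Sum>A\<in>monic_of_degree j. \<Sum>x\<in>\<M>. \<Sum>y\<in>\<M>. if (x, y) \<in> \<P> \<and> A = kk x y then \<pi> else 0)) - E * W * ?N\<^sup>2"
    by (simp add: sum_subtractf card_monic_of_degree right_diff_distrib W_def \<omega>_def sum_distrib_left sum_distrib_right mult_ac)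
  finally have Z: "?Z = \<dots>" .
  have V: "(\<Sum>j\<le>g. \<omega> j * (\<Sum>A\<in>monic_of_degree j. \<Sum>x\<in>\<M>. \<Sum>y\<in>\<M>. if (x, y) \<in> \<P> \<and> A = kk x y then \<pi> else 0))
      \<ge> \<omega> K * (\<Sum>A\<in>monic_of_degree K. \<Sum>x\<in>\<M>. \<Sum>y\<in>\<M>. if (x, y) \<in> \<P> \<and> A = kk x y then \<pi> else 0)"
    using K by (intro member_le_sum) (auto intro!: mult_nonneg_nonneg \<omega> sum_nonneg simp: \<pi>_def)
  have VK: "(\<Sum>A\<in>monic_of_degree K. \<Sum>x\<in>\<M>. \<Sum>y\<in>\<M>. if (x, y) \<in> \<P> \<and> A = kk x y then \<pi> else 0) = \<pi> * real (card \<P>)"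
  proof -
    have "(\<Sum>A\<in>monic_of_degree K. \<Sum>x\<in>\<M>. \<Sum>y\<in>\<M>. if (x, y) \<in> \<P> \<and> A = kk x y then \<pi> else 0) =
        (\<Sum>A\<in>monic_of_degree K. \<Sum>z\<in>\<M> \<times> \<M>. if z \<in> \<P> then (if A = kk (fst z) (snd z) then \<pi> else 0) else 0)"
      unfolding sum.cartesian_product by (intro sum.cong refl) auto
    also have "\<dots> = (\<Sum>z\<in>\<M> \<times> \<M>. \<Sum>A\<in>monic_of_degree K. if z \<in> \<P> then (if A = kk (fst z) (snd z) then \<pi> else 0) else 0)"
      by (rule sum.swap)
    also have "\<dots> = (\<Sum>z\<in>\<M> \<times> \<M>. if z \<in> \<P> then \<pi> else 0)"
    proof (intro sum.cong refl)
      fix z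
      show "(\<Sum>A\<in>monic_of_degree K. if z \<in> \<P> then (if A = kk (fst z) (snd z) then \<pi> else 0) else 0) = (if z \<in> \<P> then \<pi> else 0)"
        using kk[of "fst z" "snd z"] by (auto simp: sum.delta)
    qed
    also have "\<dots> = (\<Sum>z\<in>\<P>. \<pi>)"
      using pairs fin by (subst sum.inter_filter[symmetric]) (auto intro!: arg_cong[of _ _ card] simp: subset_eq)
    finally show ?thesis by simp
  qed
  have "\<omega> K * (\<pi> * real (card \<P>)) - E * W * ?N\<^sup>2 \<le> ?Z"
    using Z V unfolding VK by linarith
  moreover have "real CARD('a) powr (- (real K * \<sigma>)) * (\<pi> * real (card \<P>)) \<le> \<omega> K * (\<pi> * real (card \<P>))"
    by (intro mult_right_mono \<omega>) (simp add: \<pi>_def)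
  ultimately have "\<pi> * real (card \<P>) * real CARD('a) powr (- (real K * \<sigma>)) - E * W * ?N\<^sup>2 \<le> ?Z"
    by (simp add: mult_ac)
  also note lower1
  also have "(\<Sum>P\<in>?I. L P * (Res P)\<^sup>2) \<le> (\<Sum>P\<in>?I. X * (Res P)\<^sup>2)"
    by (intro sum_mono mult_right_mono LX) auto
  also have "\<dots> \<le> X * (\<pi> * ?N + E * ?N\<^sup>2)"
    unfolding sum_distrib_left[symmetric] using upper X(2) by (rule mult_left_mono)
  finally show ?thesis .
qed

subsection \<open>Resonators built from blocks of primes\<close>

text \<open>Remove i elements of S and add i elements from outside S; the resulting set determines
  both choices.\<close>

lemma card_near_subsets:
  assumes "finite I" "S \<subseteq> I" "card S = J"
  shows "(J choose i) * ((card I - J) choose i) \<le> card {T. T \<subseteq> I \<and> card T = J \<and> card (S - T) = i}"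
proof -
  let ?XY = "{X. X \<subseteq> S \<and> card X = i} \<times> {Y. Y \<subseteq> I - S \<and> card Y = i}"
  let ?f = "\<lambda>(X, Y). (S - X) \<union> Y"
  have finS: "finite S" using assms finite_subset by blast
  have "card ?XY = (J choose i) * ((card I - J) choose i)"
    using assms finS by (simp add: card_cartesian_product n_subsets card_Diff_subset)
  moreover have "card ?XY \<le> card {T. T \<subseteq> I \<and> card T = J \<and> card (S - T) = i}"
  proof (rule card_inj_on_le[of ?f])
    show "inj_on ?f ?XY"
    proof (rule inj_onI, clarify)
      fix X Y X' Y'
      assume "X \<subseteq> S" "Y \<subseteq> I - S" "X' \<subseteq> S" "Y' \<subseteq> I - S" "S - X \<union> Y = S - X' \<union> Y'"
      then show "X = X' \<and> Y = Y'" by blast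
    qed
    show "?f ` ?XY \<subseteq> {T. T \<subseteq> I \<and> card T = J \<and> card (S - T) = i}"
    proof (rule image_subsetI)
      fix z assume "z \<in> ?XY"
      then obtain X Y where z: "z = (X, Y)" and X: "X \<subseteq> S" "card X = i" and Y: "Y \<subseteq> I - S" "card Y = card X"
        by auto
      have finX: "finite X" and finY: "finite Y" using X Y finS assms(1) finite_subset by blast+
      have "card (S - X \<union> Y) = card (S - X) + card Y"
        using finS finY Y by (intro card_Un_disjoint) auto
      also have "\<dots> = J"
        using card_Diff_subset[OF finX X(1)] card_mono[OF finS X(1)] Y assms by simp
      finally have "card (S - X \<union> Y) = J" .
      moreover have "S - (S - X \<union> Y) = X" using X Y by blast
      moreover have "S - X \<union> Y \<subseteq> I" using Y assms by blast
      ultimately show "?f z \<in> {T. T \<subseteq> I \<and> card T = J \<and> card (S - T) = i}"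
        using X by (simp add: z)
    qed
    show "finite {T. T \<subseteq> I \<and> card T = J \<and> card (S - T) = i}"
      by (rule finite_subset[of _ "Pow I"]) (use assms in auto)
  qed
  ultimately show ?thesis by simp
qed

text \<open>A prime in S but not in S' would divide the product exactly once.\<close>

lemma prod_square_imp_eq:
  fixes S S' :: "'a :: field poly set"
  assumes fin: "finite S" "finite S'"
    and irr: "\<And>p. p \<in> S \<union> S' \<Longrightarrow> irreducible p \<and> lead_coeff p = 1"
    and sq: "\<Prod>S * \<Prod>S' = C\<^sup>2"
  shows "S \<subseteq> S'"
proof
  fix p assume p: "p \<in> S"
  show "p \<in> S'"
  proof (rule ccontr)
    assume np: "p \<notin> S'"
    have ip: "irreducible p" "lead_coeff p = 1" using irr p by auto
    then have prime: "prime_elem p" and p0: "p \<noteq> 0"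
      using field_poly_irreducible_imp_prime by (blast, auto)
    have nd: "\<not> p dvd \<Prod>F" if "F \<subseteq> S \<union> S'" "p \<notin> F" for F
    proof -
      have "finite F" using that fin finite_subset finite_Un by metis
      then show ?thesis using that
      proof (induction F rule: finite_induct)
        case (insert x F)
        have "\<not> p dvd x"
          using monic_irreducible_dvd_eq[OF ip, of x] irr[of x] insert.prems by auto
        then show ?case using insert by (auto simp: prime_elem_dvd_mult_iff[OF prime])
      qed (use prime_elem_not_unit[OF prime] in simp)
    qed
    have S: "\<Prod>S = p * \<Prod>(S - {p})" using prod.remove[OF fin(1) p, of "\<lambda>x. x"] by simp
    then have "p dvd C\<^sup>2" unfolding sq[symmetric] by simp
    then have "p dvd C" using prime prime_elem_dvd_power by blast
    then obtain C' where C': "C = p * C'" by auto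
    have "p * (\<Prod>(S - {p}) * \<Prod>S') = p * (p * C'\<^sup>2)"
      using sq S C' by (simp add: power2_eq_square algebra_simps)
    then have "\<Prod>(S - {p}) * \<Prod>S' = p * C'\<^sup>2" using p0 by simp
    then have "p dvd \<Prod>(S - {p}) * \<Prod>S'" by simp
    then show False using nd[of "S - {p}"] nd[of S'] np
      by (auto simp: prime_elem_dvd_mult_iff[OF prime])
  qed
qed

lemma lead_coeff_prod_1:
  "(\<And>x. x \<in> X \<Longrightarrow> lead_coeff (f x) = 1) \<Longrightarrow> lead_coeff (\<Prod>x\<in>X. f x) = (1 :: 'a :: field)"
  unfolding lead_coeff_prod by (rule prod.neutral) blast

lemma prod_symdiff_square:
  fixes A B :: "'a :: comm_semiring_1 set"
  assumes "finite A" "finite B"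
  shows "\<Prod>((A - B) \<union> (B - A)) * \<Prod>A * \<Prod>B = (\<Prod>(A \<union> B))\<^sup>2"
proof -
  have d: "\<Prod>((A - B) \<union> (B - A)) = \<Prod>(A - B) * \<Prod>(B - A)"
    using assms by (intro prod.union_disjoint) auto
  have "(A - B) \<union> (A \<inter> B) = A" "(B - A) \<union> (A \<inter> B) = B" by blast+
  moreover have "\<Prod>((A - B) \<union> (A \<inter> B)) = \<Prod>(A - B) * \<Prod>(A \<inter> B)"
    "\<Prod>((B - A) \<union> (A \<inter> B)) = \<Prod>(B - A) * \<Prod>(A \<inter> B)"
    using assms by (intro prod.union_disjoint; auto)+
  ultimately have a: "\<Prod>A = \<Prod>(A - B) * \<Prod>(A \<inter> B)"
    and b: "\<Prod>B = \<Prod>(B - A) * \<Prod>(A \<inter> B)" by simp_all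
  have "\<Prod>(A \<union> B) = \<Prod>A * \<Prod>(B - A)"
    using assms prod.union_disjoint[of A "B - A" "\<lambda>x. x"] by auto
  then show ?thesis unfolding a b d power2_eq_square by (simp add: mult_ac)
qed

text \<open>Resonator terms are choices F of J d primes in each degree d. For a pair,
  \<open>kk\<close> is the product of the symmetric differences: it completes the product to the
  square over the unions, and exchanging i d primes per degree gives it the same degree K for all
  pairs. Each F has at least B partners, so N B \<le> card \<P>, and one factor N cancels. Degrees
  up to 2 g keep all factors prime to P.\<close>

theorem block_resonance:
  fixes Ds :: "nat set" and J i :: "nat \<Rightarrow> nat"
  assumes odd: "odd CARD('a :: {finite, field})" and fin: "finite Ds"
    and Ds: "\<And>d. d \<in> Ds \<Longrightarrow> d \<le> 2 * g"
    and J: "\<And>d. d \<in> Ds \<Longrightarrow> J d \<le> prime_count TYPE('a) d"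
    and K: "K = (\<Sum>d\<in>Ds. 2 * d * i d)" "K \<le> g"
    and Y: "(\<Sum>d\<in>Ds. d * J d) \<le> Y"
    and large: "CARD('a) ^ g \<ge> 2 * (g + 2 * Y) + 3"
    and \<sigma>: "\<sigma> \<ge> 1 / 2"
    and X: "\<And>P :: 'a poly. P \<in> monic_irreducibles (2 * g + 1) \<Longrightarrow> cmod (L_function (quad_char P) (complex_of_real \<sigma>)) \<le> X"
      "X \<ge> 0"
  defines "\<pi> \<equiv> real (prime_count TYPE('a) (2 * g + 1))"
    and "E \<equiv> (4 * real (g + 2 * Y) + 4) * real CARD('a) ^ (g + 1)"
    and "W \<equiv> \<Sum>j\<le>g. real CARD('a) ^ j * afe_weight CARD('a) g \<sigma> j"
    and "N \<equiv> \<Prod>d\<in>Ds. real (prime_count TYPE('a) d choose J d)"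
    and "B \<equiv> \<Prod>d\<in>Ds. real (J d choose i d) * real ((prime_count TYPE('a) d - J d) choose i d)"
  shows "\<pi> * B * real CARD('a) powr (- (real K * \<sigma>)) - E * W * N \<le> X * (\<pi> + E * N)"
proof -
  let ?I = "\<lambda>d. monic_irreducibles d :: 'a poly set"
  define sub where "sub = (\<lambda>d. {T. T \<subseteq> ?I d \<and> card T = J d})"
  define near where "near = (\<lambda>d F. {T. T \<subseteq> ?I d \<and> card T = J d \<and> card (F - T) = i d})"
  define \<M> where "\<M> = PiE Ds sub"
  define \<P> where "\<P> = (SIGMA F:\<M>. PiE Ds (\<lambda>d. near d (F d)))"
  define bp where "bp = (\<lambda>F :: nat \<Rightarrow> 'a poly set. \<Prod>d\<in>Ds. \<Prod>(F d))"
  define kk where "kk = (\<lambda>F F' :: nat \<Rightarrow> 'a poly set. bp (\<lambda>d. (F d - F' d) \<union> (F' d - F d)))"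
  have finI: "finite (?I d)" for d by (rule finite_monic_irreducibles)
  have finsub: "finite (sub d)" for d
    unfolding sub_def by (rule finite_subset[of _ "Pow (?I d)"]) (use finI in auto)
  have finM: "finite \<M>" unfolding \<M>_def using fin finsub by (intro finite_PiE) auto
  have cardM: "real (card \<M>) = N"
    unfolding \<M>_def N_def using fin finI by (simp add: card_PiE sub_def n_subsets)
  have N0: "N > 0" unfolding N_def using J by (intro prod_pos) auto
  have M: "F d \<subseteq> ?I d" "card (F d) = J d" if "F \<in> \<M>" "d \<in> Ds" for F d
    using PiE_mem[of F Ds sub d] that by (auto simp: \<M>_def sub_def)
  have finF: "finite X" if "X \<subseteq> ?I d" for X d using that finI finite_subset by blast
  have mono_bp: "lead_coeff (bp F) = 1" if "\<And>d. d \<in> Ds \<Longrightarrow> F d \<subseteq> ?I d" for F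
    unfolding bp_def by (intro lead_coeff_prod_1) (use that in \<open>auto simp: monic_irreducibles_def\<close>)
  have deg_bp: "degree (bp F) = (\<Sum>d\<in>Ds. d * card (F d))" if F: "\<And>d. d \<in> Ds \<Longrightarrow> F d \<subseteq> ?I d" for F
  proof -
    have nz: "p \<noteq> 0" if "p \<in> F d" "d \<in> Ds" for p d
    proof -
      have "p \<in> ?I d" using F[OF that(2)] that(1) by blast
      then show ?thesis by (auto simp: monic_irreducibles_def)
    qed
    have "degree (bp F) = (\<Sum>d\<in>Ds. degree (\<Prod>(F d)))"
      unfolding bp_def
    proof (rule degree_prod_eq_sum_degree, rule ballI)
      fix d assume d: "d \<in> Ds"
      show "\<Prod>(F d) \<noteq> 0" using nz[OF _ d] finF[OF F[OF d]] by auto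
    qed
    also have "\<dots> = (\<Sum>d\<in>Ds. d * card (F d))"
    proof (rule sum.cong[OF refl])
      fix d assume d: "d \<in> Ds"
      have "degree (\<Prod>(F d)) = (\<Sum>p\<in>F d. degree p)"
        using nz[OF _ d] by (intro degree_prod_eq_sum_degree) auto
      also have "\<dots> = (\<Sum>p\<in>F d. d)"
        by (intro sum.cong refl) (use F d in \<open>auto simp: monic_irreducibles_def\<close>)
      finally show "degree (\<Prod>(F d)) = d * card (F d)" by simp
    qed
    finally show ?thesis .
  qed
  have near_sub: "near d F \<subseteq> sub d" for d F by (auto simp: near_def sub_def)
  have PM: "\<P> \<subseteq> \<M> \<times> \<M>"
  proof
    fix z assume "z \<in> \<P>"
    then obtain F F' where z: "z = (F, F')" "F \<in> \<M>" "F' \<in> PiE Ds (\<lambda>d. near d (F d))"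
      unfolding \<P>_def by (rule SigmaE)
    moreover have "PiE Ds (\<lambda>d. near d (F d)) \<subseteq> PiE Ds sub"
      by (rule PiE_mono) (rule near_sub)
    ultimately show "z \<in> \<M> \<times> \<M>" unfolding \<M>_def by blast
  qed
  have symsub: "(F d - F' d) \<union> (F' d - F d) \<subseteq> ?I d" if "F \<in> \<M>" "F' \<in> \<M>" "d \<in> Ds" for F F' d
    using M(1)[of F d] M(1)[of F' d] that by blast
  have "\<pi> * real (card \<P>) * real CARD('a) powr (- (real K * \<sigma>)) - E * W * (real (card \<M>))\<^sup>2
    \<le> X * (\<pi> * real (card \<M>) + E * (real (card \<M>))\<^sup>2)"
    unfolding \<pi>_def E_def W_def
  proof (rule resonance[where mm = bp and kk = kk])
    show "lead_coeff (bp F) = 1" if "F \<in> \<M>" for F using M(1)[OF that] by (rule mono_bp)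
    show "degree (bp F) \<le> Y" if "F \<in> \<M>" for F
      using deg_bp[of F] M[OF that] Y by simp
    show "bp F * bp F' \<noteq> C\<^sup>2" if FF: "F \<in> \<M>" "F' \<in> \<M>" "F \<noteq> F'" for F F' C
    proof
      assume sq: "bp F * bp F' = C\<^sup>2"
      have U: "bp G = \<Prod>(\<Union>d\<in>Ds. G d)" "finite (\<Union>d\<in>Ds. G d)" if "G \<in> \<M>" for G
      proof -
        have disj: "G d \<inter> G d' = {}" if "d \<in> Ds" "d' \<in> Ds" "d \<noteq> d'" for d d'
          using M(1)[OF \<open>G \<in> \<M>\<close>, of d] M(1)[OF \<open>G \<in> \<M>\<close>, of d'] that by (force simp: monic_irreducibles_def)
        show "bp G = \<Prod>(\<Union>d\<in>Ds. G d)"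
          unfolding bp_def using fin finF M(1)[OF that] disj by (intro prod.UNION_disjoint[symmetric]) auto
        show "finite (\<Union>d\<in>Ds. G d)" using fin finF M(1)[OF that] by blast
      qed
      have irr: "irreducible p \<and> lead_coeff p = 1" if "p \<in> (\<Union>d\<in>Ds. F d) \<union> (\<Union>d\<in>Ds. F' d)" for p
        using that M(1)[OF FF(1)] M(1)[OF FF(2)] by (auto simp: monic_irreducibles_def)
      have "(\<Union>d\<in>Ds. F d) \<subseteq> (\<Union>d\<in>Ds. F' d)"
        using sq U[OF FF(1)] U[OF FF(2)] irr by (intro prod_square_imp_eq[of _ _ C]) auto
      moreover have "(\<Union>d\<in>Ds. F' d) \<subseteq> (\<Union>d\<in>Ds. F d)"
        using sq U[OF FF(1)] U[OF FF(2)] irr by (intro prod_square_imp_eq[of _ _ C]) (auto simp: mult.commute)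
      ultimately have eq: "(\<Union>d\<in>Ds. F d) = (\<Union>d\<in>Ds. F' d)" by blast
      have slice: "G d = (\<Union>d\<in>Ds. G d) \<inter> ?I d" if "G \<in> \<M>" "d \<in> Ds" for G d
      proof
        show "G d \<subseteq> (\<Union>d\<in>Ds. G d) \<inter> ?I d" using M(1)[OF that] that by blast
        show "(\<Union>d\<in>Ds. G d) \<inter> ?I d \<subseteq> G d"
        proof
          fix p assume p: "p \<in> (\<Union>d\<in>Ds. G d) \<inter> ?I d"
          then obtain d' where d': "d' \<in> Ds" "p \<in> G d'" by blast
          then have "p \<in> ?I d'" using M(1)[OF that(1)] by blast
          then have "d' = d" using p by (auto simp: monic_irreducibles_def)
          then show "p \<in> G d" using d' by simp
        qed
      qed
      have "F d = F' d" if "d \<in> Ds" for d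
        using slice[OF FF(1) that] slice[OF FF(2) that] eq by simp
      then have "F = F'" using FF unfolding \<M>_def by (intro PiE_ext)
      then show False using FF by simp
    qed
    fix F F' assume FP: "(F, F') \<in> \<P>"
    then have FM: "F \<in> \<M>" "F' \<in> \<M>" using PM by auto
    have FF': "card (F d - F' d) = i d" if "d \<in> Ds" for d
      using FP that PiE_mem[of F' Ds "\<lambda>d. near d (F d)" d] by (auto simp: \<P>_def near_def)
    have ck: "card ((F d - F' d) \<union> (F' d - F d)) = 2 * i d" if d: "d \<in> Ds" for d
    proof -
      have f: "finite (F d)" "finite (F' d)" using finF M(1)[OF FM(1) d] M(1)[OF FM(2) d] by auto
      have "card (F d - F' d) = card (F' d - F d)"
        using f M(2)[OF FM(1) d] M(2)[OF FM(2) d] card_Diff_subset_Int[of "F d" "F' d"]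
          card_Diff_subset_Int[of "F' d" "F d"] by (simp add: Int_commute)
      moreover have "card ((F d - F' d) \<union> (F' d - F d)) = card (F d - F' d) + card (F' d - F d)"
        using f by (intro card_Un_disjoint) auto
      ultimately show ?thesis using FF'[OF d] by simp
    qed
    have "degree (kk F F') = K"
      unfolding kk_def K(1) using symsub[OF FM] by (subst deg_bp) (auto simp: ck intro!: sum.cong)
    moreover have "lead_coeff (kk F F') = 1"
      unfolding kk_def using symsub[OF FM] by (intro mono_bp) auto
    ultimately show "kk F F' \<in> monic_of_degree K" by (simp add: monic_of_degree_def)
    have sq: "kk F F' * bp F * bp F' = (\<Prod>d\<in>Ds. \<Prod>(F d \<union> F' d))\<^sup>2"
    proof -
      have "kk F F' * bp F * bp F' = (\<Prod>d\<in>Ds. \<Prod>((F d - F' d) \<union> (F' d - F d)) * \<Prod>(F d) * \<Prod>(F' d))"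
        by (simp add: kk_def bp_def prod.distrib)
      also have "\<dots> = (\<Prod>d\<in>Ds. (\<Prod>(F d \<union> F' d))\<^sup>2)"
        by (intro prod.cong refl prod_symdiff_square finF[OF M(1)[OF FM(1)]] finF[OF M(1)[OF FM(2)]])
      finally show ?thesis by (simp add: prod_power_distrib)
    qed
    then show "\<exists>C. kk F F' * bp F * bp F' = C\<^sup>2" by blast
    fix P assume P: "P \<in> ?I (2 * g + 1)"
    interpret pp: odd_degree_prime P g by (rule monic_irreducibles_odd_degree_prime[OF odd P])
    have "\<not> P dvd p" if "p \<in> F d \<union> F' d" "d \<in> Ds" for p d
    proof
      assume "P dvd p"
      moreover have p: "p \<in> ?I d" using M(1)[OF FM(1) that(2)] M(1)[OF FM(2) that(2)] that(1) by blast
      ultimately have "P = p"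
        using P by (intro monic_irreducible_dvd_eq) (auto simp: monic_irreducibles_def)
      then show False using P p Ds[OF that(2)] by (auto simp: monic_irreducibles_def)
    qed
    moreover have "finite (F d \<union> F' d)" if "d \<in> Ds" for d
      using finF M(1)[OF FM(1) that] M(1)[OF FM(2) that] by blast
    ultimately have "\<not> P dvd (\<Prod>d\<in>Ds. \<Prod>(F d \<union> F' d))"
      by (simp add: pp.dvd_prod_iff[OF fin] pp.dvd_prod_iff)
    then show "\<not> P dvd kk F F' * bp F * bp F'"
      unfolding sq by (simp add: power2_eq_square pp.dvd_mult_iff)
  qed (use assms finM PM in auto)
  moreover have "N * B \<le> real (card \<P>)"
  proof -
    have fnear: "finite (near d F)" for d F using near_sub finsub finite_subset by blast
    have "card \<P> = (\<Sum>F\<in>\<M>. card (PiE Ds (\<lambda>d. near d (F d))))"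
      unfolding \<P>_def using finM fin fnear by (intro card_SigmaI ballI finite_PiE) auto
    also have "\<dots> = (\<Sum>F\<in>\<M>. \<Prod>d\<in>Ds. card (near d (F d)))"
      using fin by (simp add: card_PiE)
    finally have "real (card \<P>) = (\<Sum>F\<in>\<M>. \<Prod>d\<in>Ds. real (card (near d (F d))))" by simp
    also have "\<dots> \<ge> (\<Sum>F\<in>\<M>. B)"
    proof (rule sum_mono)
      fix F assume F: "F \<in> \<M>"
      show "B \<le> (\<Prod>d\<in>Ds. real (card (near d (F d))))"
        unfolding B_def
      proof (rule prod_mono, intro conjI)
        fix d assume d: "d \<in> Ds"
        have "(J d choose i d) * ((prime_count TYPE('a) d - J d) choose i d) \<le> card (near d (F d))"
          unfolding near_def using M[OF F d] by (intro card_near_subsets finI)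
        then show "real (J d choose i d) * real ((prime_count TYPE('a) d - J d) choose i d) \<le> real (card (near d (F d)))"
          by (metis of_nat_le_iff of_nat_mult)
      qed simp
    qed
    also have "(\<Sum>F\<in>\<M>. B) = N * B" by (simp add: cardM)
    finally show ?thesis .
  qed
  then have "\<pi> * (N * B) * real CARD('a) powr (- (real K * \<sigma>)) \<le> \<pi> * real (card \<P>) * real CARD('a) powr (- (real K * \<sigma>))"
    by (intro mult_right_mono mult_left_mono) (auto simp: \<pi>_def)
  ultimately have "\<pi> * (N * B) * real CARD('a) powr (- (real K * \<sigma>)) - E * W * N\<^sup>2 \<le> X * (\<pi> * N + E * N\<^sup>2)"
    unfolding cardM by linarith
  then have "N * (\<pi> * B * real CARD('a) powr (- (real K * \<sigma>)) - E * W * N) \<le> N * (X * (\<pi> + E * N))"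
    by (simp add: power2_eq_square algebra_simps)
  then show ?thesis using N0 by simp
qed

subsection \<open>Elementary estimates\<close>

lemma power_le_binomial_fact:
  assumes "i \<le> n"
  shows "(real n - real i) ^ i \<le> real (n choose i) * fact i"
proof -
  have "(real n - real i) ^ j \<le> real (n choose j) * fact j" if "j \<le> i" for j
    using that
  proof (induction j)
    case (Suc j)
    have "Suc j * (n choose Suc j) = (n - j) * (n choose j)"
      using binomial_absorption[of j n] binomial_absorb_comp[of n j] by simp
    then have "real (Suc j) * real (n choose Suc j) = real (n - j) * real (n choose j)"
      by (metis of_nat_mult)
    then have eq: "real (n choose Suc j) * fact (Suc j) = real (n - j) * (real (n choose j) * fact j)"
      by (simp add: mult_ac del: of_nat_Suc)
    have "(real n - real i) * (real n - real i) ^ j \<le> real (n - j) * (real (n choose j) * fact j)"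
      using Suc assms by (intro mult_mono) (auto simp: of_nat_diff)
    then show ?case unfolding eq by simp
  qed simp
  then show ?thesis by blast
qed

lemma fact_le_stirling:
  assumes "i > 0"
  shows "fact i \<le> real i * exp 1 * (real i / exp 1) ^ i"
  using assms
proof (induction i rule: nat_induct_non_zero)
  case (Suc i)
  have "exp 1 \<le> ((real i + 1) / real i) ^ (i + 1)"
  proof -
    have "- ln (real i / (real i + 1)) \<ge> 1 - real i / (real i + 1)"
      using ln_le_minus_one[of "real i / (real i + 1)"] Suc.hyps by simp
    then have "1 / (real i + 1) \<le> ln ((real i + 1) / real i)"
      using Suc.hyps by (simp add: ln_div field_simps)
    then have "1 \<le> (real i + 1) * ln ((real i + 1) / real i)"
      using Suc.hyps by (simp add: field_simps)
    then have "exp 1 \<le> exp (real (i + 1) * ln ((real i + 1) / real i))" by (simp add: add.commute)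
    also have "\<dots> = ((real i + 1) / real i) ^ (i + 1)"
      using Suc.hyps by (subst exp_of_nat_mult) simp
    finally show ?thesis .
  qed
  then have "real i ^ (i + 1) * exp 1 \<le> (real i + 1) ^ (i + 1)"
    using Suc.hyps by (simp add: power_divide field_simps)
  then have key: "real i ^ (i + 1) * exp 1 / exp 1 ^ i \<le> (real i + 1) ^ (i + 1) / exp 1 ^ i"
    by (intro divide_right_mono) auto
  have "fact (Suc i) \<le> (real i + 1) * (real i * exp 1 * (real i / exp 1) ^ i)"
    using Suc.IH by (simp add: add.commute mult_left_mono)
  also have "\<dots> = (real i + 1) * (real i ^ (i + 1) * exp 1 / exp 1 ^ i)"
    by (simp add: power_divide)
  also have "\<dots> \<le> (real i + 1) * ((real i + 1) ^ (i + 1) / exp 1 ^ i)"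
    using key by (intro mult_left_mono) auto
  also have "\<dots> = real (Suc i) * exp 1 * (real (Suc i) / exp 1) ^ (Suc i)"
    by (simp add: power_divide field_simps)
  finally show ?case .
qed simp

text \<open>Bound each binomial below by a power over i!. The hypothesis \<open>le\<close> reduces
  the product to (i^i / i!)^2, which Stirling bounds below by e^(2 i - 2) / i^2. The gain is
  exponential in 2 i, so i should be nearly as large as \<open>le\<close> permits.\<close>

lemma block_lower_bound:
  fixes i J n :: nat and r :: real
  assumes i: "i > 0" "i \<le> J" "i \<le> n" and r: "r \<ge> 0"
    and le: "real i ^ 2 \<le> (real J - real i) * (real n - real i) * r"
  shows "exp (2 * real i - 2 - 2 * ln (real i)) \<le> real (J choose i) * real (n choose i) * r ^ i"
proof -
  have "(real i ^ 2) ^ i \<le> ((real J - real i) * (real n - real i) * r) ^ i"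
    using le by (intro power_mono) auto
  also have "\<dots> = (real J - real i) ^ i * (real n - real i) ^ i * r ^ i"
    by (simp add: power_mult_distrib)
  also have "\<dots> \<le> (real (J choose i) * fact i) * (real (n choose i) * fact i) * r ^ i"
    using power_le_binomial_fact[OF i(2)] power_le_binomial_fact[OF i(3)] i r
    by (intro mult_right_mono mult_mono) auto
  also have "\<dots> = (real (J choose i) * real (n choose i) * r ^ i) * (fact i)\<^sup>2"
    by (simp add: power2_eq_square mult_ac)
  finally have 1: "(real i ^ i)\<^sup>2 \<le> (real (J choose i) * real (n choose i) * r ^ i) * (fact i)\<^sup>2"
    by (simp add: power_mult[symmetric] mult.commute)
  have "(fact i :: real)\<^sup>2 \<le> (real i * exp 1 * (real i / exp 1) ^ i)\<^sup>2"
    using fact_le_stirling[OF i(1)] by (intro power_mono) auto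
  then have "(real i ^ i)\<^sup>2 \<le> (real (J choose i) * real (n choose i) * r ^ i) * (real i * exp 1 * (real i / exp 1) ^ i)\<^sup>2"
    using 1 r by (meson mult_left_mono order_trans mult_nonneg_nonneg of_nat_0_le_iff zero_le_power)
  also have "\<dots> = (real (J choose i) * real (n choose i) * r ^ i) * (real i * exp 1 / exp 1 ^ i)\<^sup>2 * (real i ^ i)\<^sup>2"
    by (simp add: power_divide power_mult_distrib field_simps)
  finally have "1 \<le> (real (J choose i) * real (n choose i) * r ^ i) * (real i * exp 1 / exp 1 ^ i)\<^sup>2"
    using i by simp
  moreover have "exp (2 * real i - 2 - 2 * ln (real i)) * (real i * exp 1 / exp 1 ^ i)\<^sup>2 = 1"
  proof -
    have "real i * exp 1 / exp 1 ^ i = exp (ln (real i) + 1 - real i)"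
      using i by (simp add: exp_add exp_diff exp_of_nat_mult[of i 1, simplified, symmetric])
    then show ?thesis by (simp add: exp_of_nat_mult[of 2, simplified, symmetric] flip: exp_add)
  qed
  ultimately have "exp (2 * real i - 2 - 2 * ln (real i)) * (real i * exp 1 / exp 1 ^ i)\<^sup>2 \<le>
      (real (J choose i) * real (n choose i) * r ^ i) * (real i * exp 1 / exp 1 ^ i)\<^sup>2" by simp
  moreover have "(real i * exp 1 / exp 1 ^ i)\<^sup>2 > 0" using i by simp
  ultimately show ?thesis by (simp only: mult_le_cancel_right_pos)
qed

lemma binomial_upper_bound:
  assumes "J > 0"
  shows "real (n choose J) \<le> (exp 1 * real n / real J) ^ J"
proof -
  have "real J ^ J / fact J \<le> exp (real J)"
  proof -
    have "(\<Sum>k\<in>{J}. real J ^ k /\<^sub>R fact k) \<le> (\<Sum>k. real J ^ k /\<^sub>R fact k)"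
      by (intro sum_le_suminf summable_exp_generic) auto
    then show ?thesis by (simp add: exp_def divide_inverse mult.commute)
  qed
  then have f: "real J ^ J \<le> exp 1 ^ J * fact J"
    by (simp add: field_simps exp_of_nat_mult[of J 1, simplified])
  have "(n choose J) * fact J \<le> n ^ J"
    using binomial_fact_pow[of n J] by simp
  then have "real (n choose J) * fact J \<le> real n ^ J"
    by (metis of_nat_fact of_nat_le_iff of_nat_mult of_nat_power)
  then have "real (n choose J) * fact J * real J ^ J \<le> real n ^ J * (exp 1 ^ J * fact J)"
    using f by (intro mult_mono) auto
  then have "real (n choose J) * real J ^ J \<le> real n ^ J * exp 1 ^ J" by simp
  then show ?thesis using assms by (simp add: power_divide power_mult_distrib field_simps)
qed

lemma sum_inverse_lower:
  assumes "0 < a" "a \<le> b"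
  shows "ln ((real b + 1) / real a) \<le> (\<Sum>k=a..b. 1 / real k)"
  using assms(2)
proof (induction b rule: dec_induct)
  case base
  have "ln (1 + 1 / real a) \<le> 1 / real a" by (intro ln_add_one_self_le_self) auto
  then show ?case using assms(1) by (simp add: add_divide_distrib)
next
  case (step b)
  have b: "b > 0" using step assms by linarith
  have "ln (1 + 1 / (real b + 1)) \<le> 1 / (real b + 1)" by (intro ln_add_one_self_le_self) auto
  moreover have "1 + 1 / (real b + 1) = (real b + 2) / (real b + 1)" by (simp add: field_simps)
  ultimately have "ln ((real b + 2) / real a) - ln ((real b + 1) / real a) \<le> 1 / (real b + 1)"
    using assms(1) by (simp add: ln_div)
  then show ?case using step by (simp add: add.commute)
qed

lemma sum_inverse_upper:
  assumes "0 < a" "a \<le> b"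
  shows "(\<Sum>k=a..b. 1 / real k) \<le> 1 + ln (real b / real a)"
  using assms(2)
proof (induction b rule: dec_induct)
  case base
  then show ?case using assms(1) by simp
next
  case (step b)
  have b: "b > 0" using step assms by linarith
  have "ln (real b / (real b + 1)) \<le> real b / (real b + 1) - 1"
    using b by (intro ln_le_minus_one) auto
  also have "\<dots> = - 1 / (real b + 1)" using b by (simp add: field_simps)
  finally have "1 / (real b + 1) \<le> ln (real b + 1) - ln (real b)"
    using b by (simp add: ln_div)
  then show ?case using step assms(1) b by (simp add: ln_div add.commute)
qed

subsection \<open>Choice of parameters\<close>

lemma prime_count_odd_lower:
  "real CARD('a :: {finite, field}) ^ (2 * g) \<le> (2 * real g + 1) * real (prime_count TYPE('a) (2 * g + 1))"
  if "odd CARD('a)"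
proof -
  have q: "CARD('a) \<ge> 3"
    using card_field_ge_2[where 'a='a] that by (cases "CARD('a) = 2") auto
  have "CARD('a) ^ (2 * g + 1) \<le> (2 * g + 1) * prime_count TYPE('a) (2 * g + 1) + 2 * CARD('a) ^ g"
    using prime_count_lower[of "2 * g + 1", where 'a = 'a] by simp
  moreover have "CARD('a) ^ g \<le> CARD('a) ^ (2 * g)" using q by (intro power_increasing) auto
  moreover have "3 * CARD('a) ^ (2 * g) \<le> CARD('a) ^ (2 * g + 1)" using q by simp
  ultimately have "CARD('a) ^ (2 * g) \<le> (2 * g + 1) * prime_count TYPE('a) (2 * g + 1)" by linarith
  then have "real (CARD('a) ^ (2 * g)) \<le> real ((2 * g + 1) * prime_count TYPE('a) (2 * g + 1))"
    by (simp only: of_nat_le_iff)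
  then show ?thesis by (simp add: algebra_simps)
qed

text \<open>\<open>A0\<close> to \<open>A12\<close> collect inequalities that hold for all large g,
  so that no limit enters this proof. The block at k gains e^(2 B / k), and summing 1/k gives the
  logarithm in the conclusion; b (4 + 2 ln B) collects the rounding and Stirling losses of at most b
  blocks.\<close>

lemma large_value_explicit:
  fixes g :: nat and \<kappa> \<beta> X :: real
  defines "x \<equiv> real g" and "l \<equiv> ln (real g)" and "L \<equiv> ln (ln (real g))"
    and "c \<equiv> ln (real CARD('a :: {finite, field}))"
    and "a \<equiv> ln (real g) powr (1/8)" and "b \<equiv> ln (real g) powr (7/8)"
    and "B \<equiv> \<beta> * sqrt (real g / (ln (ln (real g)) * ln (real g)))"
  assumes odd: "odd CARD('a)" and \<kappa>: "\<kappa> > 0" and \<beta>: "\<beta> > 0" "\<beta>\<^sup>2 \<le> 2 / 9 * exp (- 6 * \<kappa>) * c"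
    and A0: "x \<ge> 1" "l \<ge> 1" "L \<ge> 15" "a + 2 \<le> b"
    and A1: "l / c + 1 + b \<le> 11/10 * l / c"
    and A2: "x / (2 * b\<^sup>2 * L) \<ge> 40"
    and A3: "B / b \<ge> 2"
    and A4: "B * b * 2 * L / x \<le> 1 / 40"
    and A5: "exp a \<ge> 22 * l"
    and A6: "l \<ge> 8 * c"
    and A7: "a * c / 10 \<ge> ln 4 + 1 + c + 2 * ln b + L"
    and A9: "22/10 * l * B * (1 + L) \<le> x"
    and A10: "11/10 * b * l \<le> x"
    and A11: "(4 * (x + 2 * x\<^sup>2) + 4) * real CARD('a) * (2 * (x + 1)) * (2 * x + 1) \<le> exp (c * x / 20)"
    and A12: "2 * (x + 2 * x\<^sup>2) + 3 \<le> exp (c * x)"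
    and X: "\<And>P :: 'a poly. P \<in> monic_irreducibles (2 * g + 1) \<Longrightarrow>
        cmod (L_function (quad_char P) (complex_of_real (1/2 + \<kappa> / l))) \<le> X" "X \<ge> 0"
  shows "(exp (2 * B * ln (b / (a + 1)) - b * (4 + 2 * ln B)) - 1) / 2 \<le> X"
proof -
  let ?q = "real CARD('a)"
  define \<sigma> where "\<sigma> = 1/2 + \<kappa> / l"
  define n where "n = (\<lambda>d. prime_count TYPE('a) d)"
  have q3: "CARD('a) \<ge> 3"
    using card_field_ge_2[where 'a='a] odd by (cases "CARD('a) = 2") auto
  then have q3': "?q \<ge> 3" by simp
  have c1: "c \<ge> 1"
  proof -
    have "exp 1 \<le> ?q" using exp_le q3' by linarith
    then show ?thesis unfolding c_def using q3' by (simp add: ln_ge_iff)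
  qed
  have expc: "exp (c * real k) = ?q ^ k" for k
  proof -
    have "exp (c * real k) = exp c ^ k" by (subst mult.commute) (rule exp_of_nat_mult)
    then show ?thesis using q3' by (simp add: c_def)
  qed
  have qpowr: "?q powr y = exp (c * y)" for y
    using q3' by (simp add: powr_def c_def mult.commute)
  have a1: "a \<ge> 1" using A0 by (simp add: a_def l_def ge_one_powr_ge_zero)
  then have b3: "b \<ge> 3" using A0 by linarith
  have x0: "x > 0" and l0: "l > 0" and L0: "L > 0" using A0 by linarith+
  have B1: "B \<ge> 1" using A3 b3 by (simp add: field_simps)
  \<comment> \<open>Least degree with q^d0 \<ge> g; hence q^d0 lies between g and q g.\<close>
  define d0 where "d0 = nat \<lceil>l / c\<rceil>"
  have d0: "l / c \<le> real d0" "real d0 \<le> l / c + 1"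
    using l0 c1 by (auto simp: d0_def)
  define k0 k1 where "k0 = nat \<lceil>a\<rceil>" and "k1 = nat \<lfloor>b\<rfloor>"
  have k0: "a \<le> real k0" "real k0 \<le> a + 1" and k1: "real k1 \<le> b" "b < real k1 + 1"
    using a1 b3 by (auto simp: k0_def k1_def; linarith)+
  have k0_pos: "k0 > 0" using k0 a1 by linarith
  have k01: "k0 \<le> k1" using k0 k1 A0(4) by linarith
  \<comment> \<open>Since q^d0 is of order g, the ratio n / J in block k is q^k up to powers of k
    and L. So ln N is about the sum of J k ln q, that is g ln q / (2 L) times the sum of 1/k, and
    this stays below (g/2) ln q.\<close>
  define xk where "xk = (\<lambda>k. x / (2 * (real k)\<^sup>2 * L))"
  define Dm where "Dm = 11/10 * l / c"
  have Dm: "Dm \<le> 11/10 * l" using c1 l0 by (simp add: Dm_def field_simps)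
  define Jk where "Jk = (\<lambda>k. nat \<lfloor>xk k\<rfloor>)"
  \<comment> \<open>J n r is of order x / (k^2 L l), because n q^(-d) is about 1/d and d is of order
    l. Its square root, B / k, is where \<open>block_lower_bound\<close> stops being
    applicable.\<close>
  define ik where "ik = (\<lambda>k. nat \<lfloor>B / real k\<rfloor>)"
  define Ds where "Ds = (\<lambda>k. d0 + k) ` {k0..k1}"
  define J where "J = (\<lambda>d. Jk (d - d0))"
  define i where "i = (\<lambda>d. ik (d - d0))"
  define r where "r = (\<lambda>d. ?q powr (- (2 * real d * \<sigma>)))"
  have inj: "inj_on (\<lambda>k. d0 + k) {k0..k1}" by simp
  have sum_Ds: "sum f Ds = (\<Sum>k=k0..k1. f (d0 + k))" for f :: "nat \<Rightarrow> real"
    unfolding Ds_def by (subst sum.reindex[OF inj]) simp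
  have prod_Ds: "prod f Ds = (\<Prod>k=k0..k1. f (d0 + k))" for f :: "nat \<Rightarrow> real"
    unfolding Ds_def by (subst prod.reindex[OF inj]) simp
  have Jd: "J (d0 + k) = Jk k" and id: "i (d0 + k) = ik k" for k
    by (simp_all add: J_def i_def)
  have sum1: "(\<Sum>k=k0..k1. 1 / real k) \<le> 1 + 3 / 4 * L"
  proof -
    have "(\<Sum>k=k0..k1. 1 / real k) \<le> 1 + ln (real k1 / real k0)"
      by (rule sum_inverse_upper[OF k0_pos k01])
    also have "ln (real k1 / real k0) \<le> ln (b / a)"
      using k0 k1 k0_pos k01 a1 b3 by (subst ln_le_cancel_iff) (auto intro!: frac_le divide_pos_pos)
    also have "ln (b / a) = 3 / 4 * L"
      using l0 by (simp add: a_def b_def ln_div ln_powr L_def l_def)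
    finally show ?thesis by simp
  qed
  have sum2: "ln (b / (a + 1)) \<le> (\<Sum>k=k0..k1. 1 / real k)"
  proof -
    have "ln (b / (a + 1)) \<le> ln ((real k1 + 1) / real k0)"
      using k0 k1 k0_pos k01 a1 b3 by (subst ln_le_cancel_iff) (auto intro!: frac_le divide_pos_pos)
    also have "\<dots> \<le> (\<Sum>k=k0..k1. 1 / real k)" by (rule sum_inverse_lower[OF k0_pos k01])
    finally show ?thesis .
  qed
  have per_k: "real (d0 + k) \<le> Dm \<and> 0 < real (d0 + k) \<and> 1 \<le> real k \<and>
     real (Jk k) \<le> xk k \<and> 39/40 * (xk k) \<le> real (Jk k) \<and> 0 < Jk k \<and>
     real (ik k) \<le> B / real k \<and> B / real k - 1 \<le> real (ik k) \<and> 0 < ik k \<and>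
     40 * real (ik k) \<le> xk k \<and> xk k \<le> x / 2 \<and> a \<le> real k \<and> real k \<le> b"
    if k: "k \<in> {k0..k1}" for k
  proof -
    have ka: "a \<le> real k" using k k0 by (metis atLeastAtMost_iff of_nat_le_iff order_trans)
    have kb: "real k \<le> b" using k k1 by (metis atLeastAtMost_iff of_nat_le_iff order_trans)
    have k1': "1 \<le> real k" using ka a1 by linarith
    let ?x = "xk k"
    have "x / (2 * b\<^sup>2 * L) \<le> ?x"
      unfolding xk_def using k1' kb L0 x0 by (intro divide_left_mono mult_mono power_mono mult_pos_pos) auto
    then have x40: "?x \<ge> 40" using A2 by linarith
    have J1: "real (Jk k) \<le> ?x" "?x - 1 \<le> real (Jk k)" using x40 by (auto simp: Jk_def; linarith)+
    have "B / b \<le> B / real k" using k1' kb B1 by (intro divide_left_mono mult_pos_pos) auto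
    then have Bk: "B / real k \<ge> 2" using A3 by linarith
    have i1: "real (ik k) \<le> B / real k" "B / real k - 1 \<le> real (ik k)" using Bk by (auto simp: ik_def; linarith)+
    have "B / real k = ?x * (B * real k * 2 * L / x)"
      using k1' L0 x0 by (simp add: xk_def power2_eq_square field_simps)
    also have "\<dots> \<le> ?x * (B * b * 2 * L / x)"
      using x40 kb B1 L0 x0 by (intro mult_left_mono divide_right_mono mult_right_mono) auto
    also have "\<dots> \<le> ?x * (1 / 40)" using A4 x40 by (intro mult_left_mono) auto
    finally have i2: "40 * (B / real k) \<le> ?x" by linarith
    have x2: "?x \<le> x / 2"
    proof -
      have "1 * 1 \<le> (real k)\<^sup>2 * L" using k1' A0 by (intro mult_mono) auto
      then have "2 \<le> 2 * (real k)\<^sup>2 * L" by simp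
      then show ?thesis unfolding xk_def using x0 L0 k1' by (intro divide_left_mono mult_pos_pos) auto
    qed
    have dk: "real (d0 + k) \<le> Dm" using d0 kb A1 by (simp add: Dm_def)
    show ?thesis
      using dk k1' J1 x40 i1 Bk i2 x2 ka kb by (intro conjI; (linarith | simp))
  qed
  have n_upper: "real d * real (n d) \<le> ?q ^ d" if "d > 0" for d
  proof -
    have "d * n d \<le> CARD('a) ^ d" unfolding n_def by (rule prime_count_upper[OF that])
    then show ?thesis by (metis of_nat_le_iff of_nat_mult of_nat_power)
  qed
  have qk: "?q ^ k \<ge> 22 * l" if k: "k \<in> {k0..k1}" for k
  proof -
    have "1 * a \<le> c * real k" using per_k[OF k] c1 a1 by (intro mult_mono) auto
    then have "exp a \<le> exp (c * real k)" by simp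
    then show ?thesis using A5 expc[of k] by linarith
  qed
  have qd0: "x \<le> ?q ^ d0" "?q ^ d0 \<le> ?q * x"
  proof -
    have x_exp: "x = exp l" using x0 by (simp add: l_def x_def)
    have "l \<le> c * real d0" using d0(1) c1 by (simp add: field_simps)
    then show "x \<le> ?q ^ d0" unfolding x_exp expc[symmetric] by simp
    have "c * (l / c + 1) = c + l" using c1 by (simp add: field_simps)
    then have "c * real d0 \<le> c + l" using mult_left_mono[OF d0(2), of c] c1 by simp
    then have "?q ^ d0 \<le> exp (c + l)" unfolding expc[symmetric] by simp
    then show "?q ^ d0 \<le> ?q * x" using q3' by (simp add: exp_add x_exp c_def)
  qed
  have n_lower: "19/20 * ?q ^ (d0 + k) \<le> real (d0 + k) * real (n (d0 + k)) \<and>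
      20 * x * real (d0 + k) \<le> ?q ^ (d0 + k)" if k: "k \<in> {k0..k1}" for k
  proof
    let ?d = "d0 + k"
    have "8 \<le> l / c" using A6 c1 by (simp add: field_simps)
    then have "real ?d \<ge> 8" using d0 by simp
    then have d8: "?d \<ge> 8" by linarith
    have "CARD('a) ^ ?d \<le> ?d * n ?d + 2 * CARD('a) ^ (?d div 2)"
      unfolding n_def using d8 by (intro prime_count_lower) auto
    moreover have "40 * CARD('a) ^ (?d div 2) \<le> CARD('a) ^ ?d"
    proof -
      have "40 \<le> (3 :: nat) ^ 4" by simp
      also have "\<dots> \<le> CARD('a) ^ 4" using q3 by (intro power_mono) auto
      also have "\<dots> \<le> CARD('a) ^ (?d - ?d div 2)" using q3 d8 by (intro power_increasing) auto
      finally have "40 * CARD('a) ^ (?d div 2) \<le> CARD('a) ^ (?d - ?d div 2) * CARD('a) ^ (?d div 2)"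
        by (rule mult_le_mono1)
      also have "\<dots> = CARD('a) ^ ?d" by (simp flip: power_add)
      finally show ?thesis .
    qed
    ultimately have "19 * CARD('a) ^ ?d \<le> 20 * (?d * n ?d)" by linarith
    then have "real (19 * CARD('a) ^ ?d) \<le> real (20 * (?d * n ?d))" by (simp only: of_nat_le_iff)
    then show "19/20 * ?q ^ ?d \<le> real ?d * real (n ?d)" by (simp add: algebra_simps)
    have "20 * real ?d \<le> 22 * l"
    proof -
      have "real ?d \<le> Dm" using per_k[OF k] by blast
      then have "real ?d \<le> 11/10 * l" using Dm by (rule order_trans)
      then have "20 * real ?d \<le> 20 * (11/10 * l)" by (rule mult_left_mono) simp
      then show ?thesis by simp
    qed
    then have "x * (20 * real ?d) \<le> ?q ^ d0 * ?q ^ k"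
      using qd0(1) qk[OF k] x0 by (intro mult_mono) auto
    then show "20 * x * real ?d \<le> ?q ^ ?d" by (simp add: power_add mult_ac)
  qed
  have block: "exp (2 * B / real k - 4 - 2 * ln B) \<le>
      real (Jk k choose ik k) * real ((n (d0 + k) - Jk k) choose ik k) * r (d0 + k) ^ ik k \<and> Jk k \<le> n (d0 + k)"
    if k: "k \<in> {k0..k1}" for k
  proof -
    let ?d = "d0 + k" and ?x = "xk k"
    define u where "u = ?q ^ ?d / real ?d"
    note P = per_k[OF k]
    have d_pos: "real ?d > 0" using P by blast
    have nu: "19/20 * u \<le> real (n ?d)" using n_lower[OF k] d_pos by (simp add: u_def field_simps)
    have xu: "20 * x \<le> u" using n_lower[OF k] d_pos by (simp add: u_def field_simps)
    have Jn: "real (Jk k) \<le> u / 40" using P xu by linarith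
    then have Jn': "Jk k \<le> n ?d" using nu x0 xu by linarith
    have ii: "real (ik k) \<le> u / 40 / 40" using P xu by linarith
    have iJ: "ik k \<le> Jk k" using P x0 by linarith
    have nJ: "real (n ?d - Jk k) = real (n ?d) - real (Jk k)" using Jn' by (simp add: of_nat_diff)
    have in': "ik k \<le> n ?d - Jk k" using ii nJ nu Jn x0 xu by linarith
    have f1: "19/20 * ?x \<le> real (Jk k) - real (ik k)" using P by linarith
    have f2: "9/10 * u \<le> real (n ?d - Jk k) - real (ik k)" unfolding nJ using nu Jn ii xu x0 by linarith
    \<comment> \<open>With c d \<le> (11/10) l, the shift of \<sigma> from 1/2 costs at most e^(-22
      \<kappa> / 10); it is weakened to e^(-6 \<kappa>), the square of the factor in
      C(\<kappa>).\<close>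
    have r_ge: "exp (- (c * real ?d)) * exp (- 6 * \<kappa>) \<le> r ?d"
    proof -
      have "c * real ?d * (\<kappa> / l) \<le> (11/10 * l) * (\<kappa> / l)"
        using P c1 l0 \<kappa> by (intro mult_right_mono) (auto simp: Dm_def field_simps)
      then have "c * real ?d * (\<kappa> / l) \<le> 11/10 * \<kappa>" using l0 by simp
      moreover have "c * (- (2 * real ?d * \<sigma>)) = - (c * real ?d) - 2 * (c * real ?d * (\<kappa> / l))"
        unfolding \<sigma>_def by (simp add: algebra_simps)
      ultimately have "- (c * real ?d) - 6 * \<kappa> \<le> c * (- (2 * real ?d * \<sigma>))"
        using \<kappa> by linarith
      then show ?thesis unfolding r_def qpowr by (simp flip: exp_add)
    qed
    have r0: "r ?d \<ge> 0" by (simp add: r_def)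
    have u0: "u \<ge> 0" using xu x0 by linarith
    have x_pos: "?x > 0" using x0 L0 P by (simp add: xk_def)
    have "(real (ik k))\<^sup>2 \<le> (B / real k)\<^sup>2" using P by (intro power_mono) auto
    also have "\<dots> = \<beta>\<^sup>2 * (x / (L * l)) / (real k)\<^sup>2"
      using x0 L0 l0 by (simp add: B_def power_mult_distrib power_divide x_def l_def L_def)
    also have "\<dots> \<le> (2 / 9 * exp (- 6 * \<kappa>) * c) * (x / (L * l)) / (real k)\<^sup>2"
      using \<beta>(2) x0 L0 l0 by (intro divide_right_mono mult_right_mono) auto
    also have "\<dots> = 4 / 9 * ?x * (c / l) * exp (- 6 * \<kappa>)"
      by (simp add: xk_def field_simps)
    \<comment> \<open>The 4/9 comes from \<beta>^2. The fractions 19/20, 9/10 and 10/11 are the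
      losses in J - i, in n - J - i and in replacing d by its upper bound; their product exceeds
      3/4.\<close>
    also have "\<dots> \<le> (19/20 * (9/10)) * ?x * (10/11 * (c / l)) * exp (- 6 * \<kappa>)"
    proof -
      have "4 / 9 * (?x * (c / l) * exp (- 6 * \<kappa>)) \<le> (19/20 * (9/10) * (10/11)) * (?x * (c / l) * exp (- 6 * \<kappa>))"
        using c1 l0 by (intro mult_right_mono mult_nonneg_nonneg less_imp_le[OF x_pos]) auto
      then show ?thesis by (simp only: mult_ac)
    qed
    also have "\<dots> \<le> (19/20 * (9/10)) * ?x * (1 / real ?d) * exp (- 6 * \<kappa>)"
    proof -
      have "10/11 * (c / l) \<le> 1 / real ?d" using P c1 l0 d_pos by (simp add: Dm_def field_simps)
      then show ?thesis
        by (intro mult_right_mono mult_left_mono mult_nonneg_nonneg less_imp_le[OF x_pos]) auto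
    qed
    also have "1 / real ?d = u * exp (- (c * real ?d))"
      unfolding u_def exp_minus expc using q3' by simp
    also have "(19/20 * (9/10)) * ?x * (u * exp (- (c * real ?d))) * exp (- 6 * \<kappa>) =
        (19/20 * ?x) * (9/10 * u) * (exp (- (c * real ?d)) * exp (- 6 * \<kappa>))"
      by (simp only: mult_ac)
    also have "\<dots> \<le> (real (Jk k) - real (ik k)) * (real (n ?d - Jk k) - real (ik k)) * r ?d"
      using f1 f2 r_ge x_pos u0 by (intro mult_mono) auto
    finally have main: "(real (ik k))\<^sup>2 \<le> (real (Jk k) - real (ik k)) * (real (n ?d - Jk k) - real (ik k)) * r ?d" .
    have "exp (2 * real (ik k) - 2 - 2 * ln (real (ik k))) \<le>
        real (Jk k choose ik k) * real ((n ?d - Jk k) choose ik k) * r ?d ^ ik k"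
      using P iJ in' r0 main by (intro block_lower_bound) auto
    moreover have "ln (real (ik k)) \<le> ln B"
    proof -
      have "B / real k \<le> B / 1" using P B1 by (intro divide_left_mono) auto
      then have "real (ik k) \<le> B" using P by linarith
      then show ?thesis using P by (subst ln_le_cancel_iff) auto
    qed
    then have "2 * B / real k - 4 - 2 * ln B \<le> 2 * real (ik k) - 2 - 2 * ln (real (ik k))"
      using P by simp
    then have "exp (2 * B / real k - 4 - 2 * ln B) \<le> exp (2 * real (ik k) - 2 - 2 * ln (real (ik k)))" by simp
    ultimately show ?thesis using Jn' by linarith
  qed
  define K where "K = (\<Sum>d\<in>Ds. 2 * d * i d)"
  define \<pi> where "\<pi> = real (prime_count TYPE('a) (2 * g + 1))"
  define E where "E = (4 * real (g + 2 * g\<^sup>2) + 4) * ?q ^ (g + 1)"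
  define W where "W = (\<Sum>j\<le>g. ?q ^ j * afe_weight CARD('a) g \<sigma> j)"
  define N where "N = (\<Prod>d\<in>Ds. real (n d choose J d))"
  define BB where "BB = (\<Prod>d\<in>Ds. real (J d choose i d) * real ((n d - J d) choose i d))"
  have "real K \<le> x"
  proof -
    have "real K = (\<Sum>k=k0..k1. 2 * real (d0 + k) * real (ik k))"
      using sum_Ds[of "\<lambda>d. 2 * real d * real (i d)"] by (simp add: K_def id)
    also have "\<dots> \<le> (\<Sum>k=k0..k1. 2 * (11/10 * l) * (B / real k))"
    proof (rule sum_mono)
      fix k assume k: "k \<in> {k0..k1}"
      show "2 * real (d0 + k) * real (ik k) \<le> 2 * (11/10 * l) * (B / real k)"
        using per_k[OF k] l0 Dm by (intro mult_mono) (linarith | simp)+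
    qed
    also have "\<dots> = 22/10 * l * B * (\<Sum>k=k0..k1. 1 / real k)"
      by (simp add: sum_distrib_left)
    also have "\<dots> \<le> 22/10 * l * B * (1 + L)"
      using sum1 L0 l0 B1 by (intro mult_left_mono) auto
    finally show ?thesis using A9 by linarith
  qed
  then have K: "K \<le> g" by (simp add: x_def)
  have Y: "(\<Sum>d\<in>Ds. d * J d) \<le> g\<^sup>2"
  proof -
    have "real (\<Sum>d\<in>Ds. d * J d) = (\<Sum>k=k0..k1. real (d0 + k) * real (Jk k))"
      using sum_Ds[of "\<lambda>d. real d * real (J d)"] by (simp add: Jd)
    also have "\<dots> \<le> (\<Sum>k=k0..k1. (11/10 * l) * x)"
    proof (rule sum_mono)
      fix k assume k: "k \<in> {k0..k1}"
      show "real (d0 + k) * real (Jk k) \<le> (11/10 * l) * x"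
        using per_k[OF k] l0 x0 Dm by (intro mult_mono) (linarith | simp)+
    qed
    also have "\<dots> = real (k1 + 1 - k0) * (11/10 * l * x)" by simp
    also have "\<dots> \<le> b * (11/10 * l * x)"
      using k0_pos k1 l0 x0 by (intro mult_right_mono) auto
    also have "\<dots> = (11/10 * b * l) * x" by simp
    also have "\<dots> \<le> x * x" using A10 x0 by (intro mult_right_mono) auto
    finally have "real (\<Sum>d\<in>Ds. d * J d) \<le> real (g\<^sup>2)" by (simp add: x_def power2_eq_square)
    then show ?thesis by (simp only: of_nat_le_iff)
  qed
  have large: "CARD('a) ^ g \<ge> 2 * (g + 2 * g\<^sup>2) + 3"
  proof -
    have "real (2 * (g + 2 * g\<^sup>2) + 3) \<le> real (CARD('a) ^ g)"
      using A12 expc[of g] by (simp add: x_def)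
    then show ?thesis by (simp only: of_nat_le_iff)
  qed
  have res: "\<pi> * BB * ?q powr (- (real K * \<sigma>)) - E * W * N \<le> X * (\<pi> + E * N)"
    unfolding \<pi>_def BB_def E_def W_def N_def n_def
  proof (rule block_resonance)
    show "finite Ds" by (simp add: Ds_def)
    fix d assume "d \<in> Ds"
    then obtain k where d: "d = d0 + k" and k: "k \<in> {k0..k1}" unfolding Ds_def by blast
    show "J d \<le> prime_count TYPE('a) d" using block[OF k] by (simp add: d Jd n_def)
    have "11/10 * 1 * l \<le> 11/10 * b * l" using b3 l0 by (intro mult_right_mono) auto
    moreover have "real d \<le> Dm" using per_k[OF k] unfolding d by blast
    ultimately have "real d \<le> real g" using A10 Dm unfolding x_def by linarith
    then show "d \<le> 2 * g" by simp
  next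
    show "1 / 2 \<le> \<sigma>" using \<kappa> l0 by (simp add: \<sigma>_def)
  qed (use odd K Y large X \<sigma>_def K_def in auto)
  have low: "exp (2 * B * ln (b / (a + 1)) - b * (4 + 2 * ln B)) \<le> BB * ?q powr (- (real K * \<sigma>))"
  proof -
    have "?q powr (- (real K * \<sigma>)) = (\<Prod>d\<in>Ds. r d ^ i d)"
    proof -
      have "c * (- (real K * \<sigma>)) = (\<Sum>d\<in>Ds. real (i d) * (c * (- (2 * real d * \<sigma>))))"
        by (simp add: K_def sum_distrib_left sum_distrib_right sum_negf mult_ac)
      then have "?q powr (- (real K * \<sigma>)) = exp (\<Sum>d\<in>Ds. real (i d) * (c * (- (2 * real d * \<sigma>))))"
        by (simp only: qpowr)
      also have "\<dots> = (\<Prod>d\<in>Ds. exp (real (i d) * (c * (- (2 * real d * \<sigma>)))))"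
        by (rule exp_sum) (simp add: Ds_def)
      also have "\<dots> = (\<Prod>d\<in>Ds. r d ^ i d)"
        by (simp only: exp_of_nat_mult r_def qpowr)
      finally show ?thesis .
    qed
    then have "BB * ?q powr (- (real K * \<sigma>)) = (\<Prod>d\<in>Ds. real (J d choose i d) * real ((n d - J d) choose i d) * r d ^ i d)"
      by (simp add: BB_def prod.distrib)
    also have "\<dots> = (\<Prod>k=k0..k1. real (Jk k choose ik k) * real ((n (d0 + k) - Jk k) choose ik k) * r (d0 + k) ^ ik k)"
      unfolding prod_Ds by (simp add: Jd id)
    also have "\<dots> \<ge> (\<Prod>k=k0..k1. exp (2 * B / real k - 4 - 2 * ln B))"
      using block by (intro prod_mono) auto
    also have "(\<Prod>k=k0..k1. exp (2 * B / real k - 4 - 2 * ln B)) = exp (\<Sum>k=k0..k1. 2 * B / real k - 4 - 2 * ln B)"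
      by (simp add: exp_sum)
    also have "(\<Sum>k=k0..k1. 2 * B / real k - 4 - 2 * ln B) =
        2 * B * (\<Sum>k=k0..k1. 1 / real k) - real (k1 + 1 - k0) * (4 + 2 * ln B)"
      by (simp add: sum_subtractf sum_distrib_left algebra_simps)
    finally have le: "exp (2 * B * (\<Sum>k=k0..k1. 1 / real k) - real (k1 + 1 - k0) * (4 + 2 * ln B)) \<le>
      BB * ?q powr (- (real K * \<sigma>))" .
    have "2 * B * ln (b / (a + 1)) \<le> 2 * B * (\<Sum>k=k0..k1. 1 / real k)"
      using sum2 B1 by (intro mult_left_mono) auto
    moreover have "real (k1 + 1 - k0) * (4 + 2 * ln B) \<le> b * (4 + 2 * ln B)"
      using k0_pos k1 B1 by (intro mult_right_mono) auto
    ultimately have "exp (2 * B * ln (b / (a + 1)) - b * (4 + 2 * ln B)) \<le>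
        exp (2 * B * (\<Sum>k=k0..k1. 1 / real k) - real (k1 + 1 - k0) * (4 + 2 * ln B))" by simp
    then show ?thesis using le by linarith
  qed
  have N: "N \<le> exp (45/100 * (c * x))"
  proof -
    have "N = (\<Prod>k=k0..k1. real (n (d0 + k) choose Jk k))"
      unfolding N_def prod_Ds by (simp add: Jd)
    also have "\<dots> \<le> (\<Prod>k=k0..k1. exp (55/100 * c * x / L * (1 / real k)))"
    proof (rule prod_mono, intro conjI)
      fix k assume k: "k \<in> {k0..k1}"
      let ?d = "d0 + k" and ?x = "xk k"
      note P = per_k[OF k]
      have Jp: "real (Jk k) > 0" using P by simp
      have kp: "real k > 0" using P by linarith
      have "real (n ?d) \<le> ?q ^ ?d"
      proof -
        have "1 * real (n ?d) \<le> real ?d * real (n ?d)" using P by (intro mult_right_mono) auto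
        also have "\<dots> \<le> ?q ^ ?d" using P by (intro n_upper) simp
        finally show ?thesis by simp
      qed
      also have "\<dots> \<le> (?q * x) * exp (c * real k)"
        unfolding power_add expc using qd0 by (intro mult_right_mono) auto
      finally have nn: "real (n ?d) \<le> (?q * x) * exp (c * real k)" .
      have Jl: "x / (4 * (real k)\<^sup>2 * L) \<le> real (Jk k)"
      proof -
        have "x / (4 * (real k)\<^sup>2 * L) = ?x / 2" by (simp add: xk_def)
        moreover have "?x > 0" using x0 L0 kp by (simp add: xk_def)
        ultimately show ?thesis using P by linarith
      qed
      \<comment> \<open>The factor g in q^d0 cancels against the one in J. What remains beside e^(c
        k) is logarithmic in g, and \<open>A7\<close> absorbs it into e^(c k / 10) because k \<ge>
        a.\<close>
      have "exp 1 * real (n ?d) / real (Jk k) \<le> exp 1 * ((?q * x) * exp (c * real k)) / (x / (4 * (real k)\<^sup>2 * L))"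
        using nn Jl x0 L0 kp by (intro frac_le mult_left_mono) auto
      also have "\<dots> = exp 1 * ((?q * x) * exp (c * real k)) * (4 * (real k)\<^sup>2 * L) / x"
        by (rule divide_divide_eq_right)
      also have "\<dots> = 4 * exp 1 * ?q * (real k)\<^sup>2 * L * exp (c * real k)"
        using x0 by (simp add: mult_ac)
      also have "\<dots> = exp (ln 4 + 1 + c + 2 * ln (real k) + ln L + c * real k)"
      proof -
        have "exp (ln (real k)) = real k" using kp by simp
        then have "exp (2 * ln (real k)) = (real k)\<^sup>2"
          by (simp only: mult_2 exp_add power2_eq_square)
        moreover have "exp (ln 4) = (4 :: real)" "exp (ln L) = L" using L0 by simp_all
        moreover have "exp c = ?q" using expc[of 1] by simp
        ultimately show ?thesis by (simp only: exp_add)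
      qed
      also have "\<dots> \<le> exp (11/10 * (c * real k))"
      proof -
        have "ln (real k) \<le> ln b" using P kp by (subst ln_le_cancel_iff) auto
        moreover have "ln L \<le> L" using L0 ln_le_minus_one[of L] by linarith
        moreover have "a * c \<le> c * real k" using P c1 by (simp add: mult.commute mult_left_mono)
        ultimately show ?thesis using A7 by simp
      qed
      finally have base: "exp 1 * real (n ?d) / real (Jk k) \<le> exp (11/10 * (c * real k))" .
      have "real (n ?d choose Jk k) \<le> (exp 1 * real (n ?d) / real (Jk k)) ^ Jk k"
        using P by (intro binomial_upper_bound) simp
      also have "\<dots> \<le> exp (11/10 * (c * real k)) ^ Jk k" using base by (intro power_mono) auto
      also have "\<dots> = exp (real (Jk k) * (11/10 * (c * real k)))" by (rule exp_of_nat_mult[symmetric])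
      also have "\<dots> \<le> exp (?x * (11/10 * (c * real k)))"
        using P c1 by (simp only: exp_le_cancel_iff) (intro mult_right_mono, auto)
      also have "?x * (11/10 * (c * real k)) = 55/100 * c * x / L * (1 / real k)"
        using kp L0 by (simp add: xk_def power2_eq_square field_simps)
      finally show "real (n ?d choose Jk k) \<le> exp (55/100 * c * x / L * (1 / real k))" .
    qed simp
    also have "\<dots> = exp (55/100 * c * x / L * (\<Sum>k=k0..k1. 1 / real k))"
      by (simp only: exp_sum[symmetric] finite_atLeastAtMost sum_distrib_left)
    also have "\<dots> \<le> exp (55/100 * c * x / L * (1 + 3/4 * L))"
      using sum1 c1 x0 L0 by (simp only: exp_le_cancel_iff) (intro mult_left_mono, auto)
    \<comment> \<open>L \<ge> 15 is chosen for this line: 0.55 (1/15 + 3/4) is just below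
      0.45.\<close>
    also have "\<dots> \<le> exp (45/100 * (c * x))"
    proof -
      have "55/100 * c * x / L * (1 + 3/4 * L) = c * x * (55/100 * (1 / L + 3/4))"
        using L0 by (simp add: field_simps)
      also have "\<dots> \<le> c * x * (45/100)"
      proof -
        have "1 / L \<le> 1 / 15" using A0(3) by (intro divide_left_mono) auto
        then show ?thesis using c1 x0 by (intro mult_left_mono) auto
      qed
      finally show ?thesis by simp
    qed
    finally show ?thesis .
  qed
  have \<pi>_lower: "exp (2 * (c * x)) \<le> (2 * x + 1) * \<pi>"
  proof -
    have "exp (2 * (c * x)) = ?q ^ (2 * g)" using expc[of "2 * g"] by (simp add: x_def mult.left_commute)
    then show ?thesis using prime_count_odd_lower[OF odd, of g] by (simp add: \<pi>_def x_def)
  qed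
  then have \<pi>0: "\<pi> > 0"
  proof -
    have "0 < (2 * x + 1) * \<pi>" using \<pi>_lower exp_gt_zero order_less_le_trans by blast
    then show ?thesis using x0 by (simp add: zero_less_mult_iff)
  qed
  have \<sigma>: "\<sigma> \<ge> 1/2" using \<kappa> l0 by (simp add: \<sigma>_def)
  have W_upper: "W \<le> 2 * (x + 1) * exp (c * x / 2)"
  proof -
    have "W \<le> (\<Sum>j\<le>g. 2 * exp (c * x / 2))"
      unfolding W_def
    proof (rule sum_mono)
      fix j assume j: "j \<in> {..g}"
      have "?q ^ j * afe_weight CARD('a) g \<sigma> j \<le> ?q ^ j * (2 * ?q powr (- (real j / 2)))"
        using afe_weight_bounds(3)[OF card_field_ge_2[where 'a='a] \<sigma>, where j = j and g = g] by (intro mult_left_mono) auto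
      also have "\<dots> = 2 * exp (c * real j / 2)"
        unfolding qpowr expc[symmetric] by (simp add: exp_add[symmetric] field_simps)
      also have "\<dots> \<le> 2 * exp (c * x / 2)" using j c1 by (simp add: x_def)
      finally show "?q ^ j * afe_weight CARD('a) g \<sigma> j \<le> 2 * exp (c * x / 2)" .
    qed
    then show ?thesis by (simp add: x_def algebra_simps)
  qed
  have W_lower: "W \<ge> 1"
  proof -
    have "1 \<le> ?q ^ 0 * afe_weight CARD('a) g \<sigma> 0"
      using afe_weight_bounds(1)[OF card_field_ge_2[where 'a='a] \<sigma>, where j = 0 and g = g] by (simp add: qpowr)
    also have "\<dots> \<le> W" unfolding W_def
      using afe_weight_bounds(2)[OF card_field_ge_2[where 'a='a] \<sigma>]
      by (intro member_le_sum[of 0]) auto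
    finally show ?thesis .
  qed
  have E0: "E \<ge> 0" and N0: "N \<ge> 0" by (auto simp: E_def N_def intro!: prod_nonneg)
  \<comment> \<open>In units of c x the exponents add up as 1 + 1/2 + 45/100 + 1/20 = 2: character
    sum error, weights, resonator, and polynomial factors by \<open>A11\<close>, against the number
    of primes.\<close>
  have EWN: "E * W * N \<le> \<pi>"
  proof -
    have E: "E = (4 * (x + 2 * x\<^sup>2) + 4) * ?q * exp (c * x)"
      using expc[of g] by (simp add: E_def x_def)
    have "E * W * N \<le> E * (2 * (x + 1) * exp (c * x / 2)) * exp (45/100 * (c * x))"
      using W_upper N W_lower E0 N0 x0 by (intro mult_mono) auto
    also have "\<dots> = ((4 * (x + 2 * x\<^sup>2) + 4) * ?q * (2 * (x + 1))) * exp (c * x + c * x / 2 + 45/100 * (c * x))"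
      unfolding E exp_add by (simp only: mult_ac)
    finally have "(2 * x + 1) * (E * W * N) \<le>
        (2 * x + 1) * (((4 * (x + 2 * x\<^sup>2) + 4) * ?q * (2 * (x + 1))) * exp (c * x + c * x / 2 + 45/100 * (c * x)))"
      using x0 by (intro mult_left_mono) auto
    also have "\<dots> = ((4 * (x + 2 * x\<^sup>2) + 4) * ?q * (2 * (x + 1)) * (2 * x + 1)) * exp (c * x + c * x / 2 + 45/100 * (c * x))"
      by (simp only: mult_ac)
    also have "\<dots> \<le> exp (c * x / 20) * exp (c * x + c * x / 2 + 45/100 * (c * x))"
      using A11 by (intro mult_right_mono) auto
    also have "\<dots> = exp (2 * (c * x))" unfolding exp_add[symmetric] by simp
    also have "\<dots> \<le> (2 * x + 1) * \<pi>" by (rule \<pi>_lower)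
    finally show ?thesis using x0 by (simp only: mult_le_cancel_left_pos)
  qed
  have EN: "E * N \<le> \<pi>"
  proof -
    have "E * N * 1 \<le> E * N * W" using W_lower E0 N0 by (intro mult_left_mono) auto
    then show ?thesis using EWN by (simp add: mult_ac)
  qed
  define T where "T = exp (2 * B * ln (b / (a + 1)) - b * (4 + 2 * ln B))"
  have "\<pi> * T \<le> \<pi> * (BB * ?q powr (- (real K * \<sigma>)))"
    using low \<pi>0 unfolding T_def by (intro mult_left_mono) auto
  also have "\<dots> \<le> X * (\<pi> + E * N) + E * W * N" using res by (simp add: mult.assoc)
  also have "\<dots> \<le> X * (\<pi> + \<pi>) + \<pi>" using EN EWN X(2) by (intro add_mono mult_left_mono) auto
  also have "\<dots> = \<pi> * (2 * X + 1)" by (simp add: algebra_simps)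
  finally have "T \<le> 2 * X + 1" using \<pi>0 by simp
  then show ?thesis by (simp add: T_def)
qed

theorem theorem1p2:
  fixes \<kappa> \<epsilon> :: real
  assumes odd_q: "odd CARD('a :: {finite, field})"
    and kappa: "\<kappa> > 0"
    and eps: "\<epsilon> \<in> {0<..<1/2}"
  shows "\<exists>\<delta> :: nat \<Rightarrow> real. \<delta> \<longlonglongrightarrow> 0 \<and>
    (\<forall>\<^sub>F g in sequentially.
      (let \<sigma> = 1/2 + \<kappa> / ln (real g);
           C = exp (-3 * \<kappa>) * sqrt ((1/2 - \<epsilon>) * ln (real CARD('a)))
       in Max ((\<lambda>P. cmod (L_function (quad_char P) (complex_of_real \<sigma>))) `
                (monic_irreducibles (2 * g + 1) :: 'a poly set))
          \<ge> exp ((C + \<delta> g) * sqrt (real g * ln (ln (real g)) / ln (real g)))))"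
proof -
  define c where "c = ln (real CARD('a))"
  define C where "C = exp (-3 * \<kappa>) * sqrt ((1/2 - \<epsilon>) * c)"
  \<comment> \<open>Since ln (b / a) = (3/4) ln ln g, the main exponent is asymptotic to (3/2)
    \<beta> times the square root in the claim. This \<beta> makes (3/2) \<beta> = e^(-3 \<kappa>)
    sqrt (c / 2), the value of C at \<epsilon> = 0.\<close>
  define \<beta> where "\<beta> = 2/3 * exp (-3 * \<kappa>) * sqrt (c / 2)"
  have q: "real CARD('a) > 1" using card_field_ge_2[where 'a='a] by linarith
  then have c0: "c > 0" by (simp add: c_def)
  then have \<beta>0: "\<beta> > 0" by (simp add: \<beta>_def)
  have \<beta>2: "\<beta>\<^sup>2 \<le> 2 / 9 * exp (- 6 * \<kappa>) * c"
    using c0 by (simp add: \<beta>_def power_mult_distrib power2_eq_square exp_add[symmetric])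
  have "(1/2 - \<epsilon>) * c < 1/2 * c" using eps c0 by (intro mult_strict_right_mono) auto
  then have C\<beta>: "C < 3/2 * \<beta>" by (simp add: C_def \<beta>_def)
  have C0: "C > 0" using eps c0 by (simp add: C_def)
  define q where "q = real CARD('a)"
  have q0: "q > 0" by (simp add: q_def)
  define l L a b B where defs: "l = (\<lambda>x::real. ln x)" "L = (\<lambda>x::real. ln (ln x))"
    "a = (\<lambda>x::real. ln x powr (1/8))" "b = (\<lambda>x::real. ln x powr (7/8))"
    "B = (\<lambda>x::real. \<beta> * sqrt (x / (ln (ln x) * ln x)))"
  \<comment> \<open>The strict gap between C and (3/2) \<beta>, due to \<epsilon> > 0, absorbs the
    lower order terms. The added ln 4 serves to pass from (exp T - 1) / 2 to the target: (4 y - 1) /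
    2 \<ge> y for y \<ge> 1.\<close>
  have main: "\<forall>\<^sub>F x in at_top. C * sqrt (x * L x / l x) + ln 4 \<le> 2 * B x * ln (b x / (a x + 1)) - b x * (4 + 2 * ln (B x))"
  proof -
    have "((\<lambda>x. (2 * B x * ln (b x / (a x + 1)) - b x * (4 + 2 * ln (B x)) - ln 4) / sqrt (x * L x / l x)) \<longlongrightarrow> 3/2 * \<beta>) at_top"
      unfolding defs using \<beta>0 by real_asymp
    then have "\<forall>\<^sub>F x in at_top. (2 * B x * ln (b x / (a x + 1)) - b x * (4 + 2 * ln (B x)) - ln 4) / sqrt (x * L x / l x) > C"
      using C\<beta> by (rule order_tendstoD(1))
    moreover have "\<forall>\<^sub>F x in at_top. sqrt (x * L x / l x) > 0" unfolding defs by real_asymp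
    ultimately show ?thesis by eventually_elim (simp add: field_simps)
  qed
  have conds: "\<forall>\<^sub>F x in at_top. x \<ge> 1 \<and> l x \<ge> 1 \<and> L x \<ge> 15 \<and> a x + 2 \<le> b x \<and>
      l x / c + 1 + b x \<le> 11/10 * l x / c \<and> x / (2 * (b x)\<^sup>2 * L x) \<ge> 40 \<and> B x / b x \<ge> 2 \<and>
      B x * b x * 2 * L x / x \<le> 1 / 40 \<and> exp (a x) \<ge> 22 * l x \<and> l x \<ge> 8 * c \<and>
      a x * c / 10 \<ge> ln 4 + 1 + c + 2 * ln (b x) + L x \<and> 22/10 * l x * B x * (1 + L x) \<le> x \<and>
      11/10 * b x * l x \<le> x \<and>
      (4 * (x + 2 * x\<^sup>2) + 4) * q * (2 * (x + 1)) * (2 * x + 1) \<le> exp (c * x / 20) \<and>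
      2 * (x + 2 * x\<^sup>2) + 3 \<le> exp (c * x)"
    unfolding defs using \<beta>0 c0 q0 by (intro eventually_conj; real_asymp)
  have "\<forall>\<^sub>F g in sequentially.
      Max ((\<lambda>P. cmod (L_function (quad_char P) (complex_of_real (1/2 + \<kappa> / ln (real g))))) `
                (monic_irreducibles (2 * g + 1) :: 'a poly set))
          \<ge> exp (C * sqrt (real g * ln (ln (real g)) / ln (real g)))"
    using eventually_compose_filterlim[OF main filterlim_real_sequentially]
      eventually_compose_filterlim[OF conds filterlim_real_sequentially]
  proof eventually_elim
    case (elim g)
    let ?I = "monic_irreducibles (2 * g + 1) :: 'a poly set"
    let ?f = "\<lambda>P :: 'a poly. cmod (L_function (quad_char P) (complex_of_real (1/2 + \<kappa> / ln (real g))))"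
    define X where "X = Max (?f ` ?I)"
    have fin: "finite (?f ` ?I)" by (intro finite_imageI finite_monic_irreducibles)
    have X1: "?f P \<le> X" if "P \<in> ?I" for P
      unfolding X_def using fin that by (intro Max_ge) auto
    have "?I \<noteq> {}"
    proof
      assume "?I = {}"
      then have "real CARD('a) ^ (2 * g) \<le> 0" using prime_count_odd_lower[OF odd_q, of g] by simp
      moreover have "real CARD('a) ^ (2 * g) > 0" by simp
      ultimately show False by linarith
    qed
    then obtain P where "P \<in> ?I" by blast
    then have X0: "X \<ge> 0" using X1[of P] norm_ge_zero order_trans by blast
    define T where "T = 2 * B (real g) * ln (b (real g) / (a (real g) + 1)) - b (real g) * (4 + 2 * ln (B (real g)))"
    have "(exp T - 1) / 2 \<le> X"
      unfolding T_def defs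
      by (rule large_value_explicit[OF odd_q kappa \<beta>0])
        (use elim(2) \<beta>2 X1 X0 in \<open>simp_all add: defs c_def q_def\<close>)
    moreover have "exp (C * sqrt (real g * ln (ln (real g)) / ln (real g)) + ln 4) \<le> exp T"
      using elim(1) by (simp add: T_def defs)
    then have "exp (C * sqrt (real g * ln (ln (real g)) / ln (real g))) * 4 \<le> exp T"
      by (simp add: exp_add)
    moreover have "exp (C * sqrt (real g * ln (ln (real g)) / ln (real g))) \<ge> 1"
    proof -
      have "real g * ln (ln (real g)) / ln (real g) \<ge> 0" using elim(2) by (simp add: defs)
      then show ?thesis using C0 by simp
    qed
    ultimately have "exp (C * sqrt (real g * ln (ln (real g)) / ln (real g))) \<le> X" by argo
    then show ?case by (simp only: X_def)
  qed
  \<comment> \<open>The bound holds with C itself, so \<delta> can be constantly zero.\<close>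
  then show ?thesis
    by (intro exI[of _ "\<lambda>_. 0"]) (simp add: Let_def C_def c_def)
qed

end
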